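(* Let $\ell_0,\ell_2$ be coprime integers with $0<\ell_0<\ell_2$. The $(\ell_0,\ell_2)$ family of rotational spectral genus one constant mean curvature (cmc) tori in $\mathbb{S}^3$ converges to the $(\ell_0,\ell_2)$ sphere bouquet as $q\to 0$.
   Context: Spectral genus one cmc surfaces. Let $q\in[-1,1]\setminus\{0\}$ and let $\lambda_j=e^{2i\theta_j}$ ($j=1,2$) be two distinct points of $\mathbb{S}^1$ (sym points). Put $\varphi=\theta_1-\theta_2$, $k=\cos(\theta_1+\theta_2)$, $h=\cos(\theta_1-\theta_2)$, and let $v=\mathrm{dn}(y,1-q^2)$ (Jacobi function with parameter $1-q^2$). The associated equivariant cmc surface is the immersion $f:\mathbb{R}^2\to\mathbb{S}^3$, unique up to isometry, with induced metric $\sin^2\varphi\,v^2(dx^2+dy^2)$ and second fundamental form $H\sin^2\varphi\,v^2(dx^2+dy^2)+\mathrm{Re}\left(Q\,(dx+i\,dy)^2\right)$, $H=\cot\varphi$ (so $|H|=|h|/\sqrt{1-h^2}$), $Q=\frac{i}{2}q(\lambda_2^{-1}-\lambda_1^{-1})$. It is a spectral genus one torus if $0<|q|<1$ and $f$ is doubly periodic; it is rotational (a surface of revolution) iff $\lambda_2=\lambda_1^{-1}$, i.e. $k^2=1$. For $q=\pm1$ it is flat. Flow. With $K'=K(\sqrt{1-q^2})$, $E'=E(\sqrt{1-q^2})$ complete elliptic integrals (of modulus $\sqrt{1-q^2}$), families of spectral genus one cmc tori are the integral curves of $\dot q=q(E'k-qK'h)$, $\dot k=\frac{1-k^2}{1-q^2}((1+q^2)E'-2q^2K')$,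 $\dot h=q\frac{1-h^2}{1-q^2}(2E'-(1+q^2)K')$, along which period lattices vary continuously. Rotational tori ($k^2=1$) stay rotational, and along each rotational family $|q|$ varies between $1$ (a flat cmc torus) and the limit $0$. The $(\ell_0,\ell_2)$ family. For a flat torus obtained at $q=\pm1$ with sym points $\lambda_1,\lambda_2$, put $\lambda_0=\mathrm{sign}(q)$ (a double point of its spectral curve), $m=(\lambda_0^{1/2},\lambda_1^{1/2},\lambda_2^{1/2})$, let $(s_0,s_1,s_2)$ be an integral real multiple of the real vector $i\,m\times\bar m$ with $\gcd(s_0,s_1+s_2,s_1-s_2)=2$, and set $(\ell_0,\ell_1,\ell_2)=\frac12(|s_0|,\min|s_1\pm s_2|,\max|s_1\pm s_2|)$. These are integers with $0\le\ell_1<\ell_0<\ell_2$ and $\gcd=1$, and $\ell_1=0$ in the rotational case, where one writes $(\ell_0,\ell_2)$ for $(\ell_0,0,\ell_2)$. The $(\ell_0,\ell_2)$ family is the rotational family of tori (with $0<|q|<1$) on the integral curve ending at $|q|=1$ at the flat torus with triple $(\ell_0,0,\ell_2)$. Sphere bouquets. For $m,n\in\mathbb{Z}$, $1\le m<n$, $\gcd(m,n)=1$, let $\alpha=\exp(2\pi i m/n)$ and let $C\subset\mathbb{C}\cup\{\infty\}$ be the union of the $n$ circles through $\alpha^j$ and $\alpha^{j+1}$ perpendicular to $\mathbb{S}^1$ ($j=0,\dots,n-1$). Inverse stereographic projection of $C$ to a geodesic 2-sphere of $\mathbb{S}^3$ and revolution about the image of $\mathbb{S}^1$ as axis produces the $(m,n)$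 sphere bouquet, consisting of $n$ pairwise tangent spheres forming a necklace; it coincides with the $(n-m,n)$ sphere bouquet. For $(m,n)=(1,2)$ the two spheres coincide. Convergence means convergence of the image surfaces (profile curves) as sets. *)

theory Defs
  imports "HOL-Analysis.Analysis"
begin

section \<open>Elliptic integrals and the Jacobi function dn\<close>

text \<open>Complete integrals take the modulus as argument; the incomplete integral and the
  Jacobi functions take the parameter, i.e. the square of the modulus.\<close>

definition elliptic_F :: "real \<Rightarrow> real \<Rightarrow> real" where
  "elliptic_F \<phi> m = (LBINT t=0..\<phi>. 1 / sqrt (1 - m * (sin t)\<^sup>2))"

definition elliptic_K :: "real \<Rightarrow> real" where
  "elliptic_K \<kappa> = (LBINT t=0..pi/2. 1 / sqrt (1 - \<kappa>\<^sup>2 * (sin t)\<^sup>2))"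

definition elliptic_E :: "real \<Rightarrow> real" where
  "elliptic_E \<kappa> = (LBINT t=0..pi/2. sqrt (1 - \<kappa>\<^sup>2 * (sin t)\<^sup>2))"

text \<open>For \<open>m < 1\<close> the map \<open>\<phi> \<mapsto> elliptic_F \<phi> m\<close> is an increasing bijection of the reals, and
  the amplitude is its inverse.\<close>

definition jacobi_am :: "real \<Rightarrow> real \<Rightarrow> real" where
  "jacobi_am y m = (THE \<phi>. elliptic_F \<phi> m = y)"

definition jacobi_dn :: "real \<Rightarrow> real \<Rightarrow> real" where
  "jacobi_dn y m = sqrt (1 - m * (sin (jacobi_am y m))\<^sup>2)"


section \<open>Immersed surfaces in the 3-sphere\<close>

text \<open>Euclidean 4-space is modelled as the product \<open>complex \<times> complex\<close>, whose real inner
  product is the Euclidean one; the 3-sphere is its unit sphere.\<close>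

type_synonym R4 = "complex \<times> complex"

text \<open>\<open>g\<close> is continuously differentiable with partial derivatives \<open>gx\<close> and \<open>gy\<close>.\<close>

definition C1_partials ::
  "(real \<times> real \<Rightarrow> R4) \<Rightarrow> (real \<times> real \<Rightarrow> R4) \<Rightarrow> (real \<times> real \<Rightarrow> R4) \<Rightarrow> bool" where
  "C1_partials g gx gy \<longleftrightarrow>
     continuous_on UNIV gx \<and> continuous_on UNIV gy \<and>
     (\<forall>x y. ((\<lambda>s. g (s, y)) has_vector_derivative gx (x, y)) (at x) \<and>
            ((\<lambda>s. g (x, s)) has_vector_derivative gy (x, y)) (at y))"

text \<open>\<open>f\<close> is an immersion of class C2 of the plane into the 3-sphere with first fundamental
  form \<open>I\<close> and, for some continuous unit normal field \<open>n\<close> in the 3-sphere, second fundamental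
  form \<open>II\<close>. Both are given as quadratic forms: \<open>I p (a, b)\<close> is the value at the point \<open>p\<close> on
  the tangent vector \<open>(a, b)\<close>. That \<open>f\<close> is an immersion is the positive definiteness of
  \<open>I\<close>.\<close>

definition has_fundamental_forms ::
  "(real \<times> real \<Rightarrow> R4) \<Rightarrow> (real \<times> real \<Rightarrow> real \<times> real \<Rightarrow> real) \<Rightarrow>
     (real \<times> real \<Rightarrow> real \<times> real \<Rightarrow> real) \<Rightarrow> bool" where
  "has_fundamental_forms f I II \<longleftrightarrow>
     range f \<subseteq> sphere 0 1 \<and>
     (\<forall>p a b. (a, b) \<noteq> (0, 0) \<longrightarrow> 0 < I p (a, b)) \<and>
     (\<exists>fx fy fxx fxy fyy n.
        C1_partials f fx fy \<and> C1_partials fx fxx fxy \<and> C1_partials fy fxy fyy \<and>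
        continuous_on UNIV n \<and>
        (\<forall>p. norm (n p) = 1 \<and> n p \<bullet> f p = 0 \<and> n p \<bullet> fx p = 0 \<and> n p \<bullet> fy p = 0) \<and>
        (\<forall>p a b. (norm (a *\<^sub>R fx p + b *\<^sub>R fy p))\<^sup>2 = I p (a, b)) \<and>
        (\<forall>p a b. (a\<^sup>2 *\<^sub>R fxx p + (2 * a * b) *\<^sub>R fxy p + b\<^sup>2 *\<^sub>R fyy p) \<bullet> n p
                    = II p (a, b)))"

definition sym_point :: "real \<Rightarrow> complex" where
  "sym_point \<theta> = exp (2 * \<i> * complex_of_real \<theta>)"

text \<open>\<open>f\<close> is (one of the mutually congruent choices of) the equivariant cmc surface with
  parameter \<open>q\<close> and sym points \<open>\<lambda>\<^sub>j = exp (2 i \<theta>\<^sub>j)\<close>.\<close>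

definition cmc_surface :: "real \<Rightarrow> real \<Rightarrow> real \<Rightarrow> (real \<times> real \<Rightarrow> R4) \<Rightarrow> bool" where
  "cmc_surface q \<theta>1 \<theta>2 f \<longleftrightarrow>
     q \<in> {-1..1} - {0} \<and> sym_point \<theta>1 \<noteq> sym_point \<theta>2 \<and>
     (let \<phi> = \<theta>1 - \<theta>2;
          H = cot \<phi>;
          Q = \<i> / 2 * complex_of_real q * (inverse (sym_point \<theta>2) - inverse (sym_point \<theta>1));
          v = (\<lambda>y. jacobi_dn y (1 - q\<^sup>2))
      in has_fundamental_forms f
           (\<lambda>(x, y) (a, b). (sin \<phi>)\<^sup>2 * (v y)\<^sup>2 * (a\<^sup>2 + b\<^sup>2))
           (\<lambda>(x, y) (a, b). H * (sin \<phi>)\<^sup>2 * (v y)\<^sup>2 * (a\<^sup>2 + b\<^sup>2) + Re (Q * (Complex a b)\<^sup>2)))"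

definition doubly_periodic :: "(real \<times> real \<Rightarrow> R4) \<Rightarrow> bool" where
  "doubly_periodic f \<longleftrightarrow>
     (\<exists>\<omega>1 \<omega>2. \<omega>1 \<noteq> \<omega>2 \<and> independent {\<omega>1, \<omega>2} \<and>
        (\<forall>p. f (p + \<omega>1) = f p \<and> f (p + \<omega>2) = f p))"


section \<open>The flow and its rotational families\<close>

definition cmc_flow_on ::
  "real set \<Rightarrow> real set \<Rightarrow> (real \<Rightarrow> real) \<Rightarrow> (real \<Rightarrow> real) \<Rightarrow> (real \<Rightarrow> real) \<Rightarrow> bool" where
  "cmc_flow_on S T q k h \<longleftrightarrow>
     (\<forall>t\<in>S.
        let E' = elliptic_E (sqrt (1 - (q t)\<^sup>2)); K' = elliptic_K (sqrt (1 - (q t)\<^sup>2)) in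
        (q has_real_derivative q t * (E' * k t - q t * K' * h t)) (at t within T) \<and>
        (k has_real_derivative
           (1 - (k t)\<^sup>2) / (1 - (q t)\<^sup>2) * ((1 + (q t)\<^sup>2) * E' - 2 * (q t)\<^sup>2 * K'))
           (at t within T) \<and>
        (h has_real_derivative
           q t * ((1 - (h t)\<^sup>2) / (1 - (q t)\<^sup>2)) * (2 * E' - (1 + (q t)\<^sup>2) * K'))
           (at t within T))"

text \<open>The triple \<open>(\<ell>\<^sub>0, \<ell>\<^sub>1, \<ell>\<^sub>2)\<close> of a flat torus. Here \<open>r\<^sub>j\<close> is a square root of \<open>\<lambda>\<^sub>j\<close>, so that
  \<open>(r\<^sub>0, r\<^sub>1, r\<^sub>2)\<close> is the vector \<open>m\<close>; the choice of the roots does not affect the triple. The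
  three equations for \<open>s\<^sub>j\<close> are the components of \<open>s = c i (m \<times> cnj m)\<close>.\<close>

definition flat_torus_triple :: "real \<Rightarrow> real \<Rightarrow> real \<Rightarrow> int \<Rightarrow> int \<Rightarrow> int \<Rightarrow> bool" where
  "flat_torus_triple q \<theta>1 \<theta>2 l0 l1 l2 \<longleftrightarrow> \<bar>q\<bar> = 1 \<and>
     (\<exists>r0 r1 r2 :: complex. \<exists>c :: real. \<exists>s0 s1 s2 :: int.
        r0\<^sup>2 = complex_of_real (sgn q) \<and> r1\<^sup>2 = sym_point \<theta>1 \<and> r2\<^sup>2 = sym_point \<theta>2 \<and>
        of_int s0 = complex_of_real c * (\<i> * (r1 * cnj r2 - r2 * cnj r1)) \<and>
        of_int s1 = complex_of_real c * (\<i> * (r2 * cnj r0 - r0 * cnj r2)) \<and>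
        of_int s2 = complex_of_real c * (\<i> * (r0 * cnj r1 - r1 * cnj r0)) \<and>
        gcd s0 (gcd (s1 + s2) (s1 - s2)) = 2 \<and>
        2 * l0 = \<bar>s0\<bar> \<and>
        2 * l1 = min \<bar>s1 + s2\<bar> \<bar>s1 - s2\<bar> \<and>
        2 * l2 = max \<bar>s1 + s2\<bar> \<bar>s1 - s2\<bar>)"

text \<open>The \<open>(\<ell>\<^sub>0, \<ell>\<^sub>2)\<close> family. The interval \<open>T\<close> parametrizes an integral curve of the flow
  that ends, at the endpoint \<open>b\<close> of \<open>T\<close>, at a flat torus with triple \<open>(\<ell>\<^sub>0, 0, \<ell>\<^sub>2)\<close>. The
  differential equation is only required off \<open>b\<close>, as its right-hand side is singular at
  \<open>|q| = 1\<close>; at \<open>b\<close> the curve is continuous. Along the curve \<open>|q|\<close> runs from 1 to the limit 0,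
  so \<open>T\<close> is in general unbounded. The family itself consists of the tori \<open>f t\<close> for \<open>t\<close> in
  \<open>T\<close> other than \<open>b\<close>. The sym points of each \<open>f t\<close> are determined by \<open>k t\<close> and \<open>h t\<close> up to
  symmetries that preserve the surface, so no continuity of \<open>\<theta>1\<close>, \<open>\<theta>2\<close> is required, and the
  immersions \<open>f t\<close> are chosen independently of each other among congruent ones.\<close>

definition rotational_family ::
  "int \<Rightarrow> int \<Rightarrow> real set \<Rightarrow> real \<Rightarrow> (real \<Rightarrow> real) \<Rightarrow> (real \<Rightarrow> real) \<Rightarrow> (real \<Rightarrow> real) \<Rightarrow>
     (real \<Rightarrow> real \<times> real \<Rightarrow> R4) \<Rightarrow> bool" where
  "rotational_family l0 l2 T b q \<theta>1 \<theta>2 f \<longleftrightarrow>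
     (let k = (\<lambda>t. cos (\<theta>1 t + \<theta>2 t)); h = (\<lambda>t. cos (\<theta>1 t - \<theta>2 t)) in
        is_interval T \<and> b \<in> T \<and> ((\<forall>t\<in>T. t \<le> b) \<or> (\<forall>t\<in>T. b \<le> t)) \<and>
        continuous_on T q \<and> continuous_on T k \<and> continuous_on T h \<and>
        cmc_flow_on (T - {b}) T q k h \<and>
        (\<forall>t\<in>T - {b}. 0 < \<bar>q t\<bar> \<and> \<bar>q t\<bar> < 1) \<and>
        (\<lambda>t. \<bar>q t\<bar>) ` T = {0<..1} \<and>
        flat_torus_triple (q b) (\<theta>1 b) (\<theta>2 b) l0 0 l2 \<and>
        (\<forall>t\<in>T. sym_point (\<theta>2 t) = inverse (sym_point (\<theta>1 t))) \<and>
        (\<forall>t\<in>T. cmc_surface (q t) (\<theta>1 t) (\<theta>2 t) (f t) \<and> doubly_periodic (f t)))"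


section \<open>Sphere bouquets\<close>

text \<open>The extended complex plane is \<open>complex option\<close>, with \<open>None\<close> as the point at infinity.
  A circle in it is a Euclidean circle or a Euclidean line together with infinity. At a common
  point \<open>z\<close> with the unit circle, perpendicularity is orthogonality of the radius vectors for a
  circle, and orthogonality of the direction to the tangent vector \<open>\<i> * z\<close> for a line.\<close>

definition perp_circle :: "complex option set \<Rightarrow> bool" where
  "perp_circle D \<longleftrightarrow>
     (\<exists>c r. 0 < r \<and> D = Some ` sphere c r \<and> sphere c r \<inter> sphere 0 1 \<noteq> {} \<and>
        (\<forall>z \<in> sphere c r \<inter> sphere 0 1. (z - c) \<bullet> z = 0)) \<or>
     (\<exists>p d. d \<noteq> 0 \<and>
        (let L = range (\<lambda>s::real. p + s *\<^sub>R d) in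
           D = insert None (Some ` L) \<and> L \<inter> sphere 0 1 \<noteq> {} \<and>
           (\<forall>z \<in> L \<inter> sphere 0 1. d \<bullet> (\<i> * z) = 0)))"

definition bouquet_circles :: "int \<Rightarrow> int \<Rightarrow> complex option set" where
  "bouquet_circles m n =
     (let \<alpha> = exp (2 * pi * \<i> * of_int m / of_int n) in
        \<Union>{D. perp_circle D \<and> (\<exists>j::nat. int j < n \<and> Some (\<alpha> ^ j) \<in> D \<and> Some (\<alpha> ^ (j + 1)) \<in> D)})"

text \<open>Inverse stereographic projection onto the geodesic 2-sphere
  \<open>{(w1, w2). Im w2 = 0}\<close> of the 3-sphere. It maps the unit circle identically onto the great
  circle \<open>w2 = 0\<close>, and the rotations of the 3-sphere fixing this axis pointwise are
  \<open>(w1, w2) \<mapsto> (w1, cis \<beta> * w2)\<close>.\<close>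

fun inv_stereographic :: "complex option \<Rightarrow> R4" where
  "inv_stereographic (Some z) =
     (2 * z / complex_of_real ((norm z)\<^sup>2 + 1), complex_of_real (((norm z)\<^sup>2 - 1) / ((norm z)\<^sup>2 + 1)))"
| "inv_stereographic None = (0, 1)"

definition sphere_bouquet :: "int \<Rightarrow> int \<Rightarrow> R4 set" where
  "sphere_bouquet m n =
     {(w1, cis \<beta> * w2) | w1 w2 \<beta>. (w1, w2) \<in> inv_stereographic ` bouquet_circles m n}"

definition hausdorff_close :: "real \<Rightarrow> 'a::metric_space set \<Rightarrow> 'a set \<Rightarrow> bool" where
  "hausdorff_close e X Y \<longleftrightarrow>
     (\<forall>x\<in>X. \<exists>y\<in>Y. dist x y < e) \<and> (\<forall>y\<in>Y. \<exists>x\<in>X. dist x y < e)"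

end

(* In conformal coordinates the induced frame of a rotational cmc surface satisfies linear equations
   whose coefficients depend on y only, so up to an isometry of the 3-sphere the surface is
   (zeta(y), r(y) cis (c x)).  In the amplitude variable theta, zeta has an explicit form with
   an angle integral, and zeta(theta + pi) = M zeta(theta) for a unit complex number M, the
   monodromy.  Double periodicity forces M to be a root of unity; being continuous along the family,
   M is therefore constant, and its value at the flat torus is exp (+-2 pi i l0/l2).  As q tends to 0,
   the arc of zeta over |theta| <= pi/2 approaches h + i sqrt (1 - h^2) sin theta uniformly in h, a plane
   section, hence M approaches (h + i sqrt (1 - h^2))^2.  This determines h up to sign in the limit,
   and the l2 rotated copies of the arc sweep out the l2 spheres of the bouquet. *)

theory Submission
  imports Defs
begin

section \<open>The amplitude and the function dn\<close>

text \<open>Let \<open>p\<close> stand for \<open>q k\<close>, with \<open>k = 1\<close> or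
  \<open>k = -1\<close>. The polar angle of the curve turns arbitrarily fast as \<open>h - p\<close>
  tends to 0, and nothing excludes this a priori, neither inside the family nor near
  \<open>q = 0\<close>. Hence the curve is split: the explicit factor \<open>profile_base\<close>
  carries the rapid turn, and the velocity of the remaining angle is at most a constant times 1/dn,
  uniformly near \<open>h = p\<close>. In this form the monodromy extends continuously across
  \<open>h = p\<close>. Such parameters occur at most once along the flow, since there
  \<open>h - p\<close> has derivative q (E' - K'), of fixed sign. The limit of \<open>h\<close> is
  not known in advance, so the estimates are uniform in \<open>h\<close>. For small \<open>p\<close>
  the velocity is even at most 20 |p| / dn. As dn itself decays to |p| at the ends of the arc,
  roughly like the cosine, integration costs a logarithm: the angle is of order |p| log (1/|p|),
  weakened here to sqrt |p|. The value of \<open>h\<close> comes last, from a square root of the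
  constant monodromy. The undetermined signs, of the exponent of the monodromy and of the root, are
  absorbed by an isometry and by reindexing the pieces of the bouquet.\<close>

definition ampl_dn :: "real \<Rightarrow> real \<Rightarrow> real" where
  "ampl_dn p \<theta> = sqrt (1 - (1 - p^2) * (sin \<theta>)^2)"

lemma ampl_dn_square: "(ampl_dn p \<theta>)^2 = (cos \<theta>)^2 + p^2 * (sin \<theta>)^2"
proof -
  have "1 - (1 - p^2) * (sin \<theta>)^2 = (cos \<theta>)^2 + p^2 * (sin \<theta>)^2"
    by (simp add: cos_squared_eq algebra_simps)
  then show ?thesis by (simp add: ampl_dn_def)
qed

lemma ampl_dn_square': "(ampl_dn p \<theta>)^2 = 1 - (1 - p^2) * (sin \<theta>)^2"
  by (simp add: ampl_dn_square cos_squared_eq algebra_simps)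

lemma ampl_dn_nonneg: "0 \<le> ampl_dn p \<theta>"
  using ampl_dn_square[of p \<theta>] by (metis ampl_dn_def ampl_dn_square' real_sqrt_ge_zero zero_le_power2)

lemma ampl_dn_pos:
  assumes "p \<noteq> 0" shows "0 < ampl_dn p \<theta>"
proof -
  have "(ampl_dn p \<theta>)^2 \<noteq> 0"
    using assms sin_cos_squared_add[of \<theta>]
    by (simp only: ampl_dn_square) (smt (verit) mult_nonneg_nonneg not_sum_power2_lt_zero power2_eq_square sum_power2_gt_zero_iff mult_eq_0_iff)
  then show ?thesis using ampl_dn_nonneg[of p \<theta>] by (simp add: less_le)
qed

lemma ampl_dn_le_1:
  assumes "\<bar>p\<bar> \<le> 1" shows "ampl_dn p \<theta> \<le> 1"
proof -
  have "p^2 \<le> 1" using assms by (simp add: abs_square_le_1)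
  then have "0 \<le> (1 - p^2) * (sin \<theta>)^2" by simp
  then show ?thesis by (simp add: ampl_dn_def)
qed

lemma ampl_dn_ge:
  assumes "\<bar>p\<bar> \<le> 1" shows "\<bar>p\<bar> \<le> ampl_dn p \<theta>"
proof -
  have "p^2 \<le> 1" using assms by (simp add: abs_square_le_1)
  then have "p^2 * (cos \<theta>)^2 \<le> 1 * (cos \<theta>)^2" by (intro mult_right_mono) auto
  then have "\<bar>p\<bar>^2 \<le> (ampl_dn p \<theta>)^2"
    by (simp add: ampl_dn_square sin_squared_eq algebra_simps)
  then show ?thesis using ampl_dn_nonneg by (rule power2_le_imp_le)
qed

lemma ampl_dn_ge_cos: "\<bar>cos \<theta>\<bar> \<le> ampl_dn p \<theta>"
proof -
  have "\<bar>cos \<theta>\<bar>^2 \<le> (ampl_dn p \<theta>)^2"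
    by (simp add: ampl_dn_square)
  then show ?thesis using ampl_dn_nonneg by (rule power2_le_imp_le)
qed

lemma ampl_dn_minus [simp]: "ampl_dn p (- \<theta>) = ampl_dn p \<theta>"
  by (simp add: ampl_dn_def)

lemma ampl_dn_periodic [simp]: "ampl_dn p (\<theta> + pi) = ampl_dn p \<theta>"
  by (simp add: ampl_dn_def)

lemma ampl_dn_0 [simp]: "ampl_dn p 0 = 1"
  by (simp add: ampl_dn_def)

lemma continuous_on_ampl_dn [continuous_intros]:
  fixes f g :: "'a::t2_space \<Rightarrow> real"
  shows "continuous_on A f \<Longrightarrow> continuous_on A g \<Longrightarrow> continuous_on A (\<lambda>x. ampl_dn (f x) (g x))"
  unfolding ampl_dn_def by (intro continuous_intros)

lemma DERIV_ampl_dn: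
  assumes "p \<noteq> 0"
  shows "(ampl_dn p has_real_derivative (- (1 - p^2) * sin \<theta> * cos \<theta> / ampl_dn p \<theta>)) (at \<theta>)"
proof -
  have pos: "0 < 1 - (1 - p^2) * (sin \<theta>)^2"
    using ampl_dn_pos[OF assms, of \<theta>] by (simp add: ampl_dn_def)
  have "((\<lambda>\<theta>. sqrt (1 - (1 - p^2) * (sin \<theta>)^2)) has_real_derivative
      (- (1 - p^2) * sin \<theta> * cos \<theta> / sqrt (1 - (1 - p^2) * (sin \<theta>)^2))) (at \<theta>)"
    using pos by (auto intro!: derivative_eq_intros simp: divide_simps algebra_simps)
  then show ?thesis unfolding ampl_dn_def[abs_def] .
qed

section \<open>The incomplete elliptic integral and its inverse, the amplitude\<close>

abbreviation ampl_F :: "real \<Rightarrow> real \<Rightarrow> real" where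
  "ampl_F p \<theta> \<equiv> elliptic_F \<theta> (1 - p^2)"

lemma ampl_F_eq: "ampl_F p \<theta> = (LBINT t=0..\<theta>. 1 / ampl_dn p t)"
  by (simp add: elliptic_F_def ampl_dn_def)

lemma ampl_F_0 [simp]: "ampl_F p 0 = 0"
  by (simp add: elliptic_F_def zero_ereal_def[symmetric])

lemma DERIV_LBINT:
  fixes g :: "real \<Rightarrow> real"
  assumes "continuous_on UNIV g"
  shows "((\<lambda>u. LBINT t=0..u. g t) has_real_derivative g x) (at x)"
proof -
  let ?a = "- \<bar>x\<bar> - 1" and ?b = "\<bar>x\<bar> + 1"
  have "((\<lambda>u. LBINT t=ereal 0..u. g t) has_vector_derivative g x) (at x within {?a..?b})"
    by (rule interval_integral_FTC2) (auto intro: continuous_on_subset[OF assms])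
  then have "((\<lambda>u. LBINT t=0..u. g t) has_vector_derivative g x) (at x)"
    by (subst (asm) at_within_interior) (auto simp: zero_ereal_def)
  then show ?thesis by (simp add: has_real_derivative_iff_has_vector_derivative)
qed

lemma DERIV_ampl_F:
  assumes "p \<noteq> 0"
  shows "(ampl_F p has_real_derivative 1 / ampl_dn p \<theta>) (at \<theta>)"
  unfolding ampl_F_eq[abs_def]
  by (rule DERIV_LBINT)
     (auto intro!: continuous_intros simp: ampl_dn_pos[OF assms, THEN less_imp_neq, symmetric])

lemma ampl_F_strict_mono:
  assumes "p \<noteq> 0" shows "strict_mono (ampl_F p)"
proof (rule strict_monoI)
  fix x y :: real assume "x < y"
  then show "ampl_F p x < ampl_F p y"
    by (rule DERIV_pos_imp_increasing) (use DERIV_ampl_F[OF assms] ampl_dn_pos[OF assms] in \<open>auto intro!: exI\<close>)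
qed

text \<open>The derivative \<open>1 / ampl_dn\<close> is at least 1 when |p| <= 1. This expansion
  makes the integral reach every real value.\<close>

lemma ampl_F_expanding:
  assumes "p \<noteq> 0" "\<bar>p\<bar> \<le> 1" "x \<le> y" shows "y - x \<le> ampl_F p y - ampl_F p x"
proof -
  have "ampl_F p x - x \<le> ampl_F p y - y"
  proof (rule DERIV_nonneg_imp_nondecreasing[OF \<open>x \<le> y\<close>])
    fix z
    have "((\<lambda>x. ampl_F p x - x) has_real_derivative 1 / ampl_dn p z - 1) (at z)"
      by (intro derivative_intros DERIV_ampl_F assms)
    moreover have "0 \<le> 1 / ampl_dn p z - 1"
      using ampl_dn_pos[OF assms(1), of z] ampl_dn_le_1[OF assms(2), of z] by simp
    ultimately show "\<exists>y. ((\<lambda>x. ampl_F p x - x) has_real_derivative y) (at z) \<and> 0 \<le> y" by blast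
  qed
  then show ?thesis by simp
qed

lemma ampl_F_surj:
  assumes "p \<noteq> 0" "\<bar>p\<bar> \<le> 1" shows "\<exists>\<theta>. ampl_F p \<theta> = y"
proof -
  have cont: "isCont (ampl_F p) x" for x
    using DERIV_ampl_F[OF assms(1)] DERIV_isCont by blast
  have "ampl_F p (- \<bar>y\<bar>) \<le> y" "y \<le> ampl_F p \<bar>y\<bar>"
    using ampl_F_expanding[OF assms, of "- \<bar>y\<bar>" 0] ampl_F_expanding[OF assms, of 0 "\<bar>y\<bar>"] by auto
  then show ?thesis
    using IVT[of "ampl_F p" "- \<bar>y\<bar>" y "\<bar>y\<bar>"] cont by auto
qed

lemma jacobi_am_F:
  assumes "p \<noteq> 0" shows "jacobi_am (ampl_F p \<theta>) (1 - p^2) = \<theta>"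
  unfolding jacobi_am_def
  by (rule the_equality) (auto dest: injD[OF strict_mono_imp_inj_on[OF ampl_F_strict_mono[OF assms]]])

lemma F_jacobi_am:
  assumes "p \<noteq> 0" "\<bar>p\<bar> \<le> 1" shows "ampl_F p (jacobi_am y (1 - p^2)) = y"
  using ampl_F_surj[OF assms] jacobi_am_F[OF assms(1)] by metis

lemma jacobi_dn_eq: "jacobi_dn y (1 - p^2) = ampl_dn p (jacobi_am y (1 - p^2))"
  by (simp add: jacobi_dn_def ampl_dn_def)

lemma jacobi_dn_F: "p \<noteq> 0 \<Longrightarrow> jacobi_dn (ampl_F p \<theta>) (1 - p^2) = ampl_dn p \<theta>"
  by (simp add: jacobi_dn_eq jacobi_am_F)

lemma DERIV_jacobi_am:
  assumes "p \<noteq> 0" "\<bar>p\<bar> \<le> 1"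
  shows "((\<lambda>y. jacobi_am y (1 - p^2)) has_real_derivative jacobi_dn y (1 - p^2)) (at y)"
proof -
  let ?am = "\<lambda>y. jacobi_am y (1 - p^2)"
  have cont: "isCont ?am y"
  proof -
    have "isCont ?am (ampl_F p (?am y))"
      by (rule isCont_inverse_function[where d = 1])
         (auto simp: jacobi_am_F assms DERIV_isCont[OF DERIV_ampl_F[OF assms(1)]])
    then show ?thesis by (simp add: F_jacobi_am assms)
  qed
  have "(?am has_real_derivative inverse (1 / ampl_dn p (?am y))) (at y)"
    by (rule DERIV_inverse_function[where f = "ampl_F p" and a = "y - 1" and b = "y + 1"])
       (use DERIV_ampl_F[OF assms(1)] ampl_dn_pos[OF assms(1), of "?am y"] cont in \<open>auto simp: F_jacobi_am assms\<close>)
  then show ?thesis by (simp add: jacobi_dn_eq)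
qed

lemma DERIV_jacobi_dn:
  assumes "p \<noteq> 0" "\<bar>p\<bar> \<le> 1"
  shows "((\<lambda>y. jacobi_dn y (1 - p^2)) has_real_derivative
     - (1 - p\<^sup>2) * sin (jacobi_am y (1 - p\<^sup>2)) * cos (jacobi_am y (1 - p\<^sup>2))) (at y)"
proof -
  note DERIV_chain2[OF DERIV_ampl_dn[OF assms(1)] DERIV_jacobi_am[OF assms], of y]
  then show ?thesis
    using ampl_dn_pos[OF assms(1), of "jacobi_am y (1 - p^2)"] by (simp add: jacobi_dn_eq)
qed

section \<open>Orthonormal frames\<close>

definition orthonormal4 :: "R4 \<Rightarrow> R4 \<Rightarrow> R4 \<Rightarrow> R4 \<Rightarrow> bool" where
  "orthonormal4 e1 e2 e3 e4 \<longleftrightarrow>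
     e1 \<bullet> e1 = 1 \<and> e2 \<bullet> e2 = 1 \<and> e3 \<bullet> e3 = 1 \<and> e4 \<bullet> e4 = 1 \<and>
     e1 \<bullet> e2 = 0 \<and> e1 \<bullet> e3 = 0 \<and> e1 \<bullet> e4 = 0 \<and> e2 \<bullet> e3 = 0 \<and> e2 \<bullet> e4 = 0 \<and> e3 \<bullet> e4 = 0"

lemma orthonormal4_expand:
  assumes "orthonormal4 e1 e2 e3 e4"
  shows "v = (v \<bullet> e1) *\<^sub>R e1 + (v \<bullet> e2) *\<^sub>R e2 + (v \<bullet> e3) *\<^sub>R e3 + (v \<bullet> e4) *\<^sub>R e4"
proof -
  let ?B = "{e1, e2, e3, e4}"
  have d: "e1 \<noteq> e2" "e1 \<noteq> e3" "e1 \<noteq> e4" "e2 \<noteq> e3" "e2 \<noteq> e4" "e3 \<noteq> e4"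
    using assms unfolding orthonormal4_def by auto
  have orth: "pairwise orthogonal ?B"
    using assms unfolding orthonormal4_def pairwise_def orthogonal_def
    by (auto simp: inner_commute)
  have nz: "0 \<notin> ?B"
    using assms unfolding orthonormal4_def by auto
  have "independent ?B"
    using orth nz by (rule pairwise_orthogonal_independent)
  moreover have "card ?B = DIM(R4)"
    using d by simp
  ultimately have "UNIV \<subseteq> span ?B"
    by (intro card_ge_dim_independent) auto
  then have "v \<in> span ?B" by auto
  then have "(\<Sum>b\<in>?B. (v \<bullet> b) *\<^sub>R b) = v"
    by (intro orthonormal_basis_expand orth)
       (use assms in \<open>auto simp: orthonormal4_def norm_eq_sqrt_inner\<close>)
  then show ?thesis
    using d by (simp add: add.assoc)
qed

lemma orthonormal4_eqI:
  assumes "orthonormal4 e1 e2 e3 e4"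
    and "v \<bullet> e1 = w \<bullet> e1" "v \<bullet> e2 = w \<bullet> e2" "v \<bullet> e3 = w \<bullet> e3" "v \<bullet> e4 = w \<bullet> e4"
  shows "v = w"
  using orthonormal4_expand[OF assms(1), of v] orthonormal4_expand[OF assms(1), of w] assms(2-)
  by simp

lemma orthonormal4_inner:
  assumes "orthonormal4 e1 e2 e3 e4"
  shows "v \<bullet> w = (v \<bullet> e1) * (w \<bullet> e1) + (v \<bullet> e2) * (w \<bullet> e2) + (v \<bullet> e3) * (w \<bullet> e3) + (v \<bullet> e4) * (w \<bullet> e4)"
proof -
  have "v \<bullet> w = v \<bullet> ((w \<bullet> e1) *\<^sub>R e1 + (w \<bullet> e2) *\<^sub>R e2 + (w \<bullet> e3) *\<^sub>R e3 + (w \<bullet> e4) *\<^sub>R e4)"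
    using orthonormal4_expand[OF assms, of w] by simp
  then show ?thesis by (simp add: inner_add_right mult.commute)
qed

lemma orthogonal_transformation_coordinates:
  assumes "orthonormal4 e1 e2 e3 e4"
  shows "orthogonal_transformation (\<lambda>v. (Complex (v \<bullet> e1) (v \<bullet> e2), Complex (v \<bullet> e3) (v \<bullet> e4)))"
  unfolding orthogonal_transformation_def
proof (intro conjI allI)
  show "linear (\<lambda>v. (Complex (v \<bullet> e1) (v \<bullet> e2), Complex (v \<bullet> e3) (v \<bullet> e4)))"
    by (rule linearI) (auto simp: inner_add_left complex_eq_iff)
  show "(Complex (v \<bullet> e1) (v \<bullet> e2), Complex (v \<bullet> e3) (v \<bullet> e4)) \<bullet>
        (Complex (w \<bullet> e1) (w \<bullet> e2), Complex (w \<bullet> e3) (w \<bullet> e4)) = v \<bullet> w" for v w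
    by (simp add: orthonormal4_inner[OF assms, of v w] inner_complex_def)
qed

lemma has_real_derivative_inner:
  fixes F G :: "real \<Rightarrow> 'a::real_inner"
  assumes "(F has_vector_derivative D) (at x)" "(G has_vector_derivative E) (at x)"
  shows "((\<lambda>s. F s \<bullet> G s) has_real_derivative F x \<bullet> E + D \<bullet> G x) (at x)"
  unfolding has_real_derivative_iff_has_vector_derivative
  by (rule bounded_bilinear.has_vector_derivative[OF bounded_bilinear_inner assms])

lemma inner_derivative_eq:
  fixes F G :: "real \<Rightarrow> 'a::real_inner"
  assumes "(F has_vector_derivative D) (at x)" "(G has_vector_derivative E) (at x)"
    and "\<And>s. F s \<bullet> G s = \<phi> s" and "(\<phi> has_real_derivative d) (at x)"
  shows "F x \<bullet> E + D \<bullet> G x = d"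
  using has_real_derivative_inner[OF assms(1,2)] assms(4) DERIV_unique
  unfolding assms(3) by blast

text \<open>Near \<open>s0\<close> the normal is the normalized projection of \<open>N s0\<close> off the span of the other
  three vectors, which is differentiable although \<open>N\<close> is only assumed continuous.\<close>

lemma has_vector_derivative_normal:
  assumes on: "\<And>s. orthonormal4 (F1 s) (F2 s) (F3 s) (N s)"
    and cont: "isCont N s0"
    and D1: "(F1 has_vector_derivative D1) (at s0)"
    and D2: "(F2 has_vector_derivative D2) (at s0)"
    and D3: "(F3 has_vector_derivative D3) (at s0)"
  shows "(N has_vector_derivative
     - ((N s0 \<bullet> D1) *\<^sub>R F1 s0 + (N s0 \<bullet> D2) *\<^sub>R F2 s0 + (N s0 \<bullet> D3) *\<^sub>R F3 s0)) (at s0)"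
proof -
  define u where "u = N s0"
  define m where "m s = u - ((u \<bullet> F1 s) *\<^sub>R F1 s + (u \<bullet> F2 s) *\<^sub>R F2 s + (u \<bullet> F3 s) *\<^sub>R F3 s)" for s
  define m' where "m' = - ((u \<bullet> D1) *\<^sub>R F1 s0 + (u \<bullet> D2) *\<^sub>R F2 s0 + (u \<bullet> D3) *\<^sub>R F3 s0)"
  have m: "m s = (u \<bullet> N s) *\<^sub>R N s" for s
    using orthonormal4_expand[OF on[of s], of u] unfolding m_def by (simp add: algebra_simps)
  have um: "u \<bullet> m s = (u \<bullet> N s)^2" for s
    by (simp add: m power2_eq_square)
  have u0: "u \<bullet> F1 s0 = 0" "u \<bullet> F2 s0 = 0" "u \<bullet> F3 s0 = 0" "u \<bullet> u = 1"
    using on[of s0] unfolding u_def orthonormal4_def by (auto simp: inner_commute)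
  have m0: "m s0 = u" by (simp add: m_def u0)
  have dc: "((\<lambda>s. u \<bullet> G s) has_real_derivative u \<bullet> D) (at s0)"
    if "(G has_vector_derivative D) (at s0)" for G :: "real \<Rightarrow> R4" and D
    using has_real_derivative_inner[OF has_vector_derivative_const[of u] that] by simp
  have dm: "(m has_vector_derivative m') (at s0)"
    unfolding m_def[abs_def] m'_def
    by (rule derivative_eq_intros dc D1 D2 D3 refl | simp add: u0)+
  \<comment> \<open>\<open>u \<bullet> m s\<close> is the squared cosine of the angle between
    \<open>u\<close> and \<open>N s\<close>, which is maximal at \<open>s0\<close>; so the
    normalizing factor is stationary there and \<open>m'\<close> is also the derivative of the
    normalized vector.\<close>
  have dq: "((\<lambda>s. u \<bullet> m s) has_real_derivative 0) (at s0)"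
    using dc[OF dm] by (simp add: m'_def inner_add_right inner_diff_right u0)
  have dr: "((\<lambda>s. inverse (sqrt (u \<bullet> m s))) has_real_derivative 0) (at s0)"
    using dq by (auto intro!: derivative_eq_intros simp: m0 u0)
  have dN: "((\<lambda>s. inverse (sqrt (u \<bullet> m s)) *\<^sub>R m s) has_vector_derivative m') (at s0)"
    by (rule has_vector_derivative_eq_rhs[OF has_vector_derivative_scaleR[OF dr dm]])
       (simp add: m0 u0)
  have "isCont (\<lambda>s. u \<bullet> N s) s0"
    using cont by (intro continuous_intros)
  then have "eventually (\<lambda>s. 0 < u \<bullet> N s) (at s0)"
    unfolding isCont_def by (rule order_tendstoD) (simp add: u_def[symmetric] u0)
  then have ev: "eventually (\<lambda>s. 0 < u \<bullet> N s) (nhds s0)"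
    by (simp add: eventually_nhds_conv_at u_def[symmetric] u0)
  \<comment> \<open>Positivity of \<open>u \<bullet> N s\<close> near \<open>s0\<close> makes the
    normalized projection equal to \<open>N s\<close> and not to its negative.\<close>
  have "eventually (\<lambda>s. inverse (sqrt (u \<bullet> m s)) *\<^sub>R m s = N s) (nhds s0)"
    using ev by eventually_elim (simp add: um m)
  then have "(N has_vector_derivative m') (at s0)"
    using dN by (subst (asm) has_vector_derivative_cong_ev[where g = N]) (auto simp: u0 m0 u_def[symmetric] eventually_nhds_conv_at)
  then show ?thesis unfolding m'_def u_def .
qed

lemma vector_derivative_zero_const:
  fixes F :: "real \<Rightarrow> 'a::real_normed_vector"
  assumes "\<And>x. (F has_vector_derivative 0) (at x)"
  shows "F x = F y"
proof -
  have "F constant_on UNIV"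
    by (rule has_derivative_zero_constant[OF convex_UNIV, THEN exE])
       (use assms in \<open>auto simp: has_vector_derivative_def constant_on_def\<close>)
  then show ?thesis by (auto simp: constant_on_def)
qed

section \<open>The rotational normal form\<close>

lemma jacobi_dn_0:
  assumes "p \<noteq> 0" shows "jacobi_dn 0 (1 - p^2) = 1" "jacobi_am 0 (1 - p^2) = 0"
  using jacobi_dn_F[OF assms, of 0] jacobi_am_F[OF assms, of 0] by auto

text \<open>Here \<open>z\<close> is sin \<phi> and \<open>h\<close> is cos \<phi>. The sign
  \<open>k\<close> of a rotational surface enters only through \<open>p = q k\<close>: the parameter
  1 - q^2 of dn is the same for \<open>p\<close>, and Q is the real number -p z, so the last term of
  \<open>fund2\<close> is Re (Q (a + i b)^2).\<close>

locale rotational_surface =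
  fixes p h z :: real and f fx fy fxx fxy fyy n :: "real \<times> real \<Rightarrow> R4"
  assumes p0: "p \<noteq> 0" and p1: "\<bar>p\<bar> \<le> 1" and z0: "z \<noteq> 0" and hz: "h^2 + z^2 = 1"
    and sph: "range f \<subseteq> sphere 0 1"
    and Cf: "C1_partials f fx fy" and Cfx: "C1_partials fx fxx fxy" and Cfy: "C1_partials fy fxy fyy"
    and n_cont: "continuous_on UNIV n"
    and n_normal: "\<And>q. norm (n q) = 1 \<and> n q \<bullet> f q = 0 \<and> n q \<bullet> fx q = 0 \<and> n q \<bullet> fy q = 0"
    and fund1: "\<And>x y a b. (norm (a *\<^sub>R fx (x, y) + b *\<^sub>R fy (x, y)))^2
                  = z^2 * (jacobi_dn y (1 - p^2))^2 * (a^2 + b^2)"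
    and fund2: "\<And>x y a b. (a^2 *\<^sub>R fxx (x, y) + (2 * a * b) *\<^sub>R fxy (x, y) + b^2 *\<^sub>R fyy (x, y)) \<bullet> n (x, y)
                  = h * z * (jacobi_dn y (1 - p^2))^2 * (a^2 + b^2) - p * z * (a^2 - b^2)"
begin

definition "v y = jacobi_dn y (1 - p^2)"
definition "v' y = - (1 - p^2) * sin (jacobi_am y (1 - p^2)) * cos (jacobi_am y (1 - p^2))"
text \<open>The metric is \<rho>^2 (dx^2 + dy^2); \<open>L\<close> and \<open>M\<close> are the
  coefficients of dx^2 and dy^2 in the second fundamental form, and \<open>\<mu>\<close> is
  \<open>\<rho>\<close> times the principal curvature in the y direction.\<close>

definition "\<rho> y = \<bar>z\<bar> * v y"
definition "\<rho>' y = \<bar>z\<bar> * v' y"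
definition "L y = z * (h * (v y)^2 - p)"
definition "M y = z * (h * (v y)^2 + p)"
definition "c = sqrt (1 + p^2 - 2 * p * h)"
definition "\<mu> y = M y / \<rho> y"

lemma v_pos: "0 < v y"
  unfolding v_def jacobi_dn_eq by (rule ampl_dn_pos[OF p0])

lemma \<rho>_pos: "0 < \<rho> y"
  using v_pos z0 by (simp add: \<rho>_def)

lemma \<rho>_nz [simp]: "\<rho> y \<noteq> 0"
  using \<rho>_pos[of y] by simp

lemma v'_square: "(v' y)^2 = (1 - (v y)^2) * ((v y)^2 - p^2)"
  unfolding v_def v'_def jacobi_dn_eq ampl_dn_square'
  using sin_cos_squared_add[of "jacobi_am y (1 - p^2)"] by algebra

lemma DERIV_v: "(v has_real_derivative v' y) (at y)"
  using DERIV_jacobi_dn[OF p0 p1] unfolding v_def[abs_def] v'_def by simp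

lemma DERIV_\<rho>: "(\<rho> has_real_derivative \<rho>' y) (at y)"
  unfolding \<rho>_def[abs_def] \<rho>'_def by (rule DERIV_cmult[OF DERIV_v])

lemma v_0: "v 0 = 1" "v' 0 = 0"
  by (simp_all add: v_def v'_def jacobi_dn_0 p0)

lemma c_square: "c^2 = z^2 + (h - p)^2" and c_pos: "0 < c"
proof -
  have e: "1 + p^2 - 2 * p * h = z^2 + (h - p)^2"
    using hz by (simp add: power2_eq_square algebra_simps)
  have "0 < z^2 + (h - p)^2"
    using z0 by (intro add_pos_nonneg) auto
  then show "c^2 = z^2 + (h - p)^2" "0 < c"
    unfolding c_def e by auto
qed

text \<open>The left-hand side is the squared length of \<open>W\<close>, the x-derivative of the
  unit vector \<open>ex\<close> introduced below. It is a first integral: the differential equation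
  \<open>v'_square\<close> of dn cancels the dependence on \<open>v\<close>.\<close>

lemma c_identity: "(\<rho> y)^2 + (\<rho>' y)^2 / (\<rho> y)^2 + (L y)^2 / (\<rho> y)^2 = c^2"
proof -
  have vy: "v y \<noteq> 0" using v_pos[of y] by simp
  have r: "(\<rho> y)^2 = z^2 * (v y)^2" "(\<rho>' y)^2 = z^2 * ((1 - (v y)^2) * ((v y)^2 - p^2))"
    by (simp_all add: \<rho>_def \<rho>'_def power_mult_distrib v'_square)
  have "z^2 * (v y)^2 * (z^2 * (v y)^2) + z^2 * ((1 - (v y)^2) * ((v y)^2 - p^2)) + (z * (h * (v y)^2 - p))^2
      = c^2 * (z^2 * (v y)^2)"
    unfolding c_square using hz by algebra
  then have "(\<rho> y)^2 * (\<rho> y)^2 + (\<rho>' y)^2 + (L y)^2 = c^2 * (\<rho> y)^2"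
    by (simp add: r L_def)
  then show ?thesis
    by (simp add: divide_simps power2_eq_square algebra_simps)
qed

lemma partials:
  "((\<lambda>s. f (s, y)) has_vector_derivative fx (x, y)) (at x)"
  "((\<lambda>s. f (x, s)) has_vector_derivative fy (x, y)) (at y)"
  "((\<lambda>s. fx (s, y)) has_vector_derivative fxx (x, y)) (at x)"
  "((\<lambda>s. fx (x, s)) has_vector_derivative fxy (x, y)) (at y)"
  "((\<lambda>s. fy (s, y)) has_vector_derivative fxy (x, y)) (at x)"
  "((\<lambda>s. fy (x, s)) has_vector_derivative fyy (x, y)) (at y)"
  using Cf Cfx Cfy unfolding C1_partials_def by auto

lemma ff: "f q \<bullet> f q = 1"
proof -
  have "f q \<in> sphere 0 1" using sph by blast
  then have "norm (f q) = 1" by simp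
  then show ?thesis by (simp add: norm_eq_1)
qed

lemma nn: "n q \<bullet> n q = 1"
  using n_normal[of q] by (simp add: norm_eq_1)

lemma metric:
  "fx (x, y) \<bullet> fx (x, y) = (\<rho> y)^2" "fy (x, y) \<bullet> fy (x, y) = (\<rho> y)^2" "fx (x, y) \<bullet> fy (x, y) = 0"
proof -
  have r: "z^2 * (jacobi_dn y (1 - p^2))^2 = (\<rho> y)^2"
    by (simp add: \<rho>_def v_def power_mult_distrib)
  show 1: "fx (x, y) \<bullet> fx (x, y) = (\<rho> y)^2"
    using fund1[of 1 x y 0] by (simp add: r dot_square_norm)
  show 2: "fy (x, y) \<bullet> fy (x, y) = (\<rho> y)^2"
    using fund1[of 0 x y 1] by (simp add: r dot_square_norm)
  show "fx (x, y) \<bullet> fy (x, y) = 0"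
    using fund1[of 1 x y 1] 1 2
    by (simp add: r power2_norm_eq_inner inner_add_left inner_add_right inner_commute)
qed

lemma second_form:
  "fxx (x, y) \<bullet> n (x, y) = L y" "fyy (x, y) \<bullet> n (x, y) = M y" "fxy (x, y) \<bullet> n (x, y) = 0"
proof -
  show 1: "fxx (x, y) \<bullet> n (x, y) = L y"
    using fund2[of 1 x y 0] by (simp add: L_def v_def algebra_simps)
  show 2: "fyy (x, y) \<bullet> n (x, y) = M y"
    using fund2[of 0 x y 1] by (simp add: M_def v_def algebra_simps)
  show "fxy (x, y) \<bullet> n (x, y) = 0"
    using fund2[of 1 x y 1] 1 2 by (simp add: inner_add_left L_def M_def v_def algebra_simps)
qed

lemma f_tangent: "f q \<bullet> fx q = 0" "f q \<bullet> fy q = 0"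
proof -
  obtain x y where q: "q = (x, y)" by (cases q)
  show "f q \<bullet> fx q = 0"
    using inner_derivative_eq[OF partials(1) partials(1) ff DERIV_const, of x y] by (simp add: inner_commute q)
  show "f q \<bullet> fy q = 0"
    using inner_derivative_eq[OF partials(2) partials(2) ff DERIV_const, of x y] by (simp add: inner_commute q)
qed

definition "ex q = (1 / \<rho> (snd q)) *\<^sub>R fx q"
definition "ey q = (1 / \<rho> (snd q)) *\<^sub>R fy q"

lemma frame: "orthonormal4 (f q) (ex q) (ey q) (n q)"
proof -
  obtain x y where q: "q = (x, y)" by (cases q)
  show ?thesis
    using n_normal[of q]
    by (simp add: orthonormal4_def ff nn q ex_def ey_def metric f_tangent inner_commute power2_eq_square)
qed

text \<open>Differentiating the inner products of \<open>f\<close>, \<open>fx\<close> and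
  \<open>fy\<close>, all of which depend on \<open>y\<close> alone, yields the Christoffel symbols
  of the conformal metric.\<close>

lemma second_derivative_products:
  "f (x, y) \<bullet> fxx (x, y) = - (\<rho> y)\<^sup>2" "f (x, y) \<bullet> fxy (x, y) = 0" "f (x, y) \<bullet> fyy (x, y) = - (\<rho> y)\<^sup>2"
  "fx (x, y) \<bullet> fxx (x, y) = 0" "fx (x, y) \<bullet> fxy (x, y) = \<rho> y * \<rho>' y" "fx (x, y) \<bullet> fyy (x, y) = 0"
  "fy (x, y) \<bullet> fxx (x, y) = - \<rho> y * \<rho>' y" "fy (x, y) \<bullet> fxy (x, y) = 0" "fy (x, y) \<bullet> fyy (x, y) = \<rho> y * \<rho>' y"
proof -
  have d\<rho>: "((\<lambda>y. (\<rho> y)^2) has_real_derivative 2 * \<rho> y * \<rho>' y) (at y)"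
    by (rule derivative_eq_intros DERIV_\<rho> refl | simp)+
  show "f (x, y) \<bullet> fxx (x, y) = - (\<rho> y)\<^sup>2"
    using inner_derivative_eq[OF partials(1) partials(3) f_tangent(1) DERIV_const, of x y] by (simp add: metric)
  show "f (x, y) \<bullet> fxy (x, y) = 0"
    using inner_derivative_eq[OF partials(2) partials(4) f_tangent(1) DERIV_const, of x y]
    by (simp add: metric inner_commute)
  show "f (x, y) \<bullet> fyy (x, y) = - (\<rho> y)\<^sup>2"
    using inner_derivative_eq[OF partials(2) partials(6) f_tangent(2) DERIV_const, of x y] by (simp add: metric)
  show "fx (x, y) \<bullet> fxx (x, y) = 0"
    using inner_derivative_eq[OF partials(3) partials(3) metric(1) DERIV_const, of x y] by (simp add: inner_commute)
  show "fx (x, y) \<bullet> fxy (x, y) = \<rho> y * \<rho>' y"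
    using inner_derivative_eq[OF partials(4) partials(4) metric(1) d\<rho>, of x] by (simp add: inner_commute)
  show "fy (x, y) \<bullet> fyy (x, y) = \<rho> y * \<rho>' y"
    using inner_derivative_eq[OF partials(6) partials(6) metric(2) d\<rho>, of x] by (simp add: inner_commute)
  show *: "fy (x, y) \<bullet> fxy (x, y) = 0"
    using inner_derivative_eq[OF partials(5) partials(5) metric(2) DERIV_const, of x y] by (simp add: inner_commute)
  show "fy (x, y) \<bullet> fxx (x, y) = - \<rho> y * \<rho>' y"
    using inner_derivative_eq[OF partials(3) partials(5) metric(3) DERIV_const, of x y]
      \<open>fx (x, y) \<bullet> fxy (x, y) = \<rho> y * \<rho>' y\<close> by (simp add: inner_commute)
  show "fx (x, y) \<bullet> fyy (x, y) = 0"
    using inner_derivative_eq[OF partials(4) partials(6) metric(3) DERIV_const, of x y] * by (simp add: inner_commute)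
qed

lemma inner_table:
  "f (x, y) \<bullet> f (x, y) = 1" "f (x, y) \<bullet> fx (x, y) = 0" "f (x, y) \<bullet> fy (x, y) = 0" "f (x, y) \<bullet> n (x, y) = 0"
  "fx (x, y) \<bullet> f (x, y) = 0" "fx (x, y) \<bullet> fx (x, y) = (\<rho> y)^2" "fx (x, y) \<bullet> fy (x, y) = 0" "fx (x, y) \<bullet> n (x, y) = 0"
  "fy (x, y) \<bullet> f (x, y) = 0" "fy (x, y) \<bullet> fx (x, y) = 0" "fy (x, y) \<bullet> fy (x, y) = (\<rho> y)^2" "fy (x, y) \<bullet> n (x, y) = 0"
  "n (x, y) \<bullet> f (x, y) = 0" "n (x, y) \<bullet> fx (x, y) = 0" "n (x, y) \<bullet> fy (x, y) = 0" "n (x, y) \<bullet> n (x, y) = 1"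
  using n_normal[of "(x, y)"] ff nn f_tangent metric by (simp_all only: inner_commute[of "fy _" "fx _"] inner_commute[of "fx _" "f _"]
    inner_commute[of "fy _" "f _"] inner_commute[of "f _" "n _"] inner_commute[of "fx _" "n _"] inner_commute[of "fy _" "n _"])

lemmas second_inner_table = second_derivative_products[THEN trans[OF inner_commute]]

section \<open>Gauss and Weingarten equations, and the rotation of the x-orbits\<close>

lemma fxx_eq: "fxx (x, y) = - (\<rho> y)\<^sup>2 *\<^sub>R f (x, y) - (\<rho>' y / \<rho> y) *\<^sub>R fy (x, y) + L y *\<^sub>R n (x, y)"
  by (rule orthonormal4_eqI[OF frame[of "(x, y)"]])
     (simp_all add: ex_def ey_def inner_add_left inner_diff_left inner_table second_inner_table second_form power2_eq_square)

lemma fxy_eq: "fxy (x, y) = (\<rho>' y / \<rho> y) *\<^sub>R fx (x, y)"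
  by (rule orthonormal4_eqI[OF frame[of "(x, y)"]])
     (simp_all add: ex_def ey_def inner_add_left inner_diff_left inner_table second_inner_table second_form power2_eq_square)

lemma fyy_eq: "fyy (x, y) = - (\<rho> y)\<^sup>2 *\<^sub>R f (x, y) + (\<rho>' y / \<rho> y) *\<^sub>R fy (x, y) + M y *\<^sub>R n (x, y)"
  by (rule orthonormal4_eqI[OF frame[of "(x, y)"]])
     (simp_all add: ex_def ey_def inner_add_left inner_diff_left inner_table second_inner_table second_form power2_eq_square)

lemma ex_x: "((\<lambda>s. ex (s, y)) has_vector_derivative (1 / \<rho> y) *\<^sub>R fxx (x, y)) (at x)"
  unfolding ex_def by (auto intro!: derivative_eq_intros partials)

lemma ey_x: "((\<lambda>s. ey (s, y)) has_vector_derivative (1 / \<rho> y) *\<^sub>R fxy (x, y)) (at x)"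
  unfolding ey_def by (auto intro!: derivative_eq_intros partials)

lemma DERIV_inv_\<rho>: "((\<lambda>y. 1 / \<rho> y) has_real_derivative - \<rho>' y / (\<rho> y)^2) (at y)"
  by (rule derivative_eq_intros DERIV_\<rho> refl | simp add: power2_eq_square)+

text \<open>By \<open>fxy_eq\<close> the growth of \<open>fx\<close> in \<open>y\<close> is exactly
  that of \<open>\<rho>\<close>, so the unit tangent of the x-orbits depends on \<open>x\<close>
  alone. This is what makes all orbits turn in parallel planes.\<close>

lemma ex_y: "((\<lambda>s. ex (x, s)) has_vector_derivative 0) (at y)"
  unfolding ex_def snd_conv
  by (rule has_vector_derivative_eq_rhs[OF has_vector_derivative_scaleR[OF DERIV_inv_\<rho> partials(4)]])
     (simp add: fxy_eq power2_eq_square)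

lemma ey_y: "((\<lambda>s. ey (x, s)) has_vector_derivative - \<rho> y *\<^sub>R f (x, y) + \<mu> y *\<^sub>R n (x, y)) (at y)"
  unfolding ey_def snd_conv
  by (rule has_vector_derivative_eq_rhs[OF has_vector_derivative_scaleR[OF DERIV_inv_\<rho> partials(6)]])
     (simp add: fyy_eq \<mu>_def power2_eq_square scaleR_diff_right scaleR_add_right)

lemma f_y: "((\<lambda>s. f (x, s)) has_vector_derivative \<rho> y *\<^sub>R ey (x, y)) (at y)"
  using partials(2) by (simp add: ey_def)

lemma n_x: "((\<lambda>s. n (s, y)) has_vector_derivative - (L y / (\<rho> y)^2) *\<^sub>R fx (x, y)) (at x)"
proof -
  have "continuous_on UNIV (\<lambda>s. n (s, y))"
    by (rule continuous_on_compose2[OF n_cont]) (auto intro!: continuous_intros)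
  then have "isCont (\<lambda>s. n (s, y)) x"
    by (simp add: continuous_on_eq_continuous_at)
  from has_vector_derivative_normal[OF frame this partials(1) ex_x ey_x]
  show ?thesis
    by (rule has_vector_derivative_eq_rhs)
       (use n_normal[of "(x, y)"] in \<open>simp add: inner_commute[of "n _" "fxx _"] inner_commute[of "n _" "fxy _"] second_form ex_def power2_eq_square\<close>)
qed

lemma n_y: "((\<lambda>s. n (x, s)) has_vector_derivative - \<mu> y *\<^sub>R ey (x, y)) (at y)"
proof -
  have "continuous_on UNIV (\<lambda>s. n (x, s))"
    by (rule continuous_on_compose2[OF n_cont]) (auto intro!: continuous_intros)
  then have "isCont (\<lambda>s. n (x, s)) y"
    by (simp add: continuous_on_eq_continuous_at)
  from has_vector_derivative_normal[OF frame this f_y ex_y ey_y]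
  show ?thesis
    by (rule has_vector_derivative_eq_rhs)
       (use n_normal[of "(x, y)"] in \<open>simp add: inner_add_right inner_diff_right nn ey_def\<close>)
qed

text \<open>This is \<open>\<rho>\<close> times the curvature vector of the x-orbits in 4-space: it
  is the x-derivative of \<open>ex\<close> by \<open>ex_x'\<close>. Together with \<open>ex\<close>
  it spans the plane of rotation.\<close>

definition "W q = - \<rho> (snd q) *\<^sub>R f q - (\<rho>' (snd q) / (\<rho> (snd q))^2) *\<^sub>R fy q + (L (snd q) / \<rho> (snd q)) *\<^sub>R n q"

lemma ex_x': "((\<lambda>s. ex (s, y)) has_vector_derivative W (x, y)) (at x)"
  by (rule has_vector_derivative_eq_rhs[OF ex_x])
     (simp add: fxx_eq W_def scaleR_diff_right scaleR_add_right power2_eq_square)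

lemma W_x: "((\<lambda>s. W (s, y)) has_vector_derivative - c\<^sup>2 *\<^sub>R ex (x, y)) (at x)"
proof -
  have "((\<lambda>s. W (s, y)) has_vector_derivative
     - \<rho> y *\<^sub>R fx (x, y) - (\<rho>' y / (\<rho> y)\<^sup>2) *\<^sub>R fxy (x, y) + (L y / \<rho> y) *\<^sub>R (- (L y / (\<rho> y)\<^sup>2) *\<^sub>R fx (x, y))) (at x)"
    unfolding W_def by (auto intro!: derivative_eq_intros partials n_x)
  moreover have "- \<rho> y *\<^sub>R fx (x, y) - (\<rho>' y / (\<rho> y)^2) *\<^sub>R fxy (x, y) + (L y / \<rho> y) *\<^sub>R (- (L y / (\<rho> y)^2) *\<^sub>R fx (x, y))
    = - ((\<rho> y)\<^sup>2 + (\<rho>' y)\<^sup>2 / (\<rho> y)\<^sup>2 + (L y)\<^sup>2 / (\<rho> y)\<^sup>2) *\<^sub>R ex (x, y)"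
    by (simp add: fxy_eq ex_def scaleR_diff_left[symmetric] scaleR_minus_left[symmetric] scaleR_add_left[symmetric]
          power2_eq_square field_simps del: scaleR_minus_left)
  ultimately show ?thesis by (simp add: c_identity)
qed

lemma ex_const: "ex (x, y) = ex (x, 0)"
  by (rule vector_derivative_zero_const[OF ex_y])

lemma W_const: "W (x, y) = W (x, 0)"
  using vector_derivative_unique_at[OF ex_x'[of y x]] ex_x'[of 0 x] ex_const[of _ y] by simp

lemma W_eq: "W (x, y) = cos (c * x) *\<^sub>R W (0, 0) - (c * sin (c * x)) *\<^sub>R ex (0, 0)"
proof -
  have c: "c \<noteq> 0" using c_pos by simp
  \<comment> \<open>\<open>ex\<close> and \<open>W\<close> obey the oscillator equations ex' = W and
    W' = -c^2 ex in \<open>x\<close>. \<open>P\<close> and \<open>Q\<close> undo this oscillation,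
    and their constancy gives the solution explicitly.\<close>
  define P where "P x = cos (c * x) *\<^sub>R ex (x, 0) - (sin (c * x) / c) *\<^sub>R W (x, 0)" for x
  define Q where "Q x = (c * sin (c * x)) *\<^sub>R ex (x, 0) + cos (c * x) *\<^sub>R W (x, 0)" for x
  have "(P has_vector_derivative 0) (at x)" for x
    unfolding P_def[abs_def]
    by (rule has_vector_derivative_eq_rhs)
       (auto intro!: derivative_eq_intros ex_x' W_x simp: c power2_eq_square algebra_simps)
  from vector_derivative_zero_const[OF this, of x 0] have P: "P x = ex (0, 0)" by (simp add: P_def)
  have "(Q has_vector_derivative 0) (at x)" for x
    unfolding Q_def[abs_def]
    by (rule has_vector_derivative_eq_rhs)
       (auto intro!: derivative_eq_intros ex_x' W_x simp: c power2_eq_square algebra_simps)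
  from vector_derivative_zero_const[OF this, of x 0] have Q: "Q x = W (0, 0)" by (simp add: Q_def)
  have "cos (c * x) *\<^sub>R Q x - (c * sin (c * x)) *\<^sub>R P x =
      (cos (c * x) * cos (c * x)) *\<^sub>R W (x, 0) + (sin (c * x) * sin (c * x)) *\<^sub>R W (x, 0)"
    unfolding P_def Q_def by (simp add: c scaleR_add_right scaleR_diff_right mult_ac)
  also have "\<dots> = W (x, 0)"
    by (simp add: scaleR_add_left[symmetric])
  finally have "W (x, 0) = cos (c * x) *\<^sub>R Q x - (c * sin (c * x)) *\<^sub>R P x"
    by simp
  then show ?thesis by (simp add: P Q W_const[of x y])
qed

lemma W_products: "f (x, y) \<bullet> W (x, y) = - \<rho> y" "ex (x, y) \<bullet> W (x, y) = 0" "n (x, y) \<bullet> W (x, y) = L y / \<rho> y"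
   "ey (x, y) \<bullet> W (x, y) = - \<rho>' y / \<rho> y"
  "W (x, y) \<bullet> W (x, y) = c^2"
proof -
  have Wx: "W (x, y) = - \<rho> y *\<^sub>R f (x, y) - (\<rho>' y / \<rho> y) *\<^sub>R ey (x, y) + (L y / \<rho> y) *\<^sub>R n (x, y)"
    by (simp add: W_def ey_def power2_eq_square)
  note o = frame[of "(x, y)", unfolded orthonormal4_def]
  show "f (x, y) \<bullet> W (x, y) = - \<rho> y" "ex (x, y) \<bullet> W (x, y) = 0" "n (x, y) \<bullet> W (x, y) = L y / \<rho> y"
       "ey (x, y) \<bullet> W (x, y) = - \<rho>' y / \<rho> y"
    using o by (simp_all add: Wx inner_add_right inner_diff_right inner_commute)
  then have "W (x, y) \<bullet> W (x, y) = (\<rho> y)^2 + (\<rho>' y)^2 / (\<rho> y)^2 + (L y)^2 / (\<rho> y)^2"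
    by (subst Wx) (simp add: inner_add_left inner_diff_left power2_eq_square)
  then show "W (x, y) \<bullet> W (x, y) = c^2" by (simp add: c_identity)
qed

text \<open>The constant is the centre of the orbit circle: \<open>\<rho> ex\<close> from
  \<open>f\<close> and \<open>- \<rho> ex\<close> from \<open>W\<close> cancel in the
  derivative.\<close>

lemma f_x_const: "f (x, y) + (\<rho> y / c^2) *\<^sub>R W (x, y) = f (0, y) + (\<rho> y / c^2) *\<^sub>R W (0, y)"
proof -
  have "((\<lambda>x. f (x, y) + (\<rho> y / c^2) *\<^sub>R W (x, y)) has_vector_derivative 0) (at x)" for x
    by (rule has_vector_derivative_eq_rhs)
       (use c_pos in \<open>auto intro!: derivative_eq_intros partials W_x simp: ex_def\<close>)
  from vector_derivative_zero_const[OF this] show ?thesis by blast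
qed

end

section \<open>Coordinates adapted to the axis of revolution\<close>

context rotational_surface
begin

text \<open>Since \<open>\<rho>' 0 = 0\<close>, the vector \<open>W (0, 0)\<close> lies in the span
  of \<open>f (0, 0)\<close> and \<open>n (0, 0)\<close>, and \<open>B1\<close> is a unit vector of
  that span orthogonal to it. Thus \<open>B3\<close>, \<open>B4\<close> span the plane of rotation,
  while \<open>B1\<close>, \<open>B2\<close> span the fixed plane, which cuts the axis out of the
  3-sphere.\<close>

definition "B1 = (1 / c) *\<^sub>R ((h - p) *\<^sub>R f (0, 0) + z *\<^sub>R n (0, 0))"
definition "B2 = ey (0, 0)"
definition "B3 = (- 1 / c) *\<^sub>R W (0, 0)"
definition "B4 = ex (0, 0)"

lemma zdiv: "z * z / \<bar>z\<bar> = \<bar>z\<bar>"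
  by (metis abs_mult_self_eq mult.commute nonzero_mult_div_cancel_left z0 abs_eq_0)

lemma W_0: "W (0, 0) = - \<bar>z\<bar> *\<^sub>R f (0, 0) + (z * (h - p) / \<bar>z\<bar>) *\<^sub>R n (0, 0)"
  by (simp add: W_def \<rho>_def \<rho>'_def v_0 L_def)

lemma frame_table:
  "f q \<bullet> f q = 1" "f q \<bullet> ex q = 0" "f q \<bullet> ey q = 0" "f q \<bullet> n q = 0"
  "ex q \<bullet> f q = 0" "ex q \<bullet> ex q = 1" "ex q \<bullet> ey q = 0" "ex q \<bullet> n q = 0"
  "ey q \<bullet> f q = 0" "ey q \<bullet> ex q = 0" "ey q \<bullet> ey q = 1" "ey q \<bullet> n q = 0"
  "n q \<bullet> f q = 0" "n q \<bullet> ex q = 0" "n q \<bullet> ey q = 0" "n q \<bullet> n q = 1"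
  using frame[of q] unfolding orthonormal4_def by (simp_all add: inner_commute)

lemma orthonormal4_B: "orthonormal4 B1 B2 B3 B4"
proof -
  have c: "c * c = z * z + (h - p) * (h - p)" "c \<noteq> 0"
    using c_square c_pos by (auto simp: power2_eq_square)
  have 1: "B1 \<bullet> B1 = 1"
  proof -
    have "B1 \<bullet> B1 = ((h - p) * (h - p) + z * z) / (c * c)"
      by (simp add: B1_def inner_add_left inner_add_right frame_table add_divide_distrib)
    then show ?thesis using c z0 by simp
  qed
  have 3: "B3 \<bullet> B3 = 1"
    using W_products(5)[of 0 0] c_pos by (simp add: B3_def power2_eq_square)
  have 13: "B1 \<bullet> B3 = 0"
  proof -
    have b: "B1 \<bullet> f (0, 0) = (h - p) / c" "B1 \<bullet> n (0, 0) = z / c"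
      by (simp_all add: B1_def inner_add_left frame_table)
    have "B1 \<bullet> W (0, 0) = - \<bar>z\<bar> * (B1 \<bullet> f (0, 0)) + z * (h - p) / \<bar>z\<bar> * (B1 \<bullet> n (0, 0))"
      by (simp add: W_0 inner_diff_right)
    also have "\<dots> = (h - p) / c * (z * z / \<bar>z\<bar> - \<bar>z\<bar>)"
      unfolding b by (simp add: algebra_simps diff_divide_distrib)
    finally have "B1 \<bullet> W (0, 0) = 0"
      by (simp add: zdiv)
    then show ?thesis by (simp add: B3_def)
  qed
  have "B2 \<bullet> B3 = 0" "B3 \<bullet> B4 = 0"
    using W_products(2,4)[of 0 0] by (simp_all add: B2_def B3_def B4_def \<rho>'_def v_0 inner_commute[of "W _"])
  moreover have "B1 \<bullet> B2 = 0" "B1 \<bullet> B4 = 0" "B2 \<bullet> B4 = 0" "B2 \<bullet> B2 = 1" "B4 \<bullet> B4 = 1"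
    by (simp_all add: B1_def B2_def B4_def frame_table inner_add_left)
  ultimately show ?thesis
    using 1 3 13 by (simp add: orthonormal4_def)
qed

definition "\<zeta> y = Complex (f (0, y) \<bullet> B1) (f (0, y) \<bullet> B2)"
definition "\<zeta>' y = Complex (fy (0, y) \<bullet> B1) (fy (0, y) \<bullet> B2)"

lemma f_coordinates:
  "f (x, y) \<bullet> B1 = Re (\<zeta> y)" "f (x, y) \<bullet> B2 = Im (\<zeta> y)"
  "f (x, y) \<bullet> B3 = \<rho> y / c * cos (c * x)" "f (x, y) \<bullet> B4 = \<rho> y / c * sin (c * x)"
proof -
  \<comment> \<open>\<open>g\<close> is the centre of the orbit. It is orthogonal to
    \<open>B3\<close> and \<open>B4\<close>, so these two coordinates of \<open>f\<close> come from
    \<open>W\<close> alone.\<close>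
  define g where "g = f (0, y) + (\<rho> y / c^2) *\<^sub>R W (0, 0)"
  have g: "f (x, y) = g - (\<rho> y / c^2) *\<^sub>R W (x, y)"
    using f_x_const[of x y] by (simp add: g_def W_const[of 0 y] algebra_simps)
  have c: "c \<noteq> 0" using c_pos by simp
  have gW: "g \<bullet> W (0, 0) = 0"
    using W_products(1)[of 0 y] W_products(5)[of 0 y] c
    by (simp add: g_def inner_add_left W_const[of 0 y])
  have ge: "g \<bullet> ex (0, 0) = 0"
    using frame_table(2)[of "(0, y)"] W_products(2)[of 0 0]
    by (simp add: g_def inner_add_left ex_const[of 0 y] inner_commute[of "W _"])
  note o = orthonormal4_B[unfolded orthonormal4_def]
  have WB: "W (0, 0) = (- c) *\<^sub>R B3" "ex (0, 0) = B4"
    using c by (simp_all add: B3_def B4_def)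
  have W1: "W (x, y) = (- c) *\<^sub>R (cos (c * x) *\<^sub>R B3 + sin (c * x) *\<^sub>R B4)" for x y
    unfolding W_eq[of x y] WB by (simp add: algebra_simps)
  have g3: "g \<bullet> B3 = 0" "g \<bullet> B4 = 0"
    using gW ge c by (simp_all add: WB)
  show "f (x, y) \<bullet> B1 = Re (\<zeta> y)" "f (x, y) \<bullet> B2 = Im (\<zeta> y)"
    unfolding \<zeta>_def by (simp_all add: g W1 inner_diff_left inner_add_left inner_commute[of B3] inner_commute[of B4] o, simp_all add: g_def inner_add_left inner_diff_left WB inner_commute[of B3] o)
  show "f (x, y) \<bullet> B3 = \<rho> y / c * cos (c * x)" "f (x, y) \<bullet> B4 = \<rho> y / c * sin (c * x)"
    using c by (simp_all add: g W1 inner_diff_left inner_add_left g3 inner_commute[of B4 B3] o power2_eq_square)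
qed

lemma \<zeta>_0: "\<zeta> 0 = of_real ((h - p) / c)"
  by (simp add: \<zeta>_def B1_def B2_def inner_add_right frame_table complex_eq_iff)

lemma norm_\<zeta>: "(norm (\<zeta> y))^2 = 1 - (\<rho> y / c)^2"
proof -
  have "1 = (Re (\<zeta> y))^2 + (Im (\<zeta> y))^2 + (\<rho> y / c)^2"
    using orthonormal4_inner[OF orthonormal4_B, of "f (0, y)" "f (0, y)"]
    by (simp add: f_coordinates ff power2_eq_square)
  then show ?thesis by (simp add: cmod_power2)
qed

lemma (in -) has_vector_derivative_Complex:
  assumes "(F has_real_derivative F') (at x)" "(G has_real_derivative G') (at x)"
  shows "((\<lambda>x. Complex (F x) (G x)) has_vector_derivative Complex F' G') (at x)"
proof -
  have "((\<lambda>x. of_real (F x) + \<i> * of_real (G x)) has_vector_derivative of_real F' + \<i> * of_real G') (at x)"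
    by (intro has_vector_derivative_add has_vector_derivative_mult_right has_vector_derivative_of_real assms)
  then show ?thesis by (simp add: Complex_eq)
qed

lemma inner_const_derivative:
  fixes F :: "real \<Rightarrow> R4"
  assumes "(F has_vector_derivative D) (at x)"
  shows "((\<lambda>s. F s \<bullet> B) has_real_derivative D \<bullet> B) (at x)"
  using has_real_derivative_inner[OF assms has_vector_derivative_const[of B]] by simp

lemma DERIV_\<zeta>: "(\<zeta> has_vector_derivative \<zeta>' y) (at y)"
  unfolding \<zeta>_def[abs_def] \<zeta>'_def
  by (intro has_vector_derivative_Complex inner_const_derivative partials)

text \<open>The three \<open>2 \<times> 2\<close> minors of the first two coordinate columns of the frame
  \<open>(f, ey, n)\<close> solve the same linear system as its third column; comparing the values at \<open>0\<close>
  identifies them, without any discussion of orientations.\<close>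

lemma angular_momentum: "Im (cnj (\<zeta> y) * \<zeta>' y) = \<bar>z\<bar> * (h * (v y)^2 - p) / c"
proof -
  define X where "X y = (f (0, y) \<bullet> B1) * (ey (0, y) \<bullet> B2) - (f (0, y) \<bullet> B2) * (ey (0, y) \<bullet> B1)" for y
  define Y where "Y y = (f (0, y) \<bullet> B1) * (n (0, y) \<bullet> B2) - (f (0, y) \<bullet> B2) * (n (0, y) \<bullet> B1)" for y
  define Z where "Z y = (ey (0, y) \<bullet> B1) * (n (0, y) \<bullet> B2) - (ey (0, y) \<bullet> B2) * (n (0, y) \<bullet> B1)" for y
  define \<epsilon> where "\<epsilon> = - z / \<bar>z\<bar>"
  \<comment> \<open>(Z, -Y, X) and the third column obey the same skew-symmetric system, so the
    squared distance \<open>D\<close> between the former and \<open>\<epsilon>\<close> times the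
    latter is constant. The sign \<open>\<epsilon>\<close> is read off at \<open>0\<close>.\<close>
  define D where "D y = (Z y - \<epsilon> * (f (0, y) \<bullet> B3))^2 + (Y y + \<epsilon> * (ey (0, y) \<bullet> B3))^2
     + (X y - \<epsilon> * (n (0, y) \<bullet> B3))^2" for y
  have df: "((\<lambda>s. f (0, s) \<bullet> B) has_real_derivative \<rho> y * (ey (0, y) \<bullet> B)) (at y)"
    and de: "((\<lambda>s. ey (0, s) \<bullet> B) has_real_derivative - \<rho> y * (f (0, y) \<bullet> B) + \<mu> y * (n (0, y) \<bullet> B)) (at y)"
    and dn: "((\<lambda>s. n (0, s) \<bullet> B) has_real_derivative - \<mu> y * (ey (0, y) \<bullet> B)) (at y)" for y B
    using inner_const_derivative[OF f_y] inner_const_derivative[OF ey_y] inner_const_derivative[OF n_y]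
    by (simp_all add: inner_add_left inner_diff_left)
  have dX: "(X has_real_derivative \<mu> y * Y y) (at y)" for y
    unfolding X_def[abs_def] Y_def
    by (rule derivative_eq_intros df de dn refl)+ (simp add: algebra_simps)
  have dY: "(Y has_real_derivative \<rho> y * Z y - \<mu> y * X y) (at y)" for y
    unfolding X_def[abs_def] Y_def[abs_def] Z_def
    by (rule derivative_eq_intros df de dn refl)+ (simp add: algebra_simps)
  have dZ: "(Z has_real_derivative - \<rho> y * Y y) (at y)" for y
    unfolding Y_def[abs_def] Z_def[abs_def]
    by (rule derivative_eq_intros df de dn refl)+ (simp add: algebra_simps)
  have dD: "(D has_real_derivative 0) (at y)" for y
    unfolding D_def[abs_def]
    by (rule derivative_eq_intros df de dn dX dY dZ refl)+ (simp add: algebra_simps)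
  have D0: "D 0 = 0"
  proof -
    have c: "c \<noteq> 0" using c_pos by simp
    have f3: "f (0, 0) \<bullet> B3 = \<bar>z\<bar> / c" "ey (0, 0) \<bullet> B3 = 0" "n (0, 0) \<bullet> B3 = - (z * (h - p)) / (\<bar>z\<bar> * c)"
      by (simp_all add: B3_def W_0 inner_add_right inner_diff_right frame_table divide_simps)
    have f12: "f (0, 0) \<bullet> B1 = (h - p) / c" "f (0, 0) \<bullet> B2 = 0" "ey (0, 0) \<bullet> B1 = 0" "ey (0, 0) \<bullet> B2 = 1"
      "n (0, 0) \<bullet> B1 = z / c" "n (0, 0) \<bullet> B2 = 0"
      by (simp_all add: B1_def B2_def inner_add_right frame_table)
    show ?thesis
      using z0 c by (simp add: D_def X_def Y_def Z_def f3 f12 \<epsilon>_def divide_simps mult_ac)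
  qed
  have "D y = 0"
    using DERIV_isconst_all[of D y 0] dD D0 by auto
  then have "X y - \<epsilon> * (n (0, y) \<bullet> B3) = 0"
    unfolding D_def by (smt (verit) zero_le_power2 zero_eq_power2)
  moreover have "n (0, y) \<bullet> B3 = - L y / (\<rho> y * c)"
    using W_products(3)[of 0 y] by (simp add: B3_def W_const[of 0 y])
  ultimately have X: "X y = z * L y / (\<bar>z\<bar> * \<rho> y * c)"
    by (simp add: \<epsilon>_def)
  have "Im (cnj (\<zeta> y) * \<zeta>' y) = \<rho> y * X y"
    by (simp add: \<zeta>_def \<zeta>'_def X_def ey_def algebra_simps)
  also have "\<dots> = (z * z / \<bar>z\<bar>) * (h * (v y)^2 - p) / c"
    by (simp add: X L_def)
  also have "\<dots> = \<bar>z\<bar> * (h * (v y)^2 - p) / c"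
    unfolding zdiv ..
  finally show ?thesis .
qed

end

section \<open>The profile curve\<close>

definition orbit_speed :: "real \<Rightarrow> real \<Rightarrow> real" where
  "orbit_speed p h = sqrt (1 + p^2 - 2 * p * h)"

text \<open>With c the orbit speed, this is c^2 - (1 - h^2) dn^2, the squared modulus of the curve
  times c^2.\<close>

definition profile_den :: "real \<Rightarrow> real \<Rightarrow> real \<Rightarrow> real" where
  "profile_den p h \<theta> = (h - p)^2 + (1 - h^2) * (1 - p^2) * (sin \<theta>)^2"

text \<open>The angular velocity of the whole curve minus that of \<open>profile_base\<close>,
  brought to the common denominator \<open>profile_den * ampl_dn\<close>. The first term is the
  factor h dn^2 - p of the angular momentum with dn^2 expanded.\<close>

definition profile_num :: "real \<Rightarrow> real \<Rightarrow> real \<Rightarrow> real" where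
  "profile_num p h \<theta> = sqrt (1 - h^2) *
     (orbit_speed p h * (h - p - h * (1 - p^2) * (sin \<theta>)^2) - (h - p) * sqrt (1 - p^2) * cos \<theta> * ampl_dn p \<theta>)"

definition profile_arg :: "real \<Rightarrow> real \<Rightarrow> real \<Rightarrow> real" where
  "profile_arg p h \<theta> = (LBINT t=0..\<theta>. profile_num p h t / (profile_den p h t * ampl_dn p t))"

text \<open>The curve is polar about the second axis, which it meets only if \<open>h = p\<close> (at \<open>sin \<theta> = 0\<close>).
  Splitting off the factor \<open>profile_base\<close>, which has the same modulus up to \<open>orbit_speed\<close>, leaves an
  angle whose derivative stays bounded as \<open>h - p\<close> tends to \<open>0\<close>.\<close>

definition profile_base :: "real \<Rightarrow> real \<Rightarrow> real \<Rightarrow> complex" where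
  "profile_base p h \<theta> = Complex (h - p) (sqrt (1 - h^2) * sqrt (1 - p^2) * sin \<theta>)"

definition profile :: "real \<Rightarrow> real \<Rightarrow> real \<Rightarrow> complex" where
  "profile p h \<theta> = profile_base p h \<theta> / of_real (orbit_speed p h) * cis (profile_arg p h \<theta>)"

text \<open>The real part is half the logarithmic derivative of \<open>profile_den\<close>; the
  imaginary part is the angular momentum in the variable \<open>\<theta>\<close> divided by the
  squared modulus.\<close>

definition profile_log_deriv :: "real \<Rightarrow> real \<Rightarrow> real \<Rightarrow> complex" where
  "profile_log_deriv p h \<theta> = Complex ((1 - h^2) * (1 - p^2) * sin \<theta> * cos \<theta>)
     (orbit_speed p h * sqrt (1 - h^2) * (h * (ampl_dn p \<theta>)^2 - p) / ampl_dn p \<theta>) / of_real (profile_den p h \<theta>)"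

lemma orbit_speed_square:
  assumes "\<bar>h\<bar> < 1"
  shows "(orbit_speed p h)^2 = (1 - h^2) + (h - p)^2" "0 < orbit_speed p h"
    "(orbit_speed p h)^2 = 1 + p^2 - 2 * p * h"
proof -
  have e: "1 + p^2 - 2 * p * h = (1 - h^2) + (h - p)^2"
    by (simp add: power2_eq_square algebra_simps)
  have "0 < 1 - h^2" using assms by (simp add: abs_square_less_1)
  then have "0 < (1 - h^2) + (h - p)^2" by (intro add_pos_nonneg) auto
  then show "(orbit_speed p h)^2 = (1 - h^2) + (h - p)^2" "0 < orbit_speed p h"
    unfolding orbit_speed_def e by auto
  then show "(orbit_speed p h)^2 = 1 + p^2 - 2 * p * h" by (simp add: e)
qed

text \<open>Splitting the constant term by cos^2 + sin^2 = 1 leaves a sum of two squares. The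
  coefficient 1 - p h stays positive for |p| <= 1 and |h| < 1, in particular at
  \<open>h = p\<close>.\<close>

lemma profile_den_eq: "profile_den p h \<theta> = (h - p)^2 * (cos \<theta>)^2 + (1 - p * h)^2 * (sin \<theta>)^2"
  unfolding profile_den_def using sin_cos_squared_add[of \<theta>] by algebra

lemma ph_less_1:
  fixes p h :: real
  assumes "\<bar>p\<bar> \<le> 1" "\<bar>h\<bar> < 1" shows "0 < 1 - p * h"
proof -
  have "p * h \<le> \<bar>p\<bar> * \<bar>h\<bar>" by (metis abs_ge_self abs_mult)
  also have "\<dots> \<le> 1 * \<bar>h\<bar>" using assms by (intro mult_right_mono) auto
  finally show ?thesis using assms by simp
qed

lemma profile_den_pos:
  assumes "\<bar>p\<bar> \<le> 1" "\<bar>h\<bar> < 1" "h \<noteq> p \<or> sin \<theta> \<noteq> 0" shows "0 < profile_den p h \<theta>"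
proof (cases "sin \<theta> = 0")
  case True
  then have "(cos \<theta>)^2 = 1" by (simp add: cos_squared_eq)
  then show ?thesis using assms True by (simp add: profile_den_eq)
next
  case False
  then have "0 < (1 - p * h)^2 * (sin \<theta>)^2" using ph_less_1[OF assms(1,2)] by simp
  then show ?thesis unfolding profile_den_eq by (intro add_nonneg_pos) auto
qed

lemma norm_profile_base:
  assumes "\<bar>p\<bar> \<le> 1" "\<bar>h\<bar> < 1" shows "profile_base p h \<theta> * cnj (profile_base p h \<theta>) = of_real (profile_den p h \<theta>)"
proof -
  have "0 \<le> 1 - h^2" "0 \<le> 1 - p^2" using assms by (auto simp: abs_square_le_1)
  then have "(h - p)^2 + (sqrt (1 - h^2) * sqrt (1 - p^2) * sin \<theta>)^2 = profile_den p h \<theta>"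
    by (simp add: profile_den_def power_mult_distrib)
  then show ?thesis
    by (simp add: complex_mult_cnj profile_base_def)
qed

text \<open>The two values are conjugate and have modulus \<open>1 - p * h\<close>. The right-hand
  side therefore has a denominator that stays away from 0 near \<open>h = p\<close>, which is why
  \<open>monodromy\<close> is built from it.\<close>

lemma profile_base_pi2:
  assumes "\<bar>p\<bar> \<le> 1" "\<bar>h\<bar> < 1"
  shows "profile_base p h (pi/2) / profile_base p h (- pi/2) = (profile_base p h (pi/2))^2 / of_real ((1 - p * h)^2)"
proof -
  have c: "cnj (profile_base p h (pi/2)) = profile_base p h (- pi/2)"
    by (simp add: profile_base_def complex_eq_iff)
  have ab: "profile_base p h (pi/2) * profile_base p h (- pi/2) = of_real ((1 - p * h)^2)"
    using norm_profile_base[OF assms, of "pi/2"] unfolding c by (simp add: profile_den_eq)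
  have k: "(of_real ((1 - p * h)^2) :: complex) \<noteq> 0"
    unfolding of_real_eq_0_iff using ph_less_1[OF assms] by simp
  have gen: "a / b = a^2 / k" if "a * b = k" "k \<noteq> 0" for a b k :: complex
  proof -
    have "a \<noteq> 0" using that by auto
    then show ?thesis unfolding that(1)[symmetric] power2_eq_square by simp
  qed
  show ?thesis by (rule gen[OF ab k])
qed

lemma log_derivative_unique:
  fixes f g :: "real \<Rightarrow> complex"
  assumes "\<And>x. (f has_vector_derivative f x * l x) (at x)"
    and "\<And>x. (g has_vector_derivative g x * l x) (at x)" and "\<And>x. g x \<noteq> 0"
  shows "f x = f y / g y * g x"
proof -
  have inv: "((\<lambda>x. inverse (g x)) has_vector_derivative g x * l x * - (inverse (g x) ^ Suc (Suc 0))) (at x)" for x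
    using field_vector_diff_chain_at[OF assms(2) DERIV_inverse[OF assms(3)]] by (simp add: o_def)
  have "((\<lambda>x. f x / g x) has_vector_derivative 0) (at x)" for x
    unfolding divide_inverse
    by (rule has_vector_derivative_eq_rhs[OF has_vector_derivative_mult[OF assms(1) inv]])
       (simp add: assms(3))
  from vector_derivative_zero_const[OF this, of x y] show ?thesis
    using assms(3) by (simp add: divide_eq_eq)
qed

lemma DERIV_profile_arg:
  assumes "p \<noteq> 0" "\<bar>p\<bar> \<le> 1" "\<bar>h\<bar> < 1" "h \<noteq> p"
  shows "(profile_arg p h has_real_derivative profile_num p h \<theta> / (profile_den p h \<theta> * ampl_dn p \<theta>)) (at \<theta>)"
proof -
  have "profile_den p h t \<noteq> 0" "ampl_dn p t \<noteq> 0" for t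
    using profile_den_pos[OF assms(2,3), of t] ampl_dn_pos[OF assms(1), of t] assms(4) by auto
  then show ?thesis
    unfolding profile_arg_def[abs_def]
    by (intro DERIV_LBINT) (auto intro!: continuous_intros simp: profile_num_def profile_den_def)
qed

lemma profile_arg_0 [simp]: "profile_arg p h 0 = 0"
  by (simp add: profile_arg_def zero_ereal_def[symmetric])

lemma profile_0: "profile p h 0 = of_real ((h - p) / orbit_speed p h)"
  by (simp add: profile_def profile_base_def complex_eq_iff cis_zero)

lemma has_vector_derivative_cis:
  assumes "(g has_real_derivative g') (at x)"
  shows "((\<lambda>x. cis (g x)) has_vector_derivative g' *\<^sub>R (\<i> * cis (g x))) (at x)"
  using has_derivative_cis[OF assms[unfolded has_field_derivative_def]]
  by (simp add: has_vector_derivative_def mult.commute)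

lemma DERIV_profile:
  assumes "p \<noteq> 0" "\<bar>p\<bar> \<le> 1" "\<bar>h\<bar> < 1" "h \<noteq> p"
  shows "(profile p h has_vector_derivative profile p h \<theta> * profile_log_deriv p h \<theta>) (at \<theta>)"
proof -
  let ?D = "profile_den p h \<theta>" and ?N = "profile_num p h \<theta>" and ?d = "ampl_dn p \<theta>"
  let ?w = "sqrt (1 - h^2) * sqrt (1 - p^2)" and ?e = "?N / (?D * ?d)"
  have nz: "?D \<noteq> 0" "?d \<noteq> 0"
    using profile_den_pos[OF assms(2,3), of \<theta>] ampl_dn_pos[OF assms(1), of \<theta>] assms(4) by auto
  have w2: "?w * ?w = (1 - h^2) * (1 - p^2)"
    using assms by (simp add: abs_square_le_1 mult_ac real_sqrt_mult_self)
  have db: "(profile_base p h has_vector_derivative Complex 0 (?w * cos \<theta>)) (at \<theta>)"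
    unfolding profile_base_def[abs_def]
    by (intro has_vector_derivative_Complex) (auto intro!: derivative_eq_intros)
  have dc: "((\<lambda>\<theta>. cis (profile_arg p h \<theta>)) has_vector_derivative ?e *\<^sub>R (\<i> * cis (profile_arg p h \<theta>))) (at \<theta>)"
    by (rule has_vector_derivative_cis[OF DERIV_profile_arg[OF assms]])
  \<comment> \<open>Multiplication by \<open>profile_den\<close>, the product of the base and its
    conjugate, turns the claim into the identity from which \<open>profile_num\<close> was
    obtained.\<close>
  have key: "Complex 0 (?w * cos \<theta>) + profile_base p h \<theta> * (?e *\<^sub>R \<i>) = profile_base p h \<theta> * profile_log_deriv p h \<theta>"
  proof -
    have "(Complex 0 (?w * cos \<theta>) + profile_base p h \<theta> * (?e *\<^sub>R \<i>)) * of_real ?D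
       = profile_base p h \<theta> * (cnj (profile_base p h \<theta>) * Complex 0 (?w * cos \<theta>) + Complex 0 (?N / ?d))"
    proof -
      have "of_real ?D * (?e *\<^sub>R \<i>) = Complex 0 (?N / ?d)"
        using nz by (simp add: complex_eq_iff)
      moreover have "(C + B * X) * D = B * (C' * C + N)" if "B * C' = D" "D * X = N" for B C C' D N X :: complex
        unfolding that[symmetric] by (simp add: algebra_simps)
      ultimately show ?thesis
        using norm_profile_base[OF assms(2,3)] by blast
    qed
    also have "cnj (profile_base p h \<theta>) * Complex 0 (?w * cos \<theta>) + Complex 0 (?N / ?d)
       = of_real ?D * profile_log_deriv p h \<theta>"
    proof -
      have 1: "of_real ?D * profile_log_deriv p h \<theta> = Complex ((1 - h^2) * (1 - p^2) * sin \<theta> * cos \<theta>)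
         (orbit_speed p h * sqrt (1 - h^2) * (h * ?d^2 - p) / ?d)"
        unfolding profile_log_deriv_def using nz by simp
      have 2: "(h - p) * (?w * cos \<theta>) + ?N / ?d = orbit_speed p h * sqrt (1 - h^2) * (h * ?d^2 - p) / ?d"
        using nz unfolding profile_num_def ampl_dn_square' by (simp add: field_simps)
      have 3: "?w * sin \<theta> * (?w * cos \<theta>) = (1 - h^2) * (1 - p^2) * sin \<theta> * cos \<theta>"
        unfolding w2[symmetric] by (simp add: mult_ac)
      show ?thesis unfolding 1 complex_eq_iff
        using 2 3 by (simp add: profile_base_def)
    qed
    finally show ?thesis using nz by (simp add: mult_ac)
  qed
  show ?thesis unfolding profile_def[abs_def]
  proof (rule has_vector_derivative_eq_rhs[OF has_vector_derivative_mult[OF has_vector_derivative_divide[OF db] dc]])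
    let ?c = "cis (profile_arg p h \<theta>)" and ?s = "complex_of_real (orbit_speed p h)"
    have "profile_base p h \<theta> / ?s * ?c * profile_log_deriv p h \<theta>
        = (profile_base p h \<theta> * profile_log_deriv p h \<theta>) * (?c / ?s)" by simp
    also have "\<dots> = (Complex 0 (?w * cos \<theta>) + profile_base p h \<theta> * (?e *\<^sub>R \<i>)) * (?c / ?s)"
      unfolding key ..
    finally show "profile_base p h \<theta> / ?s * (?e *\<^sub>R (\<i> * ?c)) + Complex 0 (?w * cos \<theta>) / ?s * ?c
       = profile_base p h \<theta> / ?s * ?c * profile_log_deriv p h \<theta>"
      by (simp add: ring_distribs add_divide_distrib scaleR_conv_of_real mult_ac)
  qed
qed

text \<open>The quotient of the profile at pi/2 and at -pi/2, in a form that also makes sense for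
  \<open>h = p\<close>: the base enters as in \<open>profile_base_pi2\<close>, and the denominator
  of the integrand vanishes at most at t = 0.\<close>

definition monodromy :: "real \<Rightarrow> real \<Rightarrow> complex" where
  "monodromy p h = (profile_base p h (pi/2))^2 / of_real ((1 - p * h)^2) *
     cis (integral {-pi/2..pi/2} (\<lambda>t. profile_num p h t / (profile_den p h t * ampl_dn p t)))"

lemma profile_nz:
  assumes "\<bar>p\<bar> \<le> 1" "\<bar>h\<bar> < 1" "h \<noteq> p"
  shows "profile p h \<theta> \<noteq> 0"
  using norm_profile_base[OF assms(1,2), of \<theta>] profile_den_pos[OF assms(1,2), of \<theta>] assms(3)
    orbit_speed_square(2)[OF assms(2), of p]
  by (auto simp: profile_def)

lemma profile_arg_diff:
  assumes "p \<noteq> 0" "\<bar>p\<bar> \<le> 1" "\<bar>h\<bar> < 1" "h \<noteq> p" "a \<le> b"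
  shows "((\<lambda>t. profile_num p h t / (profile_den p h t * ampl_dn p t)) has_integral (profile_arg p h b - profile_arg p h a)) {a..b}"
  by (rule fundamental_theorem_of_calculus[OF assms(5)])
     (auto intro!: has_field_derivative_at_within DERIV_profile_arg[OF assms(1-4)] simp flip: has_real_derivative_iff_has_vector_derivative)

text \<open>The coefficient of the logarithmic differential equation has period pi, so a shift by pi
  multiplies the solution by a constant. Evaluation at -pi/2 identifies it.\<close>

lemma profile_periodic:
  assumes "p \<noteq> 0" "\<bar>p\<bar> \<le> 1" "\<bar>h\<bar> < 1" "h \<noteq> p"
  shows "profile p h (\<theta> + pi) = monodromy p h * profile p h \<theta>"
proof -
  have l: "profile_log_deriv p h (\<theta> + pi) = profile_log_deriv p h \<theta>" for \<theta>
    by (simp add: profile_log_deriv_def profile_den_def)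
  have "((\<lambda>\<theta>. profile p h (\<theta> + pi)) has_vector_derivative profile p h (\<theta> + pi) * profile_log_deriv p h \<theta>) (at \<theta>)" for \<theta>
  proof -
    have "((profile p h \<circ> (\<lambda>\<theta>. \<theta> + pi)) has_vector_derivative 1 *\<^sub>R (profile p h (\<theta> + pi) * profile_log_deriv p h (\<theta> + pi))) (at \<theta>)"
      by (rule vector_diff_chain_at[OF _ DERIV_profile[OF assms]]) (auto intro!: derivative_eq_intros)
    then show ?thesis by (simp add: o_def l)
  qed
  from log_derivative_unique[OF this DERIV_profile[OF assms] profile_nz[OF assms(2-4)], of \<theta> "- pi/2"]
  have "profile p h (\<theta> + pi) = profile p h (pi/2) / profile p h (- pi/2) * profile p h \<theta>"
    by simp
  moreover have "profile p h (pi/2) / profile p h (- pi/2) = monodromy p h"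
  proof -
    have i: "integral {-pi/2..pi/2} (\<lambda>t. profile_num p h t / (profile_den p h t * ampl_dn p t))
        = profile_arg p h (pi/2) - profile_arg p h (- pi/2)"
      by (rule integral_unique[OF profile_arg_diff[OF assms]]) simp
    have "profile p h (pi/2) / profile p h (- pi/2) =
       (profile_base p h (pi/2) / profile_base p h (- pi/2)) * (cis (profile_arg p h (pi/2)) / cis (profile_arg p h (- pi/2)))"
      using orbit_speed_square(2)[OF assms(3), of p] by (simp add: profile_def)
    then show ?thesis
      unfolding profile_base_pi2[OF assms(2,3)] cis_divide monodromy_def i .
  qed
  ultimately show ?thesis by (simp only:)
qed

text \<open>A curve with the modulus and the angular momentum of the profile satisfies the same
  logarithmic differential equation.\<close>

lemma profile_unique:
  assumes "p \<noteq> 0" "\<bar>p\<bar> \<le> 1" "\<bar>h\<bar> < 1" "h \<noteq> p"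
    and d: "\<And>\<theta>. (Z has_vector_derivative Z' \<theta>) (at \<theta>)"
    and nZ: "\<And>\<theta>. (norm (Z \<theta>))^2 = 1 - (1 - h^2) * (ampl_dn p \<theta>)^2 / (orbit_speed p h)^2"
    and im: "\<And>\<theta>. Im (cnj (Z \<theta>) * Z' \<theta>) = sqrt (1 - h^2) * (h * (ampl_dn p \<theta>)^2 - p) / (orbit_speed p h * ampl_dn p \<theta>)"
    and Z0: "Z 0 = of_real ((h - p) / orbit_speed p h)"
  shows "Z \<theta> = profile p h \<theta>"
proof -
  define c where "c = orbit_speed p h"
  have c: "c^2 = (1 - h^2) + (h - p)^2" "0 < c"
    using orbit_speed_square[OF assms(3)] by (auto simp: c_def)
  have den: "(norm (Z \<theta>))^2 = profile_den p h \<theta> / c^2" for \<theta>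
  proof -
    have "c^2 - (1 - h^2) * (ampl_dn p \<theta>)^2 = profile_den p h \<theta>"
      unfolding c(1) ampl_dn_square' profile_den_def by (simp add: algebra_simps)
    then show ?thesis using c(2) by (simp add: nZ c_def[symmetric] divide_simps)
  qed
  \<comment> \<open>The prescribed modulus determines the radial part of \<open>Z'\<close>; the
    angular momentum supplies the rest of the logarithmic derivative.\<close>
  have re: "Re (cnj (Z \<theta>) * Z' \<theta>) = (1 - h^2) * (1 - p^2) * sin \<theta> * cos \<theta> / c^2" for \<theta>
  proof -
    have "((\<lambda>\<theta>. Z \<theta> \<bullet> Z \<theta>) has_real_derivative Z \<theta> \<bullet> Z' \<theta> + Z' \<theta> \<bullet> Z \<theta>) (at \<theta>)"
      by (rule has_real_derivative_inner[OF d d])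
    moreover have "((\<lambda>\<theta>. profile_den p h \<theta> / c^2) has_real_derivative 2 * ((1 - h^2) * (1 - p^2) * sin \<theta> * cos \<theta>) / c^2) (at \<theta>)"
      unfolding profile_den_def
      by (rule DERIV_cdivide) (auto intro!: derivative_eq_intros simp: algebra_simps)
    moreover have "Z \<theta> \<bullet> Z \<theta> = profile_den p h \<theta> / c^2" for \<theta>
      using den[of \<theta>] by (simp add: power2_norm_eq_inner)
    ultimately have "Z \<theta> \<bullet> Z' \<theta> + Z' \<theta> \<bullet> Z \<theta> = 2 * ((1 - h^2) * (1 - p^2) * sin \<theta> * cos \<theta>) / c^2"
      using DERIV_unique by auto
    then have "2 * (Z \<theta> \<bullet> Z' \<theta>) = 2 * ((1 - h^2) * (1 - p^2) * sin \<theta> * cos \<theta> / c^2)"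
      by (simp add: inner_commute)
    then have "Z \<theta> \<bullet> Z' \<theta> = (1 - h^2) * (1 - p^2) * sin \<theta> * cos \<theta> / c^2"
      unfolding mult_cancel_left by simp
    then show ?thesis by (simp add: inner_complex_def)
  qed
  have Z': "Z' \<theta> = Z \<theta> * profile_log_deriv p h \<theta>" for \<theta>
  proof -
    have D: "profile_den p h \<theta> \<noteq> 0"
      using profile_den_pos[OF assms(2,3), of \<theta>] assms(4) by simp
    have zz: "Z \<theta> * cnj (Z \<theta>) = of_real (profile_den p h \<theta> / c^2)"
      using den[of \<theta>] by (simp add: complex_norm_square[symmetric])
    have "Z \<theta> \<noteq> 0" using den[of \<theta>] D c(2) by auto
    have "cnj (Z \<theta>) * Z' \<theta> = of_real (profile_den p h \<theta> / c^2) * profile_log_deriv p h \<theta>"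
    proof -
      have "of_real (profile_den p h \<theta> / c^2) * profile_log_deriv p h \<theta> =
        Complex ((1 - h^2) * (1 - p^2) * sin \<theta> * cos \<theta> / c^2)
          (c * sqrt (1 - h^2) * (h * (ampl_dn p \<theta>)^2 - p) / ampl_dn p \<theta> / c^2)"
        using D by (simp add: profile_log_deriv_def c_def[symmetric] complex_eq_iff)
      then show ?thesis
        using re[of \<theta>] im[of \<theta>] c(2) by (simp add: complex_eq_iff c_def[symmetric] power2_eq_square)
    qed
    then have "cnj (Z \<theta>) * Z' \<theta> = cnj (Z \<theta>) * (Z \<theta> * profile_log_deriv p h \<theta>)"
      unfolding zz[symmetric] by (simp only: mult_ac)
    then show ?thesis using \<open>Z \<theta> \<noteq> 0\<close> by simp
  qed
  have "Z \<theta> = Z 0 / profile p h 0 * profile p h \<theta>"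
    by (rule log_derivative_unique[OF _ DERIV_profile[OF assms(1-4)] profile_nz[OF assms(2-4)]])
       (use d in \<open>simp add: Z'\<close>)
  then show ?thesis using profile_nz[OF assms(2-4), of 0] by (simp add: Z0 profile_0)
qed

section \<open>From sym points to the rotational normal form, and the effect of double
  periodicity\<close>

lemma sym_point_eq: "sym_point \<theta> = cis (2 * \<theta>)"
  unfolding sym_point_def cis_conv_exp by (simp add: mult_ac)

lemma cos_eq_pm1_if_sin_eq_0:
  fixes x :: real assumes "sin x = 0" shows "cos x = 1 \<or> cos x = -1"
  using assms sin_cos_squared_add[of x] by (simp add: power2_eq_1_iff)

text \<open>That the sym points have product 1 means that 2 (\<theta>1 + \<theta>2) is a multiple of
  2 pi.\<close>

lemma rotational_sym_points:
  assumes "sym_point \<theta>2 = inverse (sym_point \<theta>1)"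
  shows "sin (\<theta>1 + \<theta>2) = 0" "cos (\<theta>1 + \<theta>2) = 1 \<or> cos (\<theta>1 + \<theta>2) = - 1"
proof -
  have "cis (2 * \<theta>2) * cis (2 * \<theta>1) = 1"
    using assms by (simp add: sym_point_eq cis_mult)
  then have "cis (2 * (\<theta>1 + \<theta>2)) = 1"
    by (simp add: cis_mult algebra_simps)
  then have "cos (2 * (\<theta>1 + \<theta>2)) = 1" by (simp add: complex_eq_iff)
  then show "sin (\<theta>1 + \<theta>2) = 0" unfolding cos_double_sin by simp
  then show "cos (\<theta>1 + \<theta>2) = 1 \<or> cos (\<theta>1 + \<theta>2) = - 1" by (rule cos_eq_pm1_if_sin_eq_0)
qed

lemma distinct_sym_points:
  assumes "sym_point \<theta>1 \<noteq> sym_point \<theta>2" shows "sin (\<theta>1 - \<theta>2) \<noteq> 0" "\<bar>cos (\<theta>1 - \<theta>2)\<bar> < 1"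
proof -
  show s: "sin (\<theta>1 - \<theta>2) \<noteq> 0"
  proof
    assume "sin (\<theta>1 - \<theta>2) = 0"
    then have "cos (2 * (\<theta>1 - \<theta>2)) = 1" "sin (2 * (\<theta>1 - \<theta>2)) = 0"
      by (simp_all only: cos_double_sin sin_double, simp_all)
    then have "cis (2 * (\<theta>1 - \<theta>2)) = 1" by (simp add: complex_eq_iff)
    then have "cis (2 * \<theta>1) / cis (2 * \<theta>2) = 1" by (simp add: cis_divide algebra_simps)
    then show False using assms by (simp add: sym_point_eq)
  qed
  then have "0 < (sin (\<theta>1 - \<theta>2))^2" by simp
  then have "(cos (\<theta>1 - \<theta>2))^2 < 1" by (simp add: cos_squared_eq)
  then show "\<bar>cos (\<theta>1 - \<theta>2)\<bar> < 1" by (simp add: abs_square_less_1)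
qed

lemma cmc_surface_rotational:
  assumes cmc: "cmc_surface q \<theta>1 \<theta>2 f" and rot: "sym_point \<theta>2 = inverse (sym_point \<theta>1)"
  shows "\<exists>fx fy fxx fxy fyy n. rotational_surface (q * cos (\<theta>1 + \<theta>2)) (cos (\<theta>1 - \<theta>2)) (sin (\<theta>1 - \<theta>2)) f fx fy fxx fxy fyy n"
proof -
  define k where "k = cos (\<theta>1 + \<theta>2)"
  define z where "z = sin (\<theta>1 - \<theta>2)"
  define h where "h = cos (\<theta>1 - \<theta>2)"
  have k: "k = 1 \<or> k = -1" and s0: "sin (\<theta>1 + \<theta>2) = 0"
    using rotational_sym_points[OF rot] by (auto simp: k_def)
  then have k2: "k^2 = 1" by auto
  have q: "q \<noteq> 0" "\<bar>q\<bar> \<le> 1" and z0: "z \<noteq> 0"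
    using cmc distinct_sym_points unfolding cmc_surface_def z_def by auto
  \<comment> \<open>For inverse sym points Q is a real multiple of sin (2 \<theta>1), and sin
    (\<theta>1 + \<theta>2) = 0 reduces this sine to k z.\<close>
  have Q: "\<i> / 2 * complex_of_real q * (inverse (sym_point \<theta>2) - inverse (sym_point \<theta>1)) = of_real (- q * k * z)"
  proof -
    have "sin (2 * \<theta>1) = sin ((\<theta>1 + \<theta>2) + (\<theta>1 - \<theta>2))" by simp
    also have "\<dots> = k * z" unfolding sin_add[of "\<theta>1 + \<theta>2"] k_def z_def s0 by simp
    finally have *: "sin (2 * \<theta>1) = k * z" .
    have "inverse (sym_point \<theta>2) - inverse (sym_point \<theta>1) = cis (2 * \<theta>1) - cis (- (2 * \<theta>1))"
      unfolding rot by (simp add: sym_point_eq)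
    also have "\<dots> = 2 * \<i> * of_real (sin (2 * \<theta>1))"
      by (simp add: complex_eq_iff)
    finally show ?thesis unfolding * by (simp add: complex_eq_iff)
  qed
  have Hz: "cot (\<theta>1 - \<theta>2) * z^2 = h * z"
    using z0 by (simp add: cot_def z_def h_def power2_eq_square)
  let ?I = "\<lambda>(x, y) (a, b). z^2 * (jacobi_dn y (1 - q^2))^2 * (a^2 + b^2)"
  let ?II = "\<lambda>(x, y) (a, b). cot (\<theta>1 - \<theta>2) * z^2 * (jacobi_dn y (1 - q^2))^2 * (a^2 + b^2)
               + Re (of_real (- q * k * z) * (Complex a b)^2)"
  have ff: "has_fundamental_forms f ?I ?II"
    using cmc unfolding cmc_surface_def Let_def Q z_def by blast
  have pq: "(q * k)^2 = q^2" using k2 by (simp add: power_mult_distrib)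
  have Re_sq: "Re (of_real (- q * k * z) * (Complex a b)^2) = - (q * k * z * (a^2 - b^2))" for a b
    by (simp add: power2_eq_square algebra_simps)
  obtain fx fy fxx fxy fyy n where
    C: "C1_partials f fx fy" "C1_partials fx fxx fxy" "C1_partials fy fxy fyy" "continuous_on UNIV n"
     and n: "\<forall>p. norm (n p) = 1 \<and> n p \<bullet> f p = 0 \<and> n p \<bullet> fx p = 0 \<and> n p \<bullet> fy p = 0"
     and I: "\<forall>p a b. (norm (a *\<^sub>R fx p + b *\<^sub>R fy p))^2 = ?I p (a, b)"
     and II: "\<forall>p a b. (a^2 *\<^sub>R fxx p + (2 * a * b) *\<^sub>R fxy p + b^2 *\<^sub>R fyy p) \<bullet> n p = ?II p (a, b)"
    using ff unfolding has_fundamental_forms_def by (elim conjE exE)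
  have sph: "range f \<subseteq> sphere 0 1" using ff unfolding has_fundamental_forms_def by (elim conjE)
  have "rotational_surface (q * k) h z f fx fy fxx fxy fyy n"
  proof
    show "q * k \<noteq> 0" "\<bar>q * k\<bar> \<le> 1" using q k by (auto simp: abs_mult)
    show "h^2 + z^2 = 1" by (simp add: h_def z_def)
    show "norm (n p) = 1 \<and> n p \<bullet> f p = 0 \<and> n p \<bullet> fx p = 0 \<and> n p \<bullet> fy p = 0" for p
      using n by (rule spec)
    show "(norm (a *\<^sub>R fx (x, y) + b *\<^sub>R fy (x, y)))^2 = z^2 * (jacobi_dn y (1 - (q * k)^2))^2 * (a^2 + b^2)" for x y a b
      using I[rule_format, of a "(x, y)" b] unfolding pq prod.case .
    show "(a^2 *\<^sub>R fxx (x, y) + (2 * a * b) *\<^sub>R fxy (x, y) + b^2 *\<^sub>R fyy (x, y)) \<bullet> n (x, y) =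
        h * z * (jacobi_dn y (1 - (q * k)^2))^2 * (a^2 + b^2) - q * k * z * (a^2 - b^2)" for x y a b
      using II[rule_format, of a "(x, y)" b] unfolding pq prod.case Re_sq Hz by simp
  qed (fact z0 sph C)+
  then show ?thesis unfolding k_def h_def z_def by blast
qed

lemma cmc_surface_normal_form:
  assumes cmc: "cmc_surface q \<theta>1 \<theta>2 f" and rot: "sym_point \<theta>2 = inverse (sym_point \<theta>1)"
    and p: "p = q * cos (\<theta>1 + \<theta>2)" and h: "h = cos (\<theta>1 - \<theta>2)" and hp: "h \<noteq> p"
  shows "\<exists>A. orthogonal_transformation A \<and>
     (\<forall>x \<theta>. A (f (x, ampl_F p \<theta>)) = (profile p h \<theta>,
        of_real (sqrt (1 - h^2) * ampl_dn p \<theta> / orbit_speed p h) * cis (orbit_speed p h * x)))"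
proof -
  define z where "z = sin (\<theta>1 - \<theta>2)"
  obtain fx fy fxx fxy fyy n where "rotational_surface p h z f fx fy fxx fxy fyy n"
    using cmc_surface_rotational[OF cmc rot] unfolding p h z_def by blast
  then interpret rotational_surface p h z f fx fy fxx fxy fyy n .
  have z: "\<bar>z\<bar> = sqrt (1 - h^2)" "z^2 = 1 - h^2" using hz by (auto simp: algebra_simps simp flip: real_sqrt_abs)
  have "0 < z^2" using z0 by simp
  then have h1: "\<bar>h\<bar> < 1" using z(2) by (simp add: abs_square_less_1[symmetric])
  have c: "c = orbit_speed p h" by (simp add: c_def orbit_speed_def)
  have vF: "v (ampl_F p \<theta>) = ampl_dn p \<theta>" for \<theta> by (simp add: v_def jacobi_dn_F p0)
  define A where "A v = (Complex (v \<bullet> B1) (v \<bullet> B2), Complex (v \<bullet> B3) (v \<bullet> B4))" for v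
  have A: "orthogonal_transformation A"
    unfolding A_def[abs_def] by (rule orthogonal_transformation_coordinates[OF orthonormal4_B])
  have Af: "A (f (x, y)) = (\<zeta> y, of_real (\<rho> y / c) * cis (c * x))" for x y
    by (simp add: A_def f_coordinates complex_eq_iff)
  have "\<zeta> (ampl_F p \<theta>) = profile p h \<theta>" for \<theta>
  proof (rule profile_unique[where Z = "\<lambda>\<theta>. \<zeta> (ampl_F p \<theta>)" and Z' = "\<lambda>\<theta>. (1 / ampl_dn p \<theta>) *\<^sub>R \<zeta>' (ampl_F p \<theta>)", OF p0 p1 h1 hp])
    show "((\<lambda>\<theta>. \<zeta> (ampl_F p \<theta>)) has_vector_derivative (1 / ampl_dn p \<theta>) *\<^sub>R \<zeta>' (ampl_F p \<theta>)) (at \<theta>)" for \<theta>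
      using vector_diff_chain_at[OF _ DERIV_\<zeta>] DERIV_ampl_F[OF p0, of \<theta>]
      unfolding has_real_derivative_iff_has_vector_derivative o_def by blast
    show "(norm (\<zeta> (ampl_F p \<theta>)))^2 = 1 - (1 - h^2) * (ampl_dn p \<theta>)^2 / (orbit_speed p h)^2" for \<theta>
      unfolding norm_\<zeta> \<rho>_def vF power_divide power_mult_distrib c power2_abs z(2) ..
    show "Im (cnj (\<zeta> (ampl_F p \<theta>)) * (1 / ampl_dn p \<theta>) *\<^sub>R \<zeta>' (ampl_F p \<theta>)) =
         sqrt (1 - h^2) * (h * (ampl_dn p \<theta>)^2 - p) / (orbit_speed p h * ampl_dn p \<theta>)" for \<theta>
    proof -
      have "Im (cnj (\<zeta> (ampl_F p \<theta>)) * (1 / ampl_dn p \<theta>) *\<^sub>R \<zeta>' (ampl_F p \<theta>)) = Im (cnj (\<zeta> (ampl_F p \<theta>)) * \<zeta>' (ampl_F p \<theta>)) / ampl_dn p \<theta>"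
        by (simp add: add_divide_distrib diff_divide_distrib)
      then show ?thesis unfolding angular_momentum vF z c by simp
    qed
    show "\<zeta> (ampl_F p 0) = of_real ((h - p) / orbit_speed p h)"
      by (simp add: \<zeta>_0 c)
  qed
  then show ?thesis
    using A Af by (intro exI[of _ A]) (simp add: \<rho>_def vF z c)
qed

lemma profile_shift:
  assumes "p \<noteq> 0" "\<bar>p\<bar> \<le> 1" "\<bar>h\<bar> < 1" "h \<noteq> p"
  shows "profile p h (\<theta> + of_nat n * pi) = monodromy p h ^ n * profile p h \<theta>"
proof (induction n)
  case (Suc n)
  have "profile p h (\<theta> + of_nat (Suc n) * pi) = profile p h ((\<theta> + of_nat n * pi) + pi)"
    by (simp add: algebra_simps)
  then show ?case using Suc by (simp only: profile_periodic[OF assms] power_Suc mult.assoc)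
qed simp

text \<open>A period with vanishing y-part says nothing about the profile; independence guarantees
  one that moves \<open>y\<close>.\<close>

lemma independent_pair_snd:
  fixes a b :: "real \<times> real"
  assumes "independent {a, b}" "a \<noteq> b" shows "snd a \<noteq> 0 \<or> snd b \<noteq> 0"
proof (rule ccontr)
  assume "\<not> ?thesis"
  then have s: "snd a = 0" "snd b = 0" by auto
  have "a \<noteq> 0" using assms dependent_zero[of "{a, b}"] by auto
  then have "fst a \<noteq> 0" using s by (simp add: prod_eq_iff)
  then have "b = (fst b / fst a) *\<^sub>R a" using s by (simp add: prod_eq_iff)
  then have "b \<in> span {a}" by (metis span_mul span_base singletonI)
  moreover have "{a, b} - {b} = {a}" using assms(2) by auto
  ultimately show False using assms(1) unfolding dependent_def by auto
qed

text \<open>A period that moves \<open>y\<close> must restore both the radius and the profile. For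
  |p| < 1 the radius is maximal exactly where the amplitude is a multiple of pi, so such a period
  shifts the amplitude by \<open>j * pi\<close> with \<open>j \<noteq> 0\<close>. Then the |j|-th
  power of the monodromy fixes the nonzero number \<open>profile p h 0\<close>.\<close>

lemma monodromy_root_of_unity:
  assumes cmc: "cmc_surface q \<theta>1 \<theta>2 f" and rot: "sym_point \<theta>2 = inverse (sym_point \<theta>1)"
    and per: "doubly_periodic f"
    and p: "p = q * cos (\<theta>1 + \<theta>2)" and h: "h = cos (\<theta>1 - \<theta>2)" and hp: "h \<noteq> p"
    and q: "0 < \<bar>q\<bar>" "\<bar>q\<bar> < 1"
  shows "\<exists>n>0. monodromy p h ^ n = 1"
proof -
  obtain A where A: "\<And>x \<theta>. A (f (x, ampl_F p \<theta>)) = (profile p h \<theta>,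
        of_real (sqrt (1 - h^2) * ampl_dn p \<theta> / orbit_speed p h) * cis (orbit_speed p h * x))"
    using cmc_surface_normal_form[OF cmc rot p h hp] by blast
  have p1: "p \<noteq> 0" "\<bar>p\<bar> < 1"
    using q rotational_sym_points(2)[OF rot] unfolding p by (auto simp: abs_mult)
  have h1: "\<bar>h\<bar> < 1"
    using distinct_sym_points cmc unfolding h cmc_surface_def by auto
  note facts = p1(1) less_imp_le[OF p1(2)] h1 hp
  obtain u w where w: "w \<noteq> 0" "\<And>x y. f (x + u, y + w) = f (x, y)"
  proof -
    obtain \<omega>1 \<omega>2 where o: "\<omega>1 \<noteq> \<omega>2" "independent {\<omega>1, \<omega>2}" "\<And>r. f (r + \<omega>1) = f r" "\<And>r. f (r + \<omega>2) = f r"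
      using per unfolding doubly_periodic_def by blast
    obtain \<omega> where om: "snd \<omega> \<noteq> 0" "\<And>r. f (r + \<omega>) = f r"
      using independent_pair_snd[OF o(2,1)] o(3,4) by blast
    have "f (x + fst \<omega>, y + snd \<omega>) = f (x, y)" for x y
      using om(2)[of "(x, y)"] by (simp add: prod_eq_iff plus_prod_def)
    then show thesis using that om(1) by blast
  qed
  obtain \<beta> where \<beta>: "ampl_F p \<beta> = w" using ampl_F_surj[OF facts(1,2)] by blast
  have "A (f (0 + u, 0 + w)) = A (f (0, 0))" unfolding w(2) ..
  then have e: "A (f (u, ampl_F p \<beta>)) = A (f (0, ampl_F p 0))" by (simp add: \<beta>)
  have S: "0 < sqrt (1 - h^2)" using h1 by (simp add: abs_square_less_1)
  have c: "0 < orbit_speed p h" using orbit_speed_square[OF h1] by simp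
  from e have prof: "profile p h \<beta> = profile p h 0"
     and r: "of_real (sqrt (1 - h^2) * ampl_dn p \<beta> / orbit_speed p h) * cis (orbit_speed p h * u) =
       of_real (sqrt (1 - h^2) / orbit_speed p h) * cis 0"
    unfolding A by auto
  have "norm (of_real (sqrt (1 - h^2) * ampl_dn p \<beta> / orbit_speed p h) * cis (orbit_speed p h * u)) =
       norm (of_real (sqrt (1 - h^2) / orbit_speed p h) * cis 0)"
    unfolding r ..
  then have "sqrt (1 - h^2) * ampl_dn p \<beta> / orbit_speed p h = sqrt (1 - h^2) / orbit_speed p h"
    using S c ampl_dn_pos[OF p1(1), of \<beta>] by (simp add: norm_mult norm_divide abs_mult)
  then have "ampl_dn p \<beta> = 1" using S c by simp
  then have "(1 - p^2) * (sin \<beta>)^2 = 0" using ampl_dn_square'[of p \<beta>] by simp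
  moreover have "p^2 < 1" using p1(2) by (simp add: abs_square_less_1)
  ultimately have "sin \<beta> = 0" by simp
  then obtain j :: int where j: "\<beta> = of_int j * pi" using sin_zero_iff_int2 by blast
  have "j \<noteq> 0" using w(1) \<beta> j by auto
  define n where "n = nat \<bar>j\<bar>"
  have n: "0 < n" "of_nat n = \<bar>real_of_int j\<bar>" using \<open>j \<noteq> 0\<close> by (auto simp: n_def)
  have "monodromy p h ^ n * profile p h 0 = profile p h 0"
  proof (cases "0 < j")
    case True
    then show ?thesis using profile_shift[OF facts, of 0 n] prof by (simp add: n j)
  next
    case False
    then have "\<beta> + of_nat n * pi = 0" by (simp add: n j algebra_simps)
    then show ?thesis using profile_shift[OF facts, of \<beta> n] prof by simp
  qed
  then have "monodromy p h ^ n = 1" using profile_nz[OF facts(2-4), of 0] by simp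
  then show ?thesis using n(1) by blast
qed

lemma countable_roots_of_unity: "countable {z::complex. \<exists>n>0. z ^ n = 1}"
proof -
  have "{z::complex. \<exists>n>0. z ^ n = 1} = (\<Union>n\<in>{0<..}. {z. z ^ n = 1})" by auto
  moreover have "countable {z::complex. z ^ n = 1}" if "0 < n" for n
    using finite_roots_unity[of n, where ?'a = complex] that by (intro countable_finite) simp
  ultimately show ?thesis by auto
qed

section \<open>Estimates for the profile\<close>

text \<open>The factor \<open>h - p\<close> gained from the difference of squares makes the first
  term of \<open>profile_num_split\<close> quadratic in \<open>h - p\<close>.\<close>

lemma orbit_speed_minus_sqrt:
  assumes "\<bar>p\<bar> \<le> 1" "\<bar>h\<bar> < 1"
  shows "orbit_speed p h - sqrt (1 - p^2) = - 2 * p * (h - p) / (orbit_speed p h + sqrt (1 - p^2))"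
proof -
  have c: "0 < orbit_speed p h" "(orbit_speed p h)^2 = 1 + p^2 - 2 * p * h"
    using orbit_speed_square[OF assms(2)] by auto
  have m: "(sqrt (1 - p^2))^2 = 1 - p^2" "0 \<le> sqrt (1 - p^2)" using assms by (auto simp: abs_square_le_1)
  have "(orbit_speed p h - sqrt (1 - p^2)) * (orbit_speed p h + sqrt (1 - p^2)) = - 2 * p * (h - p)"
    using c(2) m(1) by (simp add: power2_eq_square algebra_simps)
  moreover have "orbit_speed p h + sqrt (1 - p^2) \<noteq> 0" using c(1) m(2) by linarith
  ultimately show ?thesis by (simp only: eq_divide_eq if_True not_False_eq_True simp_thms)
qed

lemma orbit_speed_ge:
  assumes "\<bar>p\<bar> \<le> 1" "\<bar>h\<bar> < 1" shows "1 - p * h \<le> orbit_speed p h"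
proof -
  have "h^2 \<le> 1" using assms(2) by (simp add: abs_square_le_1)
  then have "0 \<le> p^2 * (1 - h^2)" by simp
  then have "(1 - p * h)^2 \<le> 1 + p^2 - 2 * p * h" by (simp add: power2_eq_square algebra_simps)
  then show ?thesis unfolding orbit_speed_def by (rule real_le_rsqrt)
qed

text \<open>For x in [0, 1] one has 1 - x <= 1 - x^2, and squaring removes the root in
  \<open>ampl_dn\<close>.\<close>

lemma one_minus_cos_dn:
  assumes "\<bar>p\<bar> \<le> 1" "0 \<le> cos \<theta>"
  shows "0 \<le> 1 - cos \<theta> * ampl_dn p \<theta>" "1 - cos \<theta> * ampl_dn p \<theta> \<le> 2 * (sin \<theta>)^2"
proof -
  let ?x = "cos \<theta> * ampl_dn p \<theta>"
  have x: "0 \<le> ?x" "?x \<le> 1"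
    using assms ampl_dn_nonneg[of p \<theta>] ampl_dn_le_1[OF assms(1), of \<theta>] by (auto intro: mult_le_one)
  then show "0 \<le> 1 - ?x" by simp
  have "?x * ?x \<le> ?x" using x mult_left_le by blast
  moreover have "?x * ?x = (cos \<theta>)^2 * (ampl_dn p \<theta>)^2" by (simp add: power2_eq_square)
  moreover have "1 - (cos \<theta>)^2 * (ampl_dn p \<theta>)^2 \<le> 2 * (sin \<theta>)^2"
  proof -
    have "0 \<le> p^2 * (1 - (sin \<theta>)^2) * (sin \<theta>)^2" "0 \<le> (sin \<theta>)^2 * (sin \<theta>)^2"
      by (auto simp: cos_squared_eq[symmetric])
    moreover have gen: "1 - (1 - s) * (1 - (1 - p^2) * s) = 2 * s - s * s - p^2 * (1 - s) * s" for s
      by (simp add: algebra_simps)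
    ultimately show ?thesis unfolding ampl_dn_square' cos_squared_eq gen by linarith
  qed
  ultimately show "1 - ?x \<le> 2 * (sin \<theta>)^2" by linarith
qed

text \<open>Every summand now carries (h - p)^2 or, by \<open>one_minus_cos_dn\<close>, is of order
  sin^2. Both quantities are dominated by \<open>profile_den\<close>, so the quotient stays bounded
  as \<open>h - p\<close> tends to 0.\<close>

lemma profile_num_split:
  assumes "\<bar>p\<bar> \<le> 1" "\<bar>h\<bar> < 1"
  shows "profile_num p h \<theta> = sqrt (1 - h^2) *
    (- 2 * p * (h - p)^2 / (orbit_speed p h + sqrt (1 - p^2))
     + (h - p) * sqrt (1 - p^2) * (1 - cos \<theta> * ampl_dn p \<theta>)
     - orbit_speed p h * h * (1 - p\<^sup>2) * (sin \<theta>)\<^sup>2)"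
proof -
  have "(h - p) * (orbit_speed p h - sqrt (1 - p^2)) = - 2 * p * (h - p)^2 / (orbit_speed p h + sqrt (1 - p^2))"
    unfolding orbit_speed_minus_sqrt[OF assms] by (simp add: power2_eq_square)
  from this[symmetric] show ?thesis
    unfolding profile_num_def by (simp only: mult_cancel_left) (simp add: algebra_simps)
qed

text \<open>\<open>profile_den\<close> is at least (h - p)^2 and at least r^2 sin^2. The first gives
  \<open>2 / r\<close>; the second turns the coefficient 4 + 2 of sin^2 into at most
  \<open>8 / r^2\<close>. The bound supplies the dominating function for the continuity of the
  monodromy.\<close>

lemma profile_num_bound:
  assumes "\<bar>p\<bar> \<le> 1" "\<bar>h\<bar> < 1" "0 \<le> cos \<theta>" "0 < r" "r \<le> 1 - p * h"
  shows "\<bar>profile_num p h \<theta>\<bar> \<le> (2 / r + 8 / r^2) * profile_den p h \<theta>"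
proof -
  define S a c m s where "S = sqrt (1 - h^2)" and "a = h - p" and "c = orbit_speed p h" and "m = sqrt (1 - p^2)"
    and "s = (sin \<theta>)^2"
  have h2: "0 < 1 - h^2" "p^2 \<le> 1" using assms by (auto simp: abs_square_le_1 abs_square_less_1)
  have S: "0 \<le> S" "S \<le> 1" using h2 by (auto simp: S_def)
  have m: "0 \<le> m" "m \<le> 1" using h2 by (auto simp: m_def)
  have a: "\<bar>a\<bar> \<le> 2" using assms by (auto simp: a_def)
  have c: "r \<le> c" "0 < c" using orbit_speed_ge[OF assms(1,2)] assms(4,5) by (auto simp: c_def)
  have "c^2 \<le> 2^2"
  proof -
    have "\<bar>p * h\<bar> \<le> 1" using assms by (simp add: abs_mult mult_le_one)
    then show ?thesis using h2 orbit_speed_square(3)[OF assms(2), of p] by (simp add: c_def abs_le_iff)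
  qed
  then have c2: "c \<le> 2" by (rule power2_le_imp_le) simp
  have D: "a^2 \<le> profile_den p h \<theta>" "r^2 * s \<le> profile_den p h \<theta>"
  proof -
    have "0 \<le> (1 - h^2) * (1 - p^2) * s" using h2 by (simp add: s_def)
    then show "a^2 \<le> profile_den p h \<theta>" by (simp add: profile_den_def a_def s_def)
    have "r^2 \<le> (1 - p * h)^2" using assms(4,5) by (intro power_mono) auto
    then have "r^2 * s \<le> (1 - p * h)^2 * s" by (intro mult_right_mono) (auto simp: s_def)
    then show "r^2 * s \<le> profile_den p h \<theta>"
      unfolding profile_den_eq s_def by (rule add_increasing[rotated]) simp
  qed
  have s: "0 \<le> s" by (simp add: s_def)
  have 1: "\<bar>- 2 * p * a^2 / (c + m)\<bar> \<le> 2 / r * profile_den p h \<theta>"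
  proof -
    have "\<bar>- 2 * p * a^2 / (c + m)\<bar> = (2 * \<bar>p\<bar>) * a^2 / (c + m)" using c m by (simp add: abs_mult)
    also have "\<dots> \<le> 2 * profile_den p h \<theta> / r"
      using c m assms D by (intro frac_le mult_mono) (auto intro: order_trans[OF zero_le_power2])
    finally show ?thesis by simp
  qed
  have 2: "\<bar>a * m * (1 - cos \<theta> * ampl_dn p \<theta>)\<bar> \<le> 4 * s"
  proof -
    have "\<bar>a * m * (1 - cos \<theta> * ampl_dn p \<theta>)\<bar> = \<bar>a\<bar> * m * (1 - cos \<theta> * ampl_dn p \<theta>)"
      using one_minus_cos_dn(1)[OF assms(1,3)] m by (simp add: abs_mult)
    also have "\<dots> \<le> 2 * 1 * (2 * s)"
      using one_minus_cos_dn[OF assms(1,3)] m a by (intro mult_mono) (auto simp: s_def)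
    finally show ?thesis by simp
  qed
  have 3: "\<bar>c * h * (1 - p^2) * s\<bar> \<le> 2 * s"
  proof -
    have "\<bar>c * h * (1 - p^2) * s\<bar> = c * \<bar>h\<bar> * (1 - p^2) * s" using c h2 s by (simp add: abs_mult)
    also have "\<dots> \<le> 2 * 1 * 1 * s"
      using c c2 h2 s assms by (intro mult_mono) auto
    finally show ?thesis by simp
  qed
  have "6 * s \<le> 8 / r^2 * profile_den p h \<theta>"
  proof -
    have "s \<le> profile_den p h \<theta> / r^2" using D(2) assms(4) by (simp add: pos_le_divide_eq mult.commute)
    then show ?thesis using s by simp
  qed
  then have "\<bar>- 2 * p * a^2 / (c + m) + a * m * (1 - cos \<theta> * ampl_dn p \<theta>) - c * h * (1 - p^2) * s\<bar>
       \<le> 2 / r * profile_den p h \<theta> + 8 / r^2 * profile_den p h \<theta>"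
    using 1 2 3 by linarith
  then have "S * \<bar>- 2 * p * a^2 / (c + m) + a * m * (1 - cos \<theta> * ampl_dn p \<theta>) - c * h * (1 - p^2) * s\<bar>
      \<le> 1 * (2 / r * profile_den p h \<theta> + 8 / r^2 * profile_den p h \<theta>)"
    using S by (intro mult_mono) auto
  then show ?thesis
    unfolding profile_num_split[OF assms(1,2)] S_def[symmetric] a_def[symmetric] c_def[symmetric] m_def[symmetric] s_def[symmetric]
    using S(1) by (simp only: abs_mult abs_of_nonneg mult_1 ring_distribs(2))
qed

text \<open>At \<open>p = 0\<close> the last two terms of \<open>profile_num_split\<close> cancel
  and the first vanishes, so a factor |p| can be gained uniformly in \<open>h\<close>. The constant
  20 covers 3 from the quadratic term and 7 * 16/9 from the sin^2 terms.\<close>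

lemma profile_num_small:
  assumes "\<bar>p\<bar> \<le> 1/4" "\<bar>h\<bar> < 1" "0 \<le> cos \<theta>"
  shows "\<bar>profile_num p h \<theta>\<bar> \<le> 20 * \<bar>p\<bar> * profile_den p h \<theta>"
proof -
  define S a c m s where "S = sqrt (1 - h^2)" and "a = h - p" and "c = orbit_speed p h" and "m = sqrt (1 - p^2)"
    and "s = (sin \<theta>)^2"
  have p1: "\<bar>p\<bar> \<le> 1" using assms(1) by simp
  have h2: "0 < 1 - h^2" "p^2 \<le> 1" using assms(2) p1 by (auto simp: abs_square_le_1 abs_square_less_1)
  have S: "0 \<le> S" "S \<le> 1" using h2 by (auto simp: S_def)
  have m: "0 \<le> m" "m \<le> 1" "m^2 = 1 - p^2" using h2 by (auto simp: m_def)
  have ph: "\<bar>p * h\<bar> \<le> \<bar>p\<bar>" using assms(2) by (simp add: abs_mult mult_left_le)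
  have p2: "p^2 \<le> \<bar>p\<bar> / 4"
    using mult_left_mono[OF assms(1), of "\<bar>p\<bar>"] by (simp add: power2_eq_square)
  have a: "\<bar>a\<bar> \<le> 5/4" using assms(1,2) unfolding a_def by linarith
  have c: "3/4 \<le> c" "0 < c" using orbit_speed_ge[OF p1 assms(2)] ph assms(1) by (auto simp: c_def)
  have csq: "c^2 = 1 + p^2 - 2 * (p * h)" using orbit_speed_square(3)[OF assms(2), of p] by (simp add: c_def)
  have "c^2 \<le> (5/4)^2" using csq ph p2 assms(1) by (simp add: power2_eq_square)
  then have c2: "c \<le> 5/4" by (rule power2_le_imp_le) simp
  have s: "0 \<le> s" by (simp add: s_def)
  have D: "a^2 \<le> profile_den p h \<theta>" "s \<le> 16/9 * profile_den p h \<theta>"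
  proof -
    have "0 \<le> (1 - h^2) * (1 - p^2) * s" using h2 s by simp
    then show "a^2 \<le> profile_den p h \<theta>" by (simp add: profile_den_def a_def s_def)
    have "(3/4)^2 \<le> (1 - p * h)^2" using ph assms(1) by (intro power_mono) auto
    then have "(3/4)^2 * s \<le> (1 - p * h)^2 * s" using s by (rule mult_right_mono)
    moreover have "(1 - p * h)^2 * s \<le> profile_den p h \<theta>" by (simp add: profile_den_eq s_def)
    ultimately show "s \<le> 16/9 * profile_den p h \<theta>" by (simp add: power2_eq_square)
  qed
  have 1: "\<bar>- 2 * p * a^2 / (c + m)\<bar> \<le> 3 * \<bar>p\<bar> * profile_den p h \<theta>"
  proof -
    have "\<bar>- 2 * p * a^2 / (c + m)\<bar> = (2 * \<bar>p\<bar>) * a^2 / (c + m)" using c m by (simp add: abs_mult)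
    also have "\<dots> \<le> (2 * \<bar>p\<bar>) * profile_den p h \<theta> / (3/4)"
      using c m D(1) order_trans[OF zero_le_power2 D(1)] by (intro frac_le mult_left_mono) auto
    also have "\<dots> \<le> 3 * \<bar>p\<bar> * profile_den p h \<theta>"
      using order_trans[OF zero_le_power2 D(1)] by (simp add: mult_right_mono)
    finally show ?thesis .
  qed
  have 2: "\<bar>(1 - cos \<theta> * ampl_dn p \<theta>) - s\<bar> \<le> p^2 * s"
  proof -
    let ?d = "ampl_dn p \<theta>"
    have dc: "cos \<theta> \<le> ?d" using ampl_dn_ge_cos[of \<theta> p] by simp
    have "(1 - cos \<theta> * ?d) - s = - (cos \<theta> * (?d - cos \<theta>))"
      using sin_cos_squared_add[of \<theta>] by (simp add: s_def power2_eq_square algebra_simps)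
    then have "\<bar>(1 - cos \<theta> * ?d) - s\<bar> = cos \<theta> * (?d - cos \<theta>)" using assms(3) dc by (simp add: abs_mult)
    also have "\<dots> \<le> (?d + cos \<theta>) * (?d - cos \<theta>)" using dc ampl_dn_nonneg[of p \<theta>] by (intro mult_right_mono) auto
    also have "\<dots> = ?d^2 - (cos \<theta>)^2" by (simp add: power2_eq_square algebra_simps)
    also have "\<dots> = p^2 * s" by (simp add: ampl_dn_square s_def)
    finally show ?thesis .
  qed
  have 3: "\<bar>1 - c * m\<bar> \<le> 3 * \<bar>p\<bar>"
  proof -
    have "\<bar>1 - c * m\<bar> \<le> \<bar>1 - c * m\<bar> * (1 + c * m)"
      using c m by (simp add: mult_left_le_one_le mult_le_cancel_left1)
    also have "\<dots> = \<bar>1 - c^2 * m^2\<bar>"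
    proof -
      have "(1 - c * m) * (1 + c * m) = 1 - c^2 * m^2" by (simp add: power2_eq_square algebra_simps)
      moreover have "0 \<le> 1 + c * m" using c m by simp
      ultimately show ?thesis by (metis abs_mult abs_of_nonneg)
    qed
    also have "\<dots> \<le> 3 * \<bar>p\<bar>"
    proof -
      have "1 - c^2 * m^2 = p^2 * p^2 + 2 * (p * h) - 2 * (p * h) * p^2"
        unfolding csq m(3) by (simp add: algebra_simps)
      moreover have "\<bar>p^2 * p^2\<bar> \<le> \<bar>p\<bar> / 4" using p2 h2(2) mult_left_le_one_le[of "p^2" "p^2"] by simp
      moreover have "\<bar>(p * h) * p^2\<bar> \<le> \<bar>p\<bar> * (1/16)"
        unfolding abs_mult[of "p * h"] using ph p2 assms(1) by (intro mult_mono) auto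
      ultimately show ?thesis using ph by linarith
    qed
    finally show ?thesis .
  qed
  have 4: "\<bar>a * m * (1 - cos \<theta> * ampl_dn p \<theta>) - c * h * (1 - p^2) * s\<bar> \<le> 7 * \<bar>p\<bar> * s"
  proof -
    \<comment> \<open>The rearrangement isolates three deviations that vanish with \<open>p\<close>:
      that of 1 - cos dn from sin^2, that of \<open>c * m\<close> from 1, and that of
      \<open>h - p\<close> from \<open>h\<close>.\<close>
    have e: "a * m * (1 - cos \<theta> * ampl_dn p \<theta>) - c * h * (1 - p^2) * s
      = a * (m * ((1 - cos \<theta> * ampl_dn p \<theta>) - s)) + a * (m * (s * (1 - c * m))) - c * (p * ((1 - p^2) * s))"
      unfolding m(3)[symmetric] a_def by (simp add: power2_eq_square algebra_simps)
    have tri: "\<bar>X + Y - Z\<bar> \<le> x + y + z" if "\<bar>X\<bar> \<le> x" "\<bar>Y\<bar> \<le> y" "\<bar>Z\<bar> \<le> z" for X Y Z x y z :: real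
      using that by linarith
    have b1: "\<bar>a * (m * ((1 - cos \<theta> * ampl_dn p \<theta>) - s))\<bar> \<le> 5/4 * (1 * (\<bar>p\<bar> / 4 * s))"
      unfolding abs_mult using a m 2 mult_right_mono[OF p2 s] by (intro mult_mono) auto
    have b2: "\<bar>a * (m * (s * (1 - c * m)))\<bar> \<le> 5/4 * (1 * (s * (3 * \<bar>p\<bar>)))"
      unfolding abs_mult using a m 3 s by (intro mult_mono) auto
    have b3: "\<bar>c * (p * ((1 - p^2) * s))\<bar> \<le> 5/4 * (\<bar>p\<bar> * (1 * s))"
      unfolding abs_mult using c c2 h2 s by (intro mult_mono) auto
    have "0 \<le> \<bar>p\<bar> * s" using s by simp
    then have "5/4 * (1 * (\<bar>p\<bar> / 4 * s)) + 5/4 * (1 * (s * (3 * \<bar>p\<bar>))) + 5/4 * (\<bar>p\<bar> * (1 * s)) \<le> 7 * \<bar>p\<bar> * s"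
      by (simp add: algebra_simps)
    then show ?thesis unfolding e using tri[OF b1 b2 b3] by linarith
  qed
  have "\<bar>- 2 * p * a^2 / (c + m) + a * m * (1 - cos \<theta> * ampl_dn p \<theta>) - c * h * (1 - p^2) * s\<bar>
       \<le> 20 * \<bar>p\<bar> * profile_den p h \<theta>"
  proof -
    have "7 * \<bar>p\<bar> * s \<le> 7 * \<bar>p\<bar> * (16/9 * profile_den p h \<theta>)"
      using D(2) by (intro mult_left_mono) auto
    moreover have "0 \<le> \<bar>p\<bar> * profile_den p h \<theta>" using order_trans[OF zero_le_power2 D(1)] by simp
    moreover have "\<bar>X + Y - Z\<bar> \<le> x + y" if "\<bar>X\<bar> \<le> x" "\<bar>Y - Z\<bar> \<le> y" for X Y Z x y :: real
      using that by linarith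
    from this[OF 1 4] have "\<bar>- 2 * p * a^2 / (c + m) + a * m * (1 - cos \<theta> * ampl_dn p \<theta>) - c * h * (1 - p^2) * s\<bar>
      \<le> 3 * \<bar>p\<bar> * profile_den p h \<theta> + 7 * \<bar>p\<bar> * s" .
    ultimately show ?thesis by linarith
  qed
  then have "S * \<bar>- 2 * p * a^2 / (c + m) + a * m * (1 - cos \<theta> * ampl_dn p \<theta>) - c * h * (1 - p^2) * s\<bar>
      \<le> 1 * (20 * \<bar>p\<bar> * profile_den p h \<theta>)"
    using S by (intro mult_mono) auto
  then show ?thesis
    unfolding profile_num_split[OF p1 assms(2)] S_def[symmetric] a_def[symmetric] c_def[symmetric] m_def[symmetric] s_def[symmetric]
    using S by (simp add: abs_mult)
qed

section \<open>Smallness of the remaining angle and the limit of the profile arc\<close>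

lemma cos_ge_linear:
  assumes "0 \<le> x" "x \<le> pi / 2" shows "1 - 2 * x / pi \<le> cos x"
proof -
  have "convex_on {0..pi/2} (\<lambda>x. - cos x)"
    by (rule f''_ge0_imp_convex[where f' = sin and f'' = cos])
       (auto intro!: derivative_eq_intros cos_ge_zero)
  from convex_onD[OF this, of "2 * x / pi" 0 "pi / 2"] assms show ?thesis
    by (simp add: field_simps)
qed

text \<open>The average of two lower bounds: the cosine, replaced by its chord, makes the integral
  of 1/dn logarithmic, and |p| keeps the bound positive up to pi/2.\<close>

lemma ampl_dn_ge_linear:
  assumes "\<bar>p\<bar> \<le> 1" "0 \<le> x" "x \<le> pi / 2" shows "(1 - 2 * x / pi + \<bar>p\<bar>) / 2 \<le> ampl_dn p x"
  using cos_ge_linear[OF assms(2,3)] ampl_dn_ge_cos[of x p] ampl_dn_ge[OF assms(1), of x] abs_ge_self[of "cos x"]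
  by (simp only: le_divide_eq_numeral divide_le_eq_numeral1 mult_2_right)

text \<open>Since 1 + 1/x <= (1 + 1/sqrt x)^2, the logarithm of 1 + 1/x is at most 2 / sqrt x. This
  trades |p| log (1/|p|) for a power of |p|.\<close>

lemma ln_one_plus_le:
  assumes "0 < x" "x \<le> 1" shows "x * (ln (1 + x) - ln x) \<le> 2 * sqrt x"
proof -
  have "ln (1 + x) - ln x = ln (1 + 1 / x)"
    using assms ln_div[of "1 + x" x] by (simp add: add_divide_distrib add.commute)
  also have "\<dots> \<le> ln ((1 + 1 / sqrt x)^2)"
    using assms by (subst ln_le_cancel_iff) (auto simp: power2_sum power_divide add_pos_pos)
  also have "\<dots> = 2 * ln (1 + 1 / sqrt x)"
    using assms by (simp add: ln_realpow add_pos_pos)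
  also have "\<dots> \<le> 2 * (1 / sqrt x)"
    using assms by (intro mult_left_mono ln_add_one_self_le_self) auto
  finally have "x * (ln (1 + x) - ln x) \<le> x * (2 * (1 / sqrt x))"
    using assms by (intro mult_left_mono) auto
  also have "\<dots> = 2 * sqrt x"
    using assms by (simp add: real_div_sqrt[unfolded divide_inverse] divide_inverse)
  finally show ?thesis .
qed

lemma profile_arg_minus:
  assumes "p \<noteq> 0" "\<bar>p\<bar> \<le> 1" "\<bar>h\<bar> < 1" "h \<noteq> p"
  shows "profile_arg p h (- \<theta>) = - profile_arg p h \<theta>"
proof -
  have "((\<lambda>\<theta>. profile_arg p h \<theta> + profile_arg p h (- \<theta>)) has_real_derivative 0) (at \<theta>)" for \<theta>
  proof -
    have "((\<lambda>\<theta>. profile_arg p h (- \<theta>)) has_real_derivative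
        profile_num p h (- \<theta>) / (profile_den p h (- \<theta>) * ampl_dn p (- \<theta>)) * (- 1)) (at \<theta>)"
      by (rule DERIV_chain2[OF DERIV_profile_arg[OF assms]]) (auto intro!: derivative_eq_intros)
    from DERIV_add[OF DERIV_profile_arg[OF assms, of \<theta>] this] show ?thesis
      by (simp add: profile_num_def profile_den_def)
  qed
  then have "profile_arg p h \<theta> + profile_arg p h (- \<theta>) = profile_arg p h 0 + profile_arg p h (- 0)"
    using DERIV_isconst_all[of "\<lambda>\<theta>. profile_arg p h \<theta> + profile_arg p h (- \<theta>)" \<theta> 0] by blast
  then show ?thesis by simp
qed

lemma profile_arg_small:
  assumes "p \<noteq> 0" "\<bar>p\<bar> \<le> 1/4" "\<bar>h\<bar> < 1" "h \<noteq> p" "\<bar>\<theta>\<bar> \<le> pi / 2"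
  shows "\<bar>profile_arg p h \<theta>\<bar> \<le> 160 * sqrt \<bar>p\<bar>"
proof -
  have p1: "\<bar>p\<bar> \<le> 1" "0 < \<bar>p\<bar>" using assms(1,2) by auto
  note facts = assms(1) p1(1) assms(3,4)
  \<comment> \<open>\<open>H\<close> is the antiderivative, vanishing at 0, of the bound 20 |p| / dn
    after dn is replaced by \<open>ampl_dn_ge_linear\<close>. Below, 160 arises as 20 * 4 * 2 from
    pi < 4 and \<open>ln_one_plus_le\<close>.\<close>
  define H where "H x = 20 * pi * \<bar>p\<bar> * (ln (1 + \<bar>p\<bar>) - ln (1 - 2 * x / pi + \<bar>p\<bar>))" for x
  define e where "e x = profile_num p h x / (profile_den p h x * ampl_dn p x)" for x
  have dH: "(H has_real_derivative 40 * \<bar>p\<bar> / (1 - 2 * x / pi + \<bar>p\<bar>)) (at x)"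
    and eH: "\<bar>e x\<bar> \<le> 40 * \<bar>p\<bar> / (1 - 2 * x / pi + \<bar>p\<bar>)" if x: "0 \<le> x" "x \<le> pi / 2" for x
  proof -
    have "2 * x / pi \<le> 1" using x by (simp add: divide_le_eq)
    then have pos: "0 < 1 - 2 * x / pi + \<bar>p\<bar>" using p1(2) by linarith
    show "(H has_real_derivative 40 * \<bar>p\<bar> / (1 - 2 * x / pi + \<bar>p\<bar>)) (at x)"
      unfolding H_def[abs_def] by (rule derivative_eq_intros refl pos | simp)+
    have D: "0 < profile_den p h x" using profile_den_pos[OF p1(1) assms(3)] assms(4) by simp
    have "0 \<le> cos x" using x by (intro cos_ge_zero) auto
    from profile_num_small[OF assms(2,3) this]
    have N: "\<bar>profile_num p h x\<bar> / profile_den p h x \<le> 20 * \<bar>p\<bar>" using D by (simp add: pos_divide_le_eq)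
    have d: "0 < ampl_dn p x" by (rule ampl_dn_pos[OF assms(1)])
    have "\<bar>e x\<bar> = (\<bar>profile_num p h x\<bar> / profile_den p h x) / ampl_dn p x"
      unfolding e_def using D d by (simp add: abs_mult)
    also have "\<dots> \<le> (20 * \<bar>p\<bar>) / ((1 - 2 * x / pi + \<bar>p\<bar>) / 2)"
      using N D d pos ampl_dn_ge_linear[OF p1(1) x] by (intro frac_le) auto
    finally show "\<bar>e x\<bar> \<le> 40 * \<bar>p\<bar> / (1 - 2 * x / pi + \<bar>p\<bar>)" by simp
  qed
  have H0: "H 0 = 0" by (simp add: H_def)
  have pos_case: "\<bar>profile_arg p h x\<bar> \<le> H x" if x: "0 \<le> x" "x \<le> pi / 2" for x
  proof -
    have "H 0 - profile_arg p h 0 \<le> H x - profile_arg p h x"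
    proof (rule DERIV_nonneg_imp_nondecreasing[OF x(1)])
      fix y assume y: "0 \<le> y" "y \<le> x"
      then have y': "0 \<le> y" "y \<le> pi / 2" using x by auto
      show "\<exists>d. ((\<lambda>x. H x - profile_arg p h x) has_real_derivative d) (at y) \<and> 0 \<le> d"
        using DERIV_diff[OF dH[OF y'] DERIV_profile_arg[OF facts, of y]] eH[OF y'] unfolding e_def[symmetric]
        by (intro exI[of _ "40 * \<bar>p\<bar> / (1 - 2 * y / pi + \<bar>p\<bar>) - e y"]) auto
    qed
    moreover have "H 0 + profile_arg p h 0 \<le> H x + profile_arg p h x"
    proof (rule DERIV_nonneg_imp_nondecreasing[OF x(1)])
      fix y assume y: "0 \<le> y" "y \<le> x"
      then have y': "0 \<le> y" "y \<le> pi / 2" using x by auto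
      show "\<exists>d. ((\<lambda>x. H x + profile_arg p h x) has_real_derivative d) (at y) \<and> 0 \<le> d"
        using DERIV_add[OF dH[OF y'] DERIV_profile_arg[OF facts, of y]] eH[OF y'] unfolding e_def[symmetric]
        by (intro exI[of _ "40 * \<bar>p\<bar> / (1 - 2 * y / pi + \<bar>p\<bar>) + e y"]) auto
    qed
    ultimately show ?thesis by (simp add: H0 abs_le_iff)
  qed
  have H_le: "H x \<le> 160 * sqrt \<bar>p\<bar>" if x: "0 \<le> x" "x \<le> pi / 2" for x
  proof -
    have "2 * x / pi \<le> 1" using x by (simp add: divide_le_eq)
    then have "\<bar>p\<bar> \<le> 1 - 2 * x / pi + \<bar>p\<bar>" by simp
    then have "ln \<bar>p\<bar> \<le> ln (1 - 2 * x / pi + \<bar>p\<bar>)" using p1(2) by (intro ln_mono) auto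
    then have "H x \<le> 20 * pi * \<bar>p\<bar> * (ln (1 + \<bar>p\<bar>) - ln \<bar>p\<bar>)"
      unfolding H_def by (intro mult_left_mono) auto
    also have "\<dots> \<le> 20 * 4 * (2 * sqrt \<bar>p\<bar>)"
    proof -
      have "ln \<bar>p\<bar> \<le> ln (1 + \<bar>p\<bar>)" using p1(2) by simp
      then have "0 \<le> \<bar>p\<bar> * (ln (1 + \<bar>p\<bar>) - ln \<bar>p\<bar>)" by simp
      then have "20 * pi * (\<bar>p\<bar> * (ln (1 + \<bar>p\<bar>) - ln \<bar>p\<bar>)) \<le> 20 * 4 * (2 * sqrt \<bar>p\<bar>)"
        using ln_one_plus_le[OF p1(2,1)] pi_less_4 by (intro mult_mono[of "20 * pi"]) auto
      then show ?thesis by (simp only: mult.assoc)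
    qed
    finally show ?thesis by simp
  qed
  show ?thesis
  proof (cases "0 \<le> \<theta>")
    case True
    then show ?thesis using pos_case[of \<theta>] H_le[of \<theta>] assms(5) by auto
  next
    case False
    then show ?thesis using pos_case[of "- \<theta>"] H_le[of "- \<theta>"] assms(5) profile_arg_minus[OF facts, of \<theta>] by auto
  qed
qed

lemma norm_cis_minus_1: "norm (cis x - 1) \<le> \<bar>x\<bar>"
proof -
  have "cos x = 1 - 2 * (sin (x / 2))^2"
    using cos_double_sin[of "x / 2"] by simp
  then have "(norm (cis x - 1))^2 = (2 * \<bar>sin (x / 2)\<bar>)^2"
    unfolding cmod_power2 using sin_cos_squared_add[of x]
    by (simp add: power2_diff power_mult_distrib)
  then have "norm (cis x - 1) = 2 * \<bar>sin (x / 2)\<bar>"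
    by (rule power2_eq_imp_eq) auto
  then show ?thesis using abs_sin_x_le_abs_x[of "x / 2"] by simp
qed

lemma orbit_speed_small:
  assumes "\<bar>p\<bar> \<le> 1/4" "\<bar>h\<bar> < 1"
  shows "\<bar>1 / orbit_speed p h - 1\<bar> \<le> 4 * \<bar>p\<bar>" "3/4 \<le> orbit_speed p h"
proof -
  define c where "c = orbit_speed p h"
  have p1: "\<bar>p\<bar> \<le> 1" using assms(1) by simp
  have ph: "\<bar>p * h\<bar> \<le> \<bar>p\<bar>" using assms(2) by (simp add: abs_mult mult_left_le)
  have p2: "p^2 \<le> \<bar>p\<bar> / 4"
    using mult_left_mono[OF assms(1), of "\<bar>p\<bar>"] by (simp add: power2_eq_square)
  have c: "3/4 \<le> c" using orbit_speed_ge[OF p1 assms(2)] ph assms(1) by (auto simp: c_def)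
  then show "3/4 \<le> orbit_speed p h" by (simp add: c_def)
  have csq: "c^2 = 1 + p^2 - 2 * (p * h)" using orbit_speed_square(3)[OF assms(2), of p] by (simp add: c_def)
  have "\<bar>1 - c\<bar> * (7/4) \<le> \<bar>1 - c\<bar> * (1 + c)" using c by (intro mult_left_mono) auto
  then have "\<bar>1 - c\<bar> \<le> \<bar>1 - c\<bar> * (1 + c) / (7/4)" by simp
  also have "\<bar>1 - c\<bar> * (1 + c) = \<bar>1 - c^2\<bar>"
  proof -
    have "(1 - c) * (1 + c) = 1 - c^2" by (simp add: power2_eq_square algebra_simps)
    then show ?thesis using c by (metis abs_mult abs_of_nonneg add_nonneg_nonneg zero_le_one order_trans divide_nonneg_nonneg zero_le_numeral)
  qed
  also have "\<bar>1 - c^2\<bar> \<le> 9/4 * \<bar>p\<bar>" unfolding csq using p2 ph zero_le_power2[of p] by linarith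
  finally have "\<bar>1 - c\<bar> \<le> 9/7 * \<bar>p\<bar>" by simp
  then have le: "\<bar>1 - c\<bar> / c \<le> (9/7 * \<bar>p\<bar>) / (3/4)" using c by (intro frac_le) auto
  have "\<bar>1 / c - 1\<bar> = \<bar>1 - c\<bar> / c" using c by (simp add: abs_if divide_simps)
  also note le
  also have "(9/7 * \<bar>p\<bar>) / (3/4) \<le> 4 * \<bar>p\<bar>" by simp
  finally show "\<bar>1 / orbit_speed p h - 1\<bar> \<le> 4 * \<bar>p\<bar>" unfolding c_def[symmetric] .
qed

text \<open>Three errors add up: 160 from the remaining angle, 5/2 * 4 from replacing the orbit
  speed by 1, and 2 from setting \<open>p = 0\<close> in the base, where |p| <= sqrt |p|. The
  comparison curve is a vertical chord of the unit circle, with \<open>h\<close> kept as it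
  is.\<close>

lemma profile_close:
  assumes "p \<noteq> 0" "\<bar>p\<bar> \<le> 1/4" "\<bar>h\<bar> < 1" "h \<noteq> p" "\<bar>\<theta>\<bar> \<le> pi / 2"
  shows "norm (profile p h \<theta> - Complex h (sqrt (1 - h^2) * sin \<theta>)) \<le> 180 * sqrt \<bar>p\<bar>"
proof -
  define S c B B0 where "S = sqrt (1 - h^2)" and "c = orbit_speed p h" and "B = profile_base p h \<theta>"
    and "B0 = Complex h (S * sin \<theta>)"
  have p1: "\<bar>p\<bar> \<le> 1" using assms(2) by simp
  have h2: "0 < 1 - h^2" "p^2 \<le> 1" using assms(3) p1 by (auto simp: abs_square_le_1 abs_square_less_1)
  have S: "0 \<le> S" "S \<le> 1" using h2 by (auto simp: S_def)
  have c: "\<bar>1 / c - 1\<bar> \<le> 4 * \<bar>p\<bar>" "3/4 \<le> c" using orbit_speed_small[OF assms(2,3)] by (auto simp: c_def)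
  have nB: "norm B \<le> 5 / 2"
  proof -
    have "norm B \<le> \<bar>Re B\<bar> + \<bar>Im B\<bar>" by (rule cmod_le)
    moreover have "\<bar>Re B\<bar> \<le> 5/4"
      using assms(2,3) abs_triangle_ineq4[of h p] by (simp add: B_def profile_base_def)
    moreover have "\<bar>Im B\<bar> = S * sqrt (1 - p^2) * \<bar>sin \<theta>\<bar>"
      using S h2 by (simp add: B_def profile_base_def S_def abs_mult)
    moreover have "S * sqrt (1 - p^2) * \<bar>sin \<theta>\<bar> \<le> 1 * 1 * 1"
      using S h2 by (intro mult_mono) auto
    ultimately show ?thesis by linarith
  qed
  have nBc: "norm (B / of_real c) \<le> 1"
  proof -
    have "of_real ((norm B)^2) = complex_of_real (profile_den p h \<theta>)"
        using norm_profile_base[OF p1 assms(3), of \<theta>] unfolding B_def by (simp only: complex_norm_square)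
    then have "(norm B)^2 = profile_den p h \<theta>" by (simp only: of_real_eq_iff)
    also have "\<dots> \<le> (h - p)^2 + (1 - h^2) * 1 * 1"
    proof -
      have s1: "(sin \<theta>)^2 \<le> 1" by (simp add: abs_square_le_1)
      have p2: "1 - p^2 \<le> 1" "0 \<le> 1 - p^2" using h2(2) by simp_all
      have "(1 - h^2) * (1 - p^2) * (sin \<theta>)^2 \<le> (1 - h^2) * 1 * 1"
        by (rule mult_mono[OF mult_left_mono[OF p2(1)] s1]) (use h2 in simp_all)
      then show ?thesis unfolding profile_den_def by simp
    qed
    also have "\<dots> = c^2" using orbit_speed_square(1)[OF assms(3), of p] by (simp add: c_def)
    finally have "norm B \<le> c" by (rule power2_le_imp_le) (use c(2) in simp)
    then show ?thesis using c(2) by (simp add: norm_divide)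
  qed
  have BB0: "norm (B - B0) \<le> 2 * \<bar>p\<bar>"
  proof -
    have m: "\<bar>sqrt (1 - p^2) - 1\<bar> \<le> \<bar>p\<bar>"
    proof -
      have "sqrt (1 - p^2) \<le> 1" by simp
      moreover have "1 - \<bar>p\<bar> \<le> sqrt (1 - p^2)"
        using p1 mult_left_le[OF p1, of "\<bar>p\<bar>"] by (intro real_le_rsqrt) (simp add: power2_eq_square algebra_simps)
      ultimately show ?thesis by linarith
    qed
    have "norm (B - B0) \<le> \<bar>Re (B - B0)\<bar> + \<bar>Im (B - B0)\<bar>" by (rule cmod_le)
    also have "Re (B - B0) = - p" by (simp add: B_def B0_def profile_base_def)
    also have "Im (B - B0) = S * (sqrt (1 - p^2) - 1) * sin \<theta>"
      by (simp add: B_def B0_def profile_base_def S_def algebra_simps)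
    also have "\<bar>S * (sqrt (1 - p^2) - 1) * sin \<theta>\<bar> \<le> 1 * \<bar>p\<bar> * 1"
      unfolding abs_mult using S m by (intro mult_mono) auto
    finally show ?thesis by simp
  qed
  have sq: "\<bar>p\<bar> \<le> sqrt \<bar>p\<bar>"
    using p1 mult_left_le[OF p1, of "\<bar>p\<bar>"] by (intro real_le_rsqrt) (simp add: power2_eq_square)
  have "B / of_real c * e - B0 = B / of_real c * (e - 1) + B * of_real (1 / c - 1) + (B - B0)" for e
    by (simp add: divide_inverse ring_distribs)
  then have "profile p h \<theta> - B0 = B / of_real c * (cis (profile_arg p h \<theta>) - 1) + B * of_real (1 / c - 1) + (B - B0)"
    unfolding profile_def B_def[symmetric] c_def[symmetric] .
  also have "norm \<dots> \<le> norm (B / of_real c * (cis (profile_arg p h \<theta>) - 1)) + norm (B * of_real (1 / c - 1)) + norm (B - B0)"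
    by (intro norm_triangle_le add_mono order_refl)
  also have "norm (B * of_real (1 / c - 1)) \<le> 5 / 2 * (4 * \<bar>p\<bar>)"
    unfolding norm_mult norm_of_real using nB c by (intro mult_mono) auto
  also have "norm (B / of_real c * (cis (profile_arg p h \<theta>) - 1)) \<le> 1 * (160 * sqrt \<bar>p\<bar>)"
    unfolding norm_mult
    using nBc order_trans[OF norm_cis_minus_1 profile_arg_small[OF assms]] by (intro mult_mono) auto
  finally show ?thesis using BB0 sq unfolding B0_def S_def by linarith
qed

section \<open>The monodromy\<close>

definition monodromy_integrand :: "real \<Rightarrow> real \<Rightarrow> real \<Rightarrow> real" where
  "monodromy_integrand p h t = profile_num p h t / (profile_den p h t * ampl_dn p t)"

text \<open>For \<open>h = p\<close> numerator and denominator share the factor sin^2; after its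
  cancellation the integrand agrees with a continuous function away from t = 0.\<close>

lemma monodromy_integrand_integrable:
  assumes "p \<noteq> 0" "\<bar>p\<bar> \<le> 1" "\<bar>h\<bar> < 1"
  shows "monodromy_integrand p h integrable_on {-pi/2..pi/2}"
proof (cases "h = p")
  case False
  show ?thesis unfolding monodromy_integrand_def
    using has_integral_integrable[OF profile_arg_diff[OF assms False, of "- pi / 2" "pi / 2"]] by simp
next
  case True
  let ?g = "\<lambda>t. sqrt (1 - h^2) * (- orbit_speed p h * h) / ((1 - h^2) * ampl_dn p t)"
  have "?g integrable_on {-pi/2..pi/2}"
    by (intro integrable_continuous_interval continuous_intros)
       (use ampl_dn_pos[OF assms(1)] assms(3) True in \<open>auto simp: less_le power2_eq_1_iff\<close>)
  moreover have "monodromy_integrand p h t = ?g t" if "t \<in> {-pi/2..pi/2} - {0}" for t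
  proof -
    have "(sin t)^2 \<noteq> 0"
      using that sin_eq_0_pi[of t] pi_gt_zero by auto
    moreover have "1 - p^2 \<noteq> 0" using assms(3) True by (auto simp: abs_square_less_1[symmetric])
    ultimately show ?thesis
      by (simp add: monodromy_integrand_def profile_num_def profile_den_def True)
  qed
  ultimately show ?thesis
    by (intro integrable_spike_finite[of "{0}", OF _ _ \<open>?g integrable_on _\<close>]) auto
qed

lemma monodromy_integrand_bound:
  assumes "\<bar>p\<bar> \<le> 1" "\<bar>h\<bar> < 1" "t \<in> {-pi/2..pi/2}" "0 < r" "r \<le> 1 - p * h" "0 < d" "d \<le> \<bar>p\<bar>"
  shows "\<bar>monodromy_integrand p h t\<bar> \<le> (2 / r + 8 / r^2) / d"
proof -
  have "0 \<le> cos t" using assms(3) by (intro cos_ge_zero) auto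
  from profile_num_bound[OF assms(1,2) this assms(4,5)]
  have N: "\<bar>profile_num p h t\<bar> \<le> (2 / r + 8 / r^2) * profile_den p h t" .
  have D: "0 \<le> profile_den p h t" unfolding profile_den_eq by simp
  have "d \<le> ampl_dn p t" using ampl_dn_ge[OF assms(1), of t] assms(7) by simp
  show ?thesis
  proof (cases "profile_den p h t = 0")
    case True
    then show ?thesis using assms by (simp add: monodromy_integrand_def)
  next
    case False
    then have "\<bar>profile_num p h t\<bar> / profile_den p h t \<le> 2 / r + 8 / r^2" using N D by (simp add: pos_divide_le_eq)
    moreover have "\<bar>monodromy_integrand p h t\<bar> = (\<bar>profile_num p h t\<bar> / profile_den p h t) / ampl_dn p t"
      using D \<open>d \<le> ampl_dn p t\<close> assms(6) by (simp add: monodromy_integrand_def abs_mult)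
    ultimately show ?thesis
      using \<open>d \<le> ampl_dn p t\<close> assms D by (simp only:) (intro frac_le, auto)
  qed
qed

text \<open>Dominated convergence. The point t = 0 is removed because for a limit with
  \<open>h = p\<close> the integrands need not converge there.\<close>

lemma tendsto_monodromy_integral:
  fixes P H :: "nat \<Rightarrow> real"
  assumes P: "P \<longlonglongrightarrow> p" and H: "H \<longlonglongrightarrow> h"
    and PH: "\<And>n. P n \<noteq> 0" "\<And>n. \<bar>P n\<bar> \<le> 1" "\<And>n. \<bar>H n\<bar> < 1"
    and ph: "p \<noteq> 0" "\<bar>p\<bar> \<le> 1" "\<bar>h\<bar> < 1"
    and r: "0 < r" "\<And>n. r \<le> 1 - P n * H n" and d: "0 < d" "\<And>n. d \<le> \<bar>P n\<bar>"
  shows "(\<lambda>n. integral {-pi/2..pi/2} (monodromy_integrand (P n) (H n))) \<longlonglongrightarrow> integral {-pi/2..pi/2} (monodromy_integrand p h)"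
proof -
  let ?I = "{-pi/2..pi/2} - {0::real}"
  have neg: "negligible ({-pi/2..pi/2} - ?I \<union> (?I - {-pi/2..pi/2}))"
    by (rule negligible_subset[of "{0}"]) auto
  have int_eq: "integral {-pi/2..pi/2} g = integral ?I g" for g :: "real \<Rightarrow> real"
    by (rule integral_subset_negligible[symmetric]) (auto intro: negligible_subset[of "{0}"])
  have "(\<lambda>n. integral ?I (monodromy_integrand (P n) (H n))) \<longlonglongrightarrow> integral ?I (monodromy_integrand p h)"
  proof (rule dominated_convergence(2)[where h = "\<lambda>_. (2 / r + 8 / r^2) / d"])
    show "monodromy_integrand (P n) (H n) integrable_on ?I" for n
      using monodromy_integrand_integrable[OF PH] integrable_spike_set_eq[OF neg] by blast
    have "(\<lambda>_. (2 / r + 8 / r^2) / d) integrable_on {-pi/2..pi/2}" by (rule integrable_const_ivl)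
    then show "(\<lambda>_. (2 / r + 8 / r^2) / d) integrable_on ?I"
      using integrable_spike_set_eq[OF neg] by blast
    show "norm (monodromy_integrand (P n) (H n) t) \<le> (2 / r + 8 / r^2) / d" if "t \<in> ?I" for n t
      using monodromy_integrand_bound[OF PH(2,3) _ r(1) r(2) d(1) d(2), of t] that by simp
    show "(\<lambda>n. monodromy_integrand (P n) (H n) t) \<longlonglongrightarrow> monodromy_integrand p h t" if t: "t \<in> ?I" for t
    proof -
      have "sin t \<noteq> 0"
        using t sin_eq_0_pi[of t] pi_gt_zero by auto
      then have "profile_den p h t \<noteq> 0" using profile_den_pos[OF ph(2,3), of t] by simp
      moreover have "ampl_dn p t \<noteq> 0" using ampl_dn_pos[OF ph(1), of t] by simp
      ultimately show ?thesis
        unfolding monodromy_integrand_def profile_num_def profile_den_def ampl_dn_def orbit_speed_def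
        by (intro tendsto_intros P H) auto
    qed
  qed
  then show ?thesis by (simp only: int_eq)
qed

lemma tendsto_monodromy:
  fixes P H :: "nat \<Rightarrow> real"
  assumes P: "P \<longlonglongrightarrow> p" and H: "H \<longlonglongrightarrow> h"
    and PH: "\<And>n. P n \<noteq> 0" "\<And>n. \<bar>P n\<bar> \<le> 1" "\<And>n. \<bar>H n\<bar> < 1"
    and ph: "p \<noteq> 0" "\<bar>p\<bar> \<le> 1" "\<bar>h\<bar> < 1"
  shows "(\<lambda>n. monodromy (P n) (H n)) \<longlonglongrightarrow> monodromy p h"
proof -
  \<comment> \<open>Half of each limit is a positive lower bound for all late indices; the sequence
    is shifted past the others.\<close>
  define r where "r = (1 - p * h) / 2"
  define d where "d = \<bar>p\<bar> / 2"
  have r: "0 < r" "r < 1 - p * h" using ph_less_1[OF ph(2,3)] by (auto simp: r_def mult.commute)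
  have d: "0 < d" "d < \<bar>p\<bar>" using ph(1) by (auto simp: d_def)
  have "(\<lambda>n. 1 - P n * H n) \<longlonglongrightarrow> 1 - p * h" "(\<lambda>n. \<bar>P n\<bar>) \<longlonglongrightarrow> \<bar>p\<bar>" by (intro tendsto_intros P H)+
  from order_tendstoD(1)[OF this(1) r(2)] order_tendstoD(1)[OF this(2) d(2)]
  have "eventually (\<lambda>n. r < 1 - P n * H n \<and> d < \<bar>P n\<bar>) sequentially" by (rule eventually_conj)
  then obtain N where N: "\<And>n. N \<le> n \<Longrightarrow> r < 1 - P n * H n \<and> d < \<bar>P n\<bar>"
    unfolding eventually_sequentially by blast
  have "(\<lambda>n. integral {-pi/2..pi/2} (monodromy_integrand (P (n + N)) (H (n + N)))) \<longlonglongrightarrow> integral {-pi/2..pi/2} (monodromy_integrand p h)"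
    by (rule tendsto_monodromy_integral[OF LIMSEQ_ignore_initial_segment[OF P] LIMSEQ_ignore_initial_segment[OF H] PH ph r(1) _ d(1)])
       (use N in \<open>auto intro!: less_imp_le\<close>)
  then have I: "(\<lambda>n. integral {-pi/2..pi/2} (monodromy_integrand (P n) (H n))) \<longlonglongrightarrow> integral {-pi/2..pi/2} (monodromy_integrand p h)"
    by (rule LIMSEQ_offset)
  have "isCont cis x" for x
    using continuous_on_cis[OF continuous_on_id, of UNIV] by (simp add: continuous_on_eq_continuous_at)
  from isCont_tendsto_compose[OF this I]
  have C: "(\<lambda>n. cis (integral {-pi/2..pi/2} (monodromy_integrand (P n) (H n)))) \<longlonglongrightarrow> cis (integral {-pi/2..pi/2} (monodromy_integrand p h))" .
  have B: "(\<lambda>n. profile_base (P n) (H n) (pi/2)) \<longlonglongrightarrow> profile_base p h (pi/2)"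
    unfolding profile_base_def by (intro tendsto_intros P H)
  have "(\<lambda>n. (profile_base (P n) (H n) (pi/2))^2 / of_real ((1 - P n * H n)^2)) \<longlonglongrightarrow> (profile_base p h (pi/2))^2 / of_real ((1 - p * h)^2)"
  proof (rule tendsto_divide[OF tendsto_power[OF B] tendsto_of_real])
    show "(\<lambda>n. (1 - P n * H n)^2) \<longlonglongrightarrow> (1 - p * h)^2" by (intro tendsto_intros P H)
    show "complex_of_real ((1 - p * h)^2) \<noteq> 0" unfolding of_real_eq_0_iff using r by simp
  qed
  from tendsto_mult[OF this C] show ?thesis
    unfolding monodromy_def monodromy_integrand_def .
qed

text \<open>For |p| = 1 dn is identically 1, the base contributes the factor 1 and the integrand is
  the constant \<open>y\<close>. So the monodromy is \<open>cis (pi * y)\<close>, and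
  \<open>x = y / 2\<close> counts turns.\<close>

lemma monodromy_flat:
  assumes "\<bar>p\<bar> = 1" "\<bar>h\<bar> < 1"
  shows "\<exists>x. monodromy p h = cis (2 * pi * x) \<and> x^2 = (1 + p * h) / 2"
proof -
  have p2: "p^2 = 1" using assms(1) by (metis power2_abs one_power2)
  have hp: "h - p \<noteq> 0" using assms by auto
  have ph: "1 - p * h \<noteq> 0" using ph_less_1[of p h] assms by auto
  define y where "y = sqrt (1 - h^2) * orbit_speed p h / (h - p)"
  define x where "x = y / 2"
  have sq: "(h - p)^2 = (1 - p * h)^2"
  proof -
    have "(h - p)^2 - (1 - p * h)^2 = (1 - p^2) * (h^2 - 1)"
      by (simp add: power2_eq_square algebra_simps)
    then show ?thesis using p2 by simp
  qed
  have "(profile_base p h (pi/2))^2 = of_real ((1 - p * h)^2)"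
    unfolding sq[symmetric] profile_base_def by (simp add: p2 Complex_eq)
  then have 1: "(profile_base p h (pi/2))^2 / of_real ((1 - p * h)^2) = 1"
    using ph by (simp del: of_real_power of_real_diff)
  have "profile_num p h t / (profile_den p h t * ampl_dn p t) = y" for t
  proof -
    have "profile_num p h t = sqrt (1 - h^2) * (orbit_speed p h * (h - p))"
      by (simp add: profile_num_def p2)
    moreover have "profile_den p h t = (h - p) * (h - p)" "ampl_dn p t = 1"
      by (simp_all add: profile_den_def ampl_dn_def p2 power2_eq_square[of "h - p"])
    ultimately show ?thesis using hp unfolding y_def by simp
  qed
  then have "integral {-pi/2..pi/2} (\<lambda>t. profile_num p h t / (profile_den p h t * ampl_dn p t)) = 2 * pi * x"
    by (simp add: x_def)
  then have "monodromy p h = cis (2 * pi * x)" unfolding monodromy_def 1 by simp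
  moreover have "x^2 = (1 + p * h) / 2"
  proof -
    have h2: "0 \<le> 1 - h^2" using assms(2) by (simp add: abs_square_le_1)
    have x2: "x^2 = (1 - h^2) * (orbit_speed p h)^2 / (4 * (1 - p * h)^2)"
      unfolding x_def y_def power_divide power_mult_distrib sq real_sqrt_pow2[OF h2] by simp
    have c2: "(orbit_speed p h)^2 = 2 * (1 - p * h)"
      using orbit_speed_square(3)[OF assms(2), of p] p2 by simp
    have hh: "1 - h^2 = (1 - p * h) * (1 + p * h)"
    proof -
      have "(1 - p * h) * (1 + p * h) = 1 - p^2 * h^2"
        by (simp add: power2_eq_square algebra_simps)
      then show ?thesis using p2 by simp
    qed
    have gen: "w * A * (2 * w) / (4 * w^2) = A / 2" if "w \<noteq> 0" for A w :: real
      using that by (simp add: power2_eq_square)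
    show ?thesis unfolding x2 c2 hh by (rule gen[OF ph])
  qed
  ultimately show ?thesis by blast
qed

section \<open>Rotational families\<close>

text \<open>The integrands are dn and 1/dn, with dn < 1 inside the interval. Strictness fixes the
  direction in which \<open>h - p\<close> crosses 0.\<close>

lemma elliptic_E_less_K:
  assumes "q \<noteq> 0" "\<bar>q\<bar> < 1"
  shows "elliptic_E (sqrt (1 - q^2)) < elliptic_K (sqrt (1 - q^2))"
proof -
  have q2: "q^2 < 1" "(sqrt (1 - q^2))^2 = 1 - q^2" using assms by (auto simp: abs_square_less_1 less_imp_le)
  define I where "I \<theta> = (LBINT t=0..\<theta>. ampl_dn q t)" for \<theta> :: real
  have E: "elliptic_E (sqrt (1 - q^2)) = I (pi/2)"
    unfolding elliptic_E_def I_def q2(2) ampl_dn_def by simp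
  have K: "elliptic_K (sqrt (1 - q^2)) = ampl_F q (pi/2)"
    unfolding elliptic_K_def ampl_F_eq q2(2) ampl_dn_def by simp
  have dI: "(I has_real_derivative ampl_dn q \<theta>) (at \<theta>)" for \<theta>
    unfolding I_def[abs_def] by (intro DERIV_LBINT continuous_intros)
  have d: "((\<lambda>\<theta>. ampl_F q \<theta> - I \<theta>) has_real_derivative 1 / ampl_dn q \<theta> - ampl_dn q \<theta>) (at \<theta>)" for \<theta>
    by (intro DERIV_diff DERIV_ampl_F dI assms)
  have "ampl_F q 0 - I 0 < ampl_F q (pi/2) - I (pi/2)"
  proof (rule DERIV_pos_imp_increasing_open[where f = "\<lambda>\<theta>. ampl_F q \<theta> - I \<theta>"])
    fix \<theta> :: real assume \<theta>: "0 < \<theta>" "\<theta> < pi / 2"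
    then have "0 < sin \<theta>" by (intro sin_gt_zero) auto
    then have "(ampl_dn q \<theta>)^2 < 1" using q2(1) by (simp add: ampl_dn_square')
    moreover have "0 < ampl_dn q \<theta>" by (rule ampl_dn_pos[OF assms(1)])
    ultimately have "0 < 1 / ampl_dn q \<theta> - ampl_dn q \<theta>" by (simp add: divide_simps power2_eq_square)
    then show "\<exists>y. ((\<lambda>\<theta>. ampl_F q \<theta> - I \<theta>) has_real_derivative y) (at \<theta>) \<and> 0 < y" using d by blast
  next
    show "continuous_on {0..pi/2} (\<lambda>\<theta>. ampl_F q \<theta> - I \<theta>)"
      by (rule DERIV_continuous_on) (use d in \<open>auto intro: has_field_derivative_at_within\<close>)
  qed simp
  moreover have "I 0 = 0" by (simp add: I_def zero_ereal_def[symmetric])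
  ultimately show ?thesis by (simp add: E K)
qed

text \<open>A function that decreases through each of its zeros is negative just after
  \<open>s\<close>. At \<open>x0\<close>, the first return to nonnegative values, it must vanish,
  yet decreasing through \<open>x0\<close> it would have been positive just before.\<close>

lemma decreasing_at_zeros_unique:
  fixes u :: "real \<Rightarrow> real"
  assumes "s < t" and cont: "continuous_on {s..t} u" and "u s = 0" "u t = 0"
    and der: "\<And>x. x \<in> {s..t} \<Longrightarrow> u x = 0 \<Longrightarrow> \<exists>d<0. (u has_real_derivative d) (at x within {s..t})"
  shows False
proof -
  obtain d where d: "d < 0" "(u has_real_derivative d) (at s within {s..t})"
    using der[of s] assms(1,3) by auto
  from has_real_derivative_neg_dec_right[OF d(2,1)] obtain e where e: "e > 0"
    "\<And>r. 0 < r \<Longrightarrow> s + r \<in> {s..t} \<Longrightarrow> r < e \<Longrightarrow> u (s + r) < u s" by blast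
  define r where "r = min (e / 2) (t - s)"
  have r: "0 < r" "r < e" "s + r \<in> {s..t}" using e(1) assms(1) by (auto simp: r_def)
  define s1 where "s1 = s + r"
  have s1: "u s1 < 0" "s < s1" "s1 \<le> t" using e(2)[OF r(1,3,2)] r assms(3) by (auto simp: s1_def)
  define Z where "Z = {x \<in> {s1..t}. u x \<in> {0..}}"
  have cont1: "continuous_on {s1..t} u" using cont by (rule continuous_on_subset) (use s1 in auto)
  have "closed Z" unfolding Z_def
    by (rule continuous_closed_preimage[OF cont1, unfolded vimage_def Int_def, simplified mem_Collect_eq]) auto
  moreover have Zt: "t \<in> Z" "bdd_below Z" using s1 assms(4) by (auto simp: Z_def bdd_below_def)
  ultimately have Z0: "Inf Z \<in> Z" using closed_contains_Inf[of Z] by auto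
  define x0 where "x0 = Inf Z"
  have x0: "0 \<le> u x0" "s1 \<le> x0" "x0 \<le> t" using Z0 by (auto simp: Z_def x0_def)
  have below: "u x < 0" if "s1 \<le> x" "x < x0" for x
  proof (rule ccontr)
    assume "\<not> u x < 0"
    then have "x \<in> Z" using that x0 by (auto simp: Z_def)
    then have "x0 \<le> x" unfolding x0_def using Zt(2) by (intro cInf_lower)
    then show False using that by simp
  qed
  have lt: "s1 < x0" using x0 s1(1) by (cases "s1 = x0") auto
  have "u x0 = 0"
  proof (rule ccontr)
    assume "u x0 \<noteq> 0"
    then have "0 < u x0" using x0 by simp
    then obtain y where "s1 \<le> y" "y \<le> x0" "u y = 0"
      using IVT'[of u s1 0 x0] s1(1) lt continuous_on_subset[OF cont1, of "{s1..x0}"] x0 by auto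
    then show False using below[of y] \<open>0 < u x0\<close> by (cases "y = x0") auto
  qed
  then obtain d where d: "d < 0" "(u has_real_derivative d) (at x0 within {s..t})"
    using der[of x0] x0 s1 by auto
  from has_real_derivative_neg_dec_left[OF d(2,1)] obtain e where e: "e > 0"
    "\<And>r. 0 < r \<Longrightarrow> x0 - r \<in> {s..t} \<Longrightarrow> r < e \<Longrightarrow> u x0 < u (x0 - r)" by blast
  define r where "r = min (e / 2) (x0 - s1)"
  have r: "0 < r" "r < e" "x0 - r \<in> {s..t}" "s1 \<le> x0 - r" using e(1) lt x0 s1 by (auto simp: r_def)
  show False using e(2)[OF r(1,3,2)] below[of "x0 - r"] r \<open>u x0 = 0\<close> by simp
qed

text \<open>\<open>l1 = 0\<close> forces |s1| = |s2|, whence \<open>l2 = \<bar>s1\<bar>\<close>.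
  Squaring gives l0^2 = c^2 (1 - h^2) and l2^2 = 2 c^2 (1 - p h), and 1 - h^2 = (1 - p h) (1 + p h)
  because p^2 = 1.\<close>

lemma flat_triple_ratio:
  assumes tr: "flat_torus_triple q \<theta>1 \<theta>2 l0 0 l2" and rot: "sym_point \<theta>2 = inverse (sym_point \<theta>1)"
    and l: "0 < l2" and p: "p = q * cos (\<theta>1 + \<theta>2)" and h: "h = cos (\<theta>1 - \<theta>2)"
  shows "(1 + p * h) / 2 = (of_int l0 / of_int l2)^2"
proof -
  obtain r0 r1 r2 :: complex and c :: real and s0 s1 s2 :: int where
     q: "\<bar>q\<bar> = 1" and
     r: "r0^2 = complex_of_real (sgn q)" "r1^2 = sym_point \<theta>1" "r2^2 = sym_point \<theta>2" and
     s: "of_int s0 = complex_of_real c * (\<i> * (r1 * cnj r2 - r2 * cnj r1))"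
        "of_int s1 = complex_of_real c * (\<i> * (r2 * cnj r0 - r0 * cnj r2))"
     and ls: "2 * l0 = \<bar>s0\<bar>" "2 * 0 = min \<bar>s1 + s2\<bar> \<bar>s1 - s2\<bar>" "2 * l2 = max \<bar>s1 + s2\<bar> \<bar>s1 - s2\<bar>"
    using tr unfolding flat_torus_triple_def by (elim conjE exE) (rule that; assumption)
  have qs: "sgn q = q" using q by (auto simp: sgn_if abs_if split: if_splits)
  have nrm: "norm r0 = 1" "norm r1 = 1" "norm r2 = 1"
  proof -
    have *: "norm w = 1" if "norm (w^2) = 1" for w :: complex
    proof -
      have "(norm w)^2 = 1^2" using that by (simp add: norm_power)
      then show ?thesis by (rule power2_eq_imp_eq) auto
    qed
    show "norm r0 = 1" by (rule *) (use q in \<open>simp add: r qs\<close>)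
    show "norm r1 = 1" "norm r2 = 1" by (rule *, simp add: r sym_point_eq)+
  qed
  \<comment> \<open>For u = v cnj w of modulus 1, (Im u)^2 = (1 - Re (u^2)) / 2. Hence the squared
    components depend on the squares of the roots and not on the roots chosen.\<close>
  have im: "(of_int s)^2 = 2 * c^2 * (1 - Re (v^2 * cnj (w^2)))"
    if "of_int s = complex_of_real c * (\<i> * (v * cnj w - w * cnj v))" "norm v = 1" "norm w = 1" for s :: int and v w
  proof -
    define u where "u = v * cnj w"
    have "w * cnj v = cnj u" by (simp add: u_def)
    then have "\<i> * (v * cnj w - w * cnj v) = of_real (- 2 * Im u)"
      by (simp add: u_def[symmetric] complex_eq_iff)
    then have "complex_of_real (of_int s) = of_real (c * (- 2 * Im u))" using that(1) by simp
    then have "real_of_int s = c * (- 2 * Im u)" by (simp only: of_real_eq_iff)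
    then have e1: "(real_of_int s)^2 = 4 * c^2 * (Im u)^2" by (simp add: power_mult_distrib)
    have "(norm u)^2 = 1" by (simp add: u_def norm_mult that)
    then have e2: "Re (u^2) = 1 - 2 * (Im u)^2" unfolding cmod_power2 by (simp add: power2_eq_square)
    have e3: "v^2 * cnj (w^2) = u^2" by (simp add: u_def power_mult_distrib)
    show ?thesis unfolding e1 e2 e3 by simp
  qed
  have conj: "cos (2 * \<theta>1) = cos (2 * \<theta>2)"
    using rot by (simp add: sym_point_eq complex_eq_iff)
  have "(real_of_int s0)^2 = 2 * c^2 * (1 - cos (2 * (\<theta>1 - \<theta>2)))"
    unfolding im[OF s(1) nrm(2,3)] r sym_point_eq by (simp add: cis_cnj cis_mult algebra_simps)
  then have s0: "(real_of_int s0)^2 = 4 * c^2 * (1 - h^2)"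
    unfolding cos_double_cos h by simp
  have s1: "(real_of_int s1)^2 = 2 * c^2 * (1 - q * cos (2 * \<theta>2))"
    unfolding im[OF s(2) nrm(3,1)] r sym_point_eq qs by simp
  have "cos (\<theta>1 + \<theta>2) * cos (\<theta>1 - \<theta>2) = (cos (2 * \<theta>1) + cos (2 * \<theta>2)) / 2"
    unfolding cos_add cos_diff cos_double using sin_cos_squared_add[of \<theta>1] sin_cos_squared_add[of \<theta>2] by algebra
  then have ph: "p * h = q * cos (2 * \<theta>2)" unfolding p h using conj by simp
  have "q^2 = 1" using q by (metis power2_abs one_power2)
  then have p2: "p^2 = 1" using rotational_sym_points(2)[OF rot] unfolding p by (auto simp: power_mult_distrib)
  have l2: "\<bar>s1\<bar> = l2" using ls(2,3) by (auto simp: min_def max_def split: if_splits)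
  then have "(real_of_int l2)^2 = (real_of_int s1)^2" by (metis of_int_abs power2_abs)
  then have L2: "(real_of_int l2)^2 = 2 * c^2 * (1 - p * h)" using s1 ph by simp
  have "2 * real_of_int l0 = \<bar>real_of_int s0\<bar>" using ls(1) by (metis of_int_abs of_int_mult of_int_numeral)
  then have "(2 * real_of_int l0)^2 = (real_of_int s0)^2" by simp
  then have "4 * (real_of_int l0)^2 = 4 * c^2 * (1 - h^2)" using s0 by (simp add: power_mult_distrib)
  moreover have "1 - h^2 = (1 - p * h) * (1 + p * h)"
  proof -
    have "(1 - p * h) * (1 + p * h) = 1 - p^2 * h^2"
      by (simp add: power2_eq_square algebra_simps)
    then show ?thesis using p2 by simp
  qed
  ultimately have L0: "2 * (real_of_int l0)^2 = (real_of_int l2)^2 * (1 + p * h)" unfolding L2 by simp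
  then show ?thesis using l by (simp add: power_divide divide_simps mult.commute)
qed

section \<open>Constancy and value of the monodromy along a family\<close>

locale rotational_family_data =
  fixes l0 l2 :: int and T :: "real set" and b :: real and q \<theta>1 \<theta>2 :: "real \<Rightarrow> real"
    and f :: "real \<Rightarrow> real \<times> real \<Rightarrow> R4"
  assumes fam: "rotational_family l0 l2 T b q \<theta>1 \<theta>2 f" and l2: "0 < l2"
begin

definition "k t = cos (\<theta>1 t + \<theta>2 t)"
definition "h t = cos (\<theta>1 t - \<theta>2 t)"
definition "p t = q t * k t"

lemma family:
  "is_interval T" "b \<in> T" "(\<forall>t\<in>T. t \<le> b) \<or> (\<forall>t\<in>T. b \<le> t)"
  "continuous_on T q" "continuous_on T k" "continuous_on T h"
  "cmc_flow_on (T - {b}) T q k h" "\<And>t. t \<in> T - {b} \<Longrightarrow> 0 < \<bar>q t\<bar> \<and> \<bar>q t\<bar> < 1"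
  "(\<lambda>t. \<bar>q t\<bar>) ` T = {0<..1}" "flat_torus_triple (q b) (\<theta>1 b) (\<theta>2 b) l0 0 l2"
  "\<And>t. t \<in> T \<Longrightarrow> sym_point (\<theta>2 t) = inverse (sym_point (\<theta>1 t))"
  "\<And>t. t \<in> T \<Longrightarrow> cmc_surface (q t) (\<theta>1 t) (\<theta>2 t) (f t)"
  "\<And>t. t \<in> T \<Longrightarrow> doubly_periodic (f t)"
  using fam unfolding rotational_family_def Let_def k_def[abs_def] h_def[abs_def] by blast+

lemma k_cases: "t \<in> T \<Longrightarrow> k t = 1 \<or> k t = - 1"
  using rotational_sym_points(2)[OF family(11)] by (simp add: k_def)

lemma abs_p: "t \<in> T \<Longrightarrow> \<bar>p t\<bar> = \<bar>q t\<bar>"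
  using k_cases[of t] by (auto simp: p_def abs_mult)

lemma p_bounds: "t \<in> T \<Longrightarrow> p t \<noteq> 0" "t \<in> T \<Longrightarrow> \<bar>p t\<bar> \<le> 1"
proof -
  assume t: "t \<in> T"
  then have "\<bar>q t\<bar> \<in> {0<..1}" using family(9) by blast
  then show "p t \<noteq> 0" "\<bar>p t\<bar> \<le> 1" using abs_p[OF t] by auto
qed

lemma h_bound: "t \<in> T \<Longrightarrow> \<bar>h t\<bar> < 1"
  using distinct_sym_points(2) family(12) unfolding cmc_surface_def h_def by blast

lemma continuous_p: "continuous_on T p"
  unfolding p_def[abs_def] by (intro continuous_intros family)

text \<open>At a zero of \<open>h - p\<close>, h^2 = q^2 cancels the factor 1 / (1 - q^2), and k^2 =
  1 makes \<open>k\<close> stationary. The rest collapses to E' - K'.\<close>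

lemma deriv_h_minus_p:
  assumes t: "t \<in> T - {b}" and zero: "h t = p t"
  shows "((\<lambda>t. h t - p t) has_real_derivative
     q t * (elliptic_E (sqrt (1 - (q t)^2)) - elliptic_K (sqrt (1 - (q t)^2)))) (at t within T)"
proof -
  define E K where "E = elliptic_E (sqrt (1 - (q t)^2))" and "K = elliptic_K (sqrt (1 - (q t)^2))"
  have tT: "t \<in> T" using t by auto
  have k2: "(k t)^2 = 1" using k_cases[OF tT] by auto
  have q1: "1 - (q t)^2 \<noteq> 0" using family(8)[OF t] by (auto simp: abs_square_less_1[symmetric])
  have h2: "(h t)^2 = (q t)^2" using zero k2 by (simp add: p_def power_mult_distrib)
  have d: "(q has_real_derivative q t * (E * k t - q t * K * h t)) (at t within T)"
    "(k has_real_derivative (1 - (k t)^2) / (1 - (q t)^2) * ((1 + (q t)^2) * E - 2 * (q t)^2 * K)) (at t within T)"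
    "(h has_real_derivative q t * ((1 - (h t)^2) / (1 - (q t)^2)) * (2 * E - (1 + (q t)^2) * K)) (at t within T)"
    using family(7) t unfolding cmc_flow_on_def Let_def E_def K_def by blast+
  have "((\<lambda>t. h t - p t) has_real_derivative
     q t * ((1 - (h t)^2) / (1 - (q t)^2)) * (2 * E - (1 + (q t)^2) * K) - q t * (E * k t - q t * K * h t) * k t) (at t within T)"
    unfolding p_def[abs_def] by (rule derivative_eq_intros d refl)+ (simp add: k2)
  moreover have "q t * ((1 - (h t)^2) / (1 - (q t)^2)) * (2 * E - (1 + (q t)^2) * K) - q t * (E * k t - q t * K * h t) * k t
     = q t * (E - K)"
  proof -
    have "q t * ((1 - (h t)^2) / (1 - (q t)^2)) * (2 * E - (1 + (q t)^2) * K) = q t * (2 * E - (1 + (q t)^2) * K)"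
      using q1 by (simp add: h2)
    moreover have "q t * (E * k t - q t * K * h t) * k t = q t * (E - (q t)^2 * K)"
      unfolding zero p_def using k2 by algebra
    ultimately show ?thesis by (simp add: algebra_simps)
  qed
  ultimately show ?thesis unfolding E_def K_def by simp
qed

lemma q_sign:
  assumes "s \<in> T" "t \<in> T" shows "0 < q s * q t"
proof (rule ccontr)
  have nz: "q x \<noteq> 0" if "x \<in> T" for x using p_bounds(1)[OF that] by (auto simp: p_def)
  assume "\<not> ?thesis"
  then have "q s * q t \<le> 0" by simp
  then have "q s \<le> 0 \<and> 0 \<le> q t \<or> q t \<le> 0 \<and> 0 \<le> q s" by (auto simp: mult_le_0_iff)
  moreover have "connected (q ` T)"
    using connected_continuous_image[OF family(4)] family(1) by (simp add: is_interval_connected)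
  ultimately have "0 \<in> q ` T"
    using assms unfolding connected_iff_interval by (metis imageI)
  then show False using nz by auto
qed

text \<open>The parameters \<open>h = p\<close>, at which the profile formula degenerates, occur at most once along
  the flow, since \<open>h - p\<close> crosses \<open>0\<close> in one direction only.\<close>

lemma zero_unique_less:
  assumes "s \<in> T - {b}" "t \<in> T - {b}" "h s = p s" "h t = p t" "s < t"
  shows False
proof -
  \<comment> \<open>By \<open>q_sign\<close> the sign of \<open>q\<close> is constant along the
    family; multiplying by it makes the derivative q (E' - K') at every zero negative.\<close>
  define \<sigma> where "\<sigma> = sgn (q s)"
  have sub: "{s..t} \<subseteq> T"
    using family(1) assms unfolding is_interval_1 by (meson DiffD1 atLeastAtMost_iff subsetI)
  \<comment> \<open>\<open>b\<close> is an endpoint of \<open>T\<close>, so it cannot lie between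
    two other points of \<open>T\<close>.\<close>
  have sub': "x \<in> T - {b}" if "x \<in> {s..t}" for x
  proof -
    have "x \<noteq> b"
    proof
      assume "x = b"
      then have "s \<le> b" "b \<le> t" using that by auto
      then show False using family(3) assms by (metis DiffD1 DiffD2 insertI1 antisym)
    qed
    then show ?thesis using sub that by auto
  qed
  show False
  proof (rule decreasing_at_zeros_unique[of s t "\<lambda>x. \<sigma> * (h x - p x)"])
    show "continuous_on {s..t} (\<lambda>x. \<sigma> * (h x - p x))"
      by (intro continuous_intros continuous_on_subset[OF continuous_p sub] continuous_on_subset[OF family(6) sub])
    fix x assume x: "x \<in> {s..t}" "\<sigma> * (h x - p x) = 0"
    have xT: "x \<in> T - {b}" using sub'[OF x(1)] .
    have sg: "0 < q s * q x" using q_sign[of s x] assms xT by auto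
    then have "q s \<noteq> 0" by auto
    then have "\<sigma> \<noteq> 0" by (simp add: \<sigma>_def sgn_zero_iff)
    then have z: "h x = p x" using x(2) by simp
    have sq: "0 < \<sigma> * q x" using sg unfolding \<sigma>_def by (auto simp: sgn_if zero_less_mult_iff split: if_splits)
    have "((\<lambda>x. \<sigma> * (h x - p x)) has_real_derivative
        \<sigma> * (q x * (elliptic_E (sqrt (1 - (q x)^2)) - elliptic_K (sqrt (1 - (q x)^2))))) (at x within {s..t})"
      by (rule DERIV_cmult[OF DERIV_subset[OF deriv_h_minus_p[OF xT z] sub]])
    moreover have "\<sigma> * (q x * (elliptic_E (sqrt (1 - (q x)^2)) - elliptic_K (sqrt (1 - (q x)^2)))) < 0"
      using elliptic_E_less_K[of "q x"] family(8)[OF xT] sq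
      unfolding mult.assoc[symmetric] by (intro mult_pos_neg) auto
    ultimately show "\<exists>d<0. ((\<lambda>x. \<sigma> * (h x - p x)) has_real_derivative d) (at x within {s..t})" by blast
  qed (use assms in auto)
qed

lemma zero_unique:
  assumes "s \<in> T - {b}" "t \<in> T - {b}" "h s = p s" "h t = p t" shows "s = t"
  using zero_unique_less[OF assms] zero_unique_less[OF assms(2,1,4,3)] by (cases s t rule: linorder_cases) auto

text \<open>The values of the monodromy are roots of unity, apart from those at \<open>b\<close> and
  at the at most one parameter with \<open>h = p\<close>. They form a countable set, whereas a
  connected set with two distinct points is uncountable. The exceptional parameters do no harm
  because the monodromy is continuous there too.\<close>

lemma monodromy_constant:
  assumes "t \<in> T" shows "monodromy (p t) (h t) = monodromy (p b) (h b)"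
proof (rule ccontr)
  let ?M = "\<lambda>t. monodromy (p t) (h t)"
  let ?Z = "{t \<in> T - {b}. h t = p t}"
  assume ne: "?M t \<noteq> ?M b"
  have cont: "continuous_on T ?M"
  proof (rule continuous_on_sequentiallyI)
    fix u a assume u: "\<forall>n. u n \<in> T" "a \<in> T" "u \<longlonglongrightarrow> a"
    have "(\<lambda>n. p (u n)) \<longlonglongrightarrow> p a" "(\<lambda>n. h (u n)) \<longlonglongrightarrow> h a"
      using continuous_p family(6) u unfolding continuous_on_sequentially o_def by blast+
    then show "(\<lambda>n. ?M (u n)) \<longlonglongrightarrow> ?M a"
      by (rule tendsto_monodromy) (use u p_bounds h_bound in auto)
  qed
  then have conn: "connected (?M ` T)"
    using family(1) by (intro connected_continuous_image) (auto simp: is_interval_connected)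
  have cZ: "countable ?Z"
  proof (cases "?Z = {}")
    case False
    then obtain s where s: "s \<in> T - {b}" "h s = p s" by auto
    have "?Z \<subseteq> {s}" using zero_unique[OF _ s(1) _ s(2)] by auto
    then show ?thesis by (rule countable_subset) simp
  next
    case True
    show ?thesis unfolding True by simp
  qed
  have sub: "?M ` T \<subseteq> {?M b} \<union> ?M ` ?Z \<union> {z. \<exists>n>0. z ^ n = 1}"
  proof
    fix z assume "z \<in> ?M ` T"
    then obtain s where s: "s \<in> T" "z = ?M s" by auto
    show "z \<in> {?M b} \<union> ?M ` ?Z \<union> {z. \<exists>n>0. z ^ n = 1}"
    proof (cases "s = b \<or> h s = p s")
      case True then show ?thesis using s by auto
    next
      case False
      then have "\<exists>n>0. ?M s ^ n = 1"
        using s family(8)[of s]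
        by (intro monodromy_root_of_unity[OF family(12)[OF s(1)] family(11)[OF s(1)] family(13)[OF s(1)]])
           (simp_all add: p_def k_def h_def)
      then show ?thesis using s by auto
    qed
  qed
  have "countable (?M ` T)"
    by (rule countable_subset[OF sub]) (intro countable_Un countable_image[OF cZ] countable_roots_of_unity, simp)
  moreover have "uncountable (?M ` T)"
    using conn by (rule connected_uncountable[of _ "?M t" "?M b"]) (use assms ne family(2) in auto)
  ultimately show False by simp
qed

text \<open>At the flat end only the square of the number \<open>x\<close> of turns is known from
  the triple, which leaves the sign \<open>\<sigma>\<close>.\<close>

lemma monodromy_value:
  "\<exists>\<sigma>\<in>{1, -1}. \<forall>t\<in>T. monodromy (p t) (h t) = cis (\<sigma> * (2 * pi * of_int l0 / of_int l2))"
proof -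
  have b1: "\<bar>p b\<bar> = 1"
    using abs_p[OF family(2)] family(10) unfolding flat_torus_triple_def by simp
  obtain x where x: "monodromy (p b) (h b) = cis (2 * pi * x)" "x^2 = (1 + p b * h b) / 2"
    using monodromy_flat[OF b1 h_bound[OF family(2)]] by blast
  have "(1 + p b * h b) / 2 = (of_int l0 / of_int l2)^2"
    by (rule flat_triple_ratio[OF family(10) family(11)[OF family(2)] l2]) (simp_all add: p_def h_def k_def)
  then have "x = of_int l0 / of_int l2 \<or> x = - (of_int l0 / of_int l2)"
    using x(2) by (simp only: power2_eq_iff)
  then have "\<exists>\<sigma>\<in>{1, -1}. cis (2 * pi * x) = cis (\<sigma> * (2 * pi * of_int l0 / of_int l2))" by auto
  then show ?thesis using x(1) monodromy_constant by metis
qed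

end

section \<open>The sphere bouquet\<close>

text \<open>The stereographic preimage of the plane section Re (w cnj (cis b)) = cos a of the
  2-sphere. The dummy variable of type \<open>unit\<close> puts \<open>None\<close> into the set
  exactly when cos a = 0, the case of a line.\<close>

definition plane_trace :: "real \<Rightarrow> real \<Rightarrow> complex option set" where
  "plane_trace a b = {Some z |z. ((norm z)^2 + 1) * cos a = 2 * Re (z * cnj (cis b))} \<union> {None |_::unit. cos a = 0}"

lemma plane_trace_SomeI:
  "((norm z)^2 + 1) * cos a = 2 * Re (z * cnj (cis b)) \<Longrightarrow> Some z \<in> plane_trace a b"
  unfolding plane_trace_def by blast

lemma norm_mult_cis: "norm (z * cnj (cis b)) = norm z"
  by (simp add: norm_mult cis_cnj)

lemma inner_rotate: "x \<bullet> y = (x * cnj (cis b)) \<bullet> (y * cnj (cis b))"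
proof -
  have s: "(cos b)^2 = 1 - (sin b)^2" by (simp add: cos_squared_eq)
  show ?thesis unfolding inner_complex_def
    by (simp add: ring_distribs) (use s in algebra)
qed

lemma cis_rotate: "cis (b + x) * cnj (cis b) = cis x"
  by (simp add: cis_cnj cis_mult)

text \<open>Uniqueness of the perpendicular circle through two points. Its centre lies on the
  tangents to the unit circle at both points, so after rotation by \<open>- b\<close> it is real and
  equals 1 / cos a. A line through both points can be perpendicular only if cos a = 0, and then it
  passes through the origin.\<close>

lemma perp_circle_subset_plane_trace:
  assumes "perp_circle D" and a: "0 < a" "a < pi"
    and z: "Some (cis (b - a)) \<in> D" "Some (cis (b + a)) \<in> D"
  shows "D \<subseteq> plane_trace a b"
proof -
  have sa: "0 < sin a" using a by (rule sin_gt_zero)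
  define R where "R x = x * cnj (cis b)" for x
  have Rin: "x \<bullet> y = R x \<bullet> R y" for x y unfolding R_def by (rule inner_rotate)
  have R1: "R (cis (b - a)) = cis (- a)" "R (cis (b + a)) = cis a"
    using cis_rotate[of b "- a"] cis_rotate[of b a] by (simp_all add: R_def)
  have Ri: "R (\<i> * x) = \<i> * R x" for x by (simp add: R_def)
  consider c r where "0 < r" "D = Some ` sphere c r" "\<forall>z \<in> sphere c r \<inter> sphere 0 1. (z - c) \<bullet> z = 0"
    | p d where "d \<noteq> 0" "D = insert None (Some ` range (\<lambda>s::real. p + s *\<^sub>R d))"
       "\<forall>z \<in> range (\<lambda>s::real. p + s *\<^sub>R d) \<inter> sphere 0 1. d \<bullet> (\<i> * z) = 0"
    using assms(1) unfolding perp_circle_def Let_def by blast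
  then show ?thesis
  proof cases
    case 1
    have on: "c \<bullet> cis x = 1" "r^2 = c \<bullet> c - 1" if "Some (cis x) \<in> D" for x
    proof -
      have s: "cis x \<in> sphere c r" using that 1(2) by auto
      then have "(cis x - c) \<bullet> cis x = 0" using 1(3) by simp
      then show cx: "c \<bullet> cis x = 1" by (simp add: inner_diff_left dot_square_norm)
      have "norm (c - cis x) = r" using s by (simp add: dist_norm)
      then have "r^2 = (c - cis x) \<bullet> (c - cis x)" by (simp add: dot_square_norm)
      also have "\<dots> = c \<bullet> c - 2 * (c \<bullet> cis x) + cis x \<bullet> cis x"
        by (simp add: inner_diff_left inner_diff_right inner_commute)
      finally show "r^2 = c \<bullet> c - 1" using cx by (simp add: dot_square_norm)
    qed
    have "R c \<bullet> cis (- a) = 1" "R c \<bullet> cis a = 1"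
      using on(1)[OF z(1)] on(1)[OF z(2)] unfolding Rin[of c] R1 by auto
    then have e: "Re (R c) * cos a - Im (R c) * sin a = 1" "Re (R c) * cos a + Im (R c) * sin a = 1"
      by (simp_all add: inner_complex_def)
    then have "Im (R c) * sin a = 0" by linarith
    then have c': "Im (R c) = 0" "Re (R c) * cos a = 1" using sa e by auto
    show ?thesis
    proof
      fix X assume "X \<in> D"
      then obtain z where z: "X = Some z" "norm (c - z) = r" using 1(2) by (auto simp: dist_norm)
      then have "(c - z) \<bullet> (c - z) = r^2" by (simp add: dot_square_norm)
      then have "z \<bullet> z + 1 = 2 * (c \<bullet> z)" using on(2)[OF \<open>Some (cis (b - a)) \<in> D\<close>]
        by (simp add: inner_diff_left inner_diff_right inner_commute)
      also have "c \<bullet> z = Re (R c) * Re (R z)" unfolding Rin[of c z] by (simp add: inner_complex_def c')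
      finally have "((norm z)^2 + 1) * cos a = 2 * ((Re (R c) * cos a) * Re (R z))"
        by (simp add: dot_square_norm)
      then have "((norm z)^2 + 1) * cos a = 2 * Re (z * cnj (cis b))" unfolding c' by (simp only: R_def mult_1)
      then show "X \<in> plane_trace a b" unfolding plane_trace_def z(1) by blast
    qed
  next
    case 2
    have on: "R d \<bullet> (\<i> * R (cis x)) = 0" if x: "Some (cis x) \<in> D" for x
    proof -
      have "cis x \<in> range (\<lambda>s::real. p + s *\<^sub>R d)" using x 2(2) by auto
      then have "d \<bullet> (\<i> * cis x) = 0" using 2(3) by simp
      then show ?thesis unfolding Rin[of d] Ri .
    qed
    have e: "Re (R d) * sin a + Im (R d) * cos a = 0" "- (Re (R d) * sin a) + Im (R d) * cos a = 0"
      using on[OF z(1)] on[OF z(2)] unfolding R1 by (simp_all add: inner_complex_def)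
    then have "Re (R d) * sin a = 0" by linarith
    then have d: "Re (R d) = 0" "Im (R d) * cos a = 0" using sa e by auto
    have "norm (R d) = norm d" unfolding R_def by (rule norm_mult_cis)
    then have "R d \<noteq> 0" using 2(1) by auto
    then have ca: "cos a = 0" using d by (auto simp: complex_eq_iff)
    obtain s0 where s0: "cis (b + a) = p + s0 *\<^sub>R d" using z(2) 2(2) by auto
    have RL: "R (p + s *\<^sub>R d) = R p + s *\<^sub>R R d" for s by (simp add: R_def ring_distribs)
    have "Re (R p) = 0" using arg_cong[OF s0, of "\<lambda>x. Re (R x)"] unfolding R1 RL by (simp add: ca d)
    then have R0: "Re ((p + s *\<^sub>R d) * cnj (cis b)) = 0" for s unfolding R_def[symmetric] RL by (simp add: d)
    have "Some (p + s *\<^sub>R d) \<in> plane_trace a b" for s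
      by (rule plane_trace_SomeI) (simp only: R0 ca mult_zero_right)
    moreover have "None \<in> plane_trace a b" by (simp add: plane_trace_def ca)
    ultimately show ?thesis unfolding 2(2) by auto
  qed
qed

lemma plane_trace_cis: "Some (cis (b - a)) \<in> plane_trace a b" "Some (cis (b + a)) \<in> plane_trace a b"
  using arg_cong[OF cis_rotate[of b "- a"], of Re] arg_cong[OF cis_rotate[of b a], of Re] by (simp_all add: plane_trace_def)

text \<open>The circle has centre cis b / cos a and radius |tan a|. If cos a = 0, it degenerates to
  the diameter in the direction \<open>\<i> * cis b\<close>.\<close>

lemma perp_circle_plane_trace:
  assumes a: "0 < a" "a < pi" shows "perp_circle (plane_trace a b)"
proof (cases "cos a = 0")
  case False
  have sa: "0 < sin a" using a by (rule sin_gt_zero)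
  define c where "c = cis b / of_real (cos a)"
  define r where "r = \<bar>tan a\<bar>"
  have r: "0 < r" using sa False by (simp add: r_def tan_def)
  have cz: "c \<bullet> z = Re (z * cnj (cis b)) / cos a" for z
    by (simp add: c_def inner_complex_def divide_simps)
  have cc: "c \<bullet> c = r^2 + 1"
    using False sin_cos_squared_add[of a]
    by (simp add: c_def dot_square_norm norm_divide r_def tan_def power_divide divide_simps)
  have sph: "z \<in> sphere c r \<longleftrightarrow> ((norm z)^2 + 1) * cos a = 2 * Re (z * cnj (cis b))" for z
  proof -
    have "z \<in> sphere c r \<longleftrightarrow> (norm (c - z))^2 = r^2"
      using r by (simp add: dist_norm)
    also have "(norm (c - z))^2 = (r^2 + 1) - 2 * (c \<bullet> z) + (norm z)^2"
      unfolding cc[symmetric] power2_norm_eq_inner by (simp add: inner_diff_left inner_diff_right inner_commute)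
    also have "\<dots> = r^2 \<longleftrightarrow> (norm z)^2 + 1 = 2 * (c \<bullet> z)" by linarith
    also have "\<dots> \<longleftrightarrow> ((norm z)^2 + 1) * cos a = 2 * Re (z * cnj (cis b))"
      unfolding cz using False by (simp add: eq_divide_eq)
    finally show ?thesis .
  qed
  have D: "plane_trace a b = Some ` sphere c r"
    unfolding plane_trace_def using False sph by auto
  have "cis (b + a) \<in> sphere c r \<inter> sphere 0 1"
    using plane_trace_cis(2)[of b a] unfolding D by auto
  moreover have "(z - c) \<bullet> z = 0" if "z \<in> sphere c r \<inter> sphere 0 1" for z
  proof -
    have "norm z = 1" "((norm z)^2 + 1) * cos a = 2 * Re (z * cnj (cis b))" using that sph by auto
    then have "c \<bullet> z = 1" unfolding cz using False by simp
    then show ?thesis using \<open>norm z = 1\<close> by (simp add: inner_diff_left dot_square_norm)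
  qed
  ultimately show ?thesis unfolding perp_circle_def using r D by blast
next
  case True
  define d where "d = \<i> * cis b"
  define L where "L = range (\<lambda>s::real. 0 + s *\<^sub>R d)"
  have L: "z \<in> L \<longleftrightarrow> Re (z * cnj (cis b)) = 0" for z
  proof
    assume "Re (z * cnj (cis b)) = 0"
    then obtain v where "z * cnj (cis b) = \<i> * of_real v"
      by (intro that[of "Im (z * cnj (cis b))"]) (simp add: complex_eq_iff)
    then have "z * cnj (cis b) * cis b = \<i> * of_real v * cis b" by simp
    then have "z = 0 + v *\<^sub>R d"
      unfolding mult.assoc by (simp add: cis_cnj cis_mult d_def scaleR_conv_of_real mult_ac)
    then show "z \<in> L" unfolding L_def by blast
  next
    assume "z \<in> L"
    then show "Re (z * cnj (cis b)) = 0" unfolding L_def d_def by (auto simp: algebra_simps)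
  qed
  have D: "plane_trace a b = insert None (Some ` L)"
    unfolding plane_trace_def using True L by auto
  have "cis (b + a) \<in> L \<inter> sphere 0 1"
    using plane_trace_cis(2)[of b a] unfolding D by auto
  moreover have "d \<bullet> (\<i> * z) = 0" if "z \<in> L" for z
    using that unfolding L_def d_def by (auto simp: inner_complex_def algebra_simps)
  moreover have "d \<noteq> 0" by (simp add: d_def)
  ultimately have "d \<noteq> 0 \<and> (plane_trace a b = insert None (Some ` L) \<and> L \<inter> sphere 0 1 \<noteq> {} \<and>
      (\<forall>z \<in> L \<inter> sphere 0 1. d \<bullet> (\<i> * z) = 0))"
    using D by blast
  then show ?thesis
    unfolding perp_circle_def Let_def L_def by (intro disjI2 exI[of _ 0] exI[of _ d])
qed

lemma Re_of_real_mult: "Re (of_real r * z) = r * Re z"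
  by simp

lemma inv_stereographic_plane_trace:
  "inv_stereographic ` plane_trace a b =
     {(w, of_real s) |w s. (norm w)^2 + s^2 = 1 \<and> Re (w * cnj (cis b)) = cos a}" (is "?L = ?R")
proof
  show "?L \<subseteq> ?R"
  proof
    fix X assume "X \<in> ?L"
    then obtain Y where Y: "Y \<in> plane_trace a b" "X = inv_stereographic Y" by auto
    show "X \<in> ?R"
    proof (cases Y)
      case None
      then have "cos a = 0" using Y by (auto simp: plane_trace_def)
      then have "X = (0, of_real 1) \<and> (norm (0::complex))^2 + 1^2 = 1 \<and> Re (0 * cnj (cis b)) = cos a" using Y None by simp
      then show ?thesis by blast
    next
      case (Some z)
      define N where "N = (norm z)^2"
      have N: "0 < N + 1" by (simp add: N_def add_nonneg_pos)
      have eq: "(N + 1) * cos a = 2 * Re (z * cnj (cis b))" using Y Some by (auto simp: plane_trace_def N_def)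
      define w where "w = 2 * z / complex_of_real (N + 1)"
      define s where "s = (N - 1) / (N + 1)"
      have X: "X = (w, of_real s)" using Y Some by (simp add: w_def s_def N_def)
      have "(norm w)^2 = 4 * N / (N + 1)^2"
        unfolding w_def norm_divide norm_mult norm_of_real power_divide power_mult_distrib using N by (simp add: N_def)
      then have "(norm w)^2 + s^2 = (4 * N + (N - 1)^2) / (N + 1)^2"
        by (simp add: s_def power_divide add_divide_distrib)
      also have "4 * N + (N - 1)^2 = (N + 1)^2" by (simp add: power2_eq_square algebra_simps)
      finally have 1: "(norm w)^2 + s^2 = 1" using N by simp
      have "w * cnj (cis b) = of_real (2 / (N + 1)) * (z * cnj (cis b))" by (simp add: w_def)
      then have "Re (w * cnj (cis b)) = 2 / (N + 1) * Re (z * cnj (cis b))" by (simp only: Re_of_real_mult)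
      also have "\<dots> = cos a" using eq N by (simp add: field_simps)
      finally show ?thesis using X 1 by blast
    qed
  qed
  show "?R \<subseteq> ?L"
  proof
    fix X assume "X \<in> ?R"
    then obtain w s where X: "X = (w, of_real s)" and ws: "(norm w)^2 + s^2 = 1" "Re (w * cnj (cis b)) = cos a" by blast
    show "X \<in> ?L"
    proof (cases "s = 1")
      case True
      then have "w = 0" using ws by simp
      then have "X = inv_stereographic None" "None \<in> plane_trace a b"
        using X True ws by (auto simp: plane_trace_def)
      then show ?thesis by blast
    next
      case False
      \<comment> \<open>Stereographic projection from the pole (0, 1), the image of
        \<open>None\<close>; the pole itself was the case \<open>s = 1\<close>.\<close>
      define z where "z = w / of_real (1 - s)"
      have s: "1 - s \<noteq> 0" using False by simp
      have "(norm z)^2 = (1 - s^2) / (1 - s)^2"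
        using ws(1) unfolding z_def norm_divide power_divide norm_of_real power2_abs by (simp add: algebra_simps)
      also have "1 - s^2 = (1 - s) * (1 + s)" by (simp add: power2_eq_square algebra_simps)
      also have "(1 - s) * (1 + s) / (1 - s)^2 = (1 + s) / (1 - s)" using s by (simp add: power2_eq_square)
      finally have nz: "(norm z)^2 = (1 + s) / (1 - s)" .
      have N1: "(norm z)^2 + 1 = 2 / (1 - s)" "(norm z)^2 - 1 = 2 * s / (1 - s)"
        unfolding nz using s by (simp_all add: add_divide_eq_iff diff_divide_eq_iff divide_simps)
      have "2 * z / complex_of_real ((norm z)^2 + 1) = w"
        unfolding N1(1) unfolding z_def of_real_divide using s by (simp del: of_real_diff)
      moreover have "((norm z)^2 - 1) / ((norm z)^2 + 1) = s"
        unfolding N1 using s by simp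
      ultimately have "X = inv_stereographic (Some z)" using X by simp
      moreover have "z * cnj (cis b) = of_real (1 / (1 - s)) * (w * cnj (cis b))" by (simp add: z_def)
      then have "Re (z * cnj (cis b)) = 1 / (1 - s) * cos a" by (simp only: Re_of_real_mult ws)
      then have "((norm z)^2 + 1) * cos a = 2 * Re (z * cnj (cis b))" unfolding N1(1) by simp
      then have "Some z \<in> plane_trace a b" by (rule plane_trace_SomeI)
      ultimately show ?thesis by blast
    qed
  qed
qed

text \<open>Revolution about the axis changes only the argument of \<open>w2\<close>, while the
  plane sections constrain \<open>w1\<close> alone. Each sphere is thus a hyperplane section of the
  3-sphere, with normal direction \<open>2 * a * j + a\<close> midway between the j-th and the next
  point.\<close>

lemma sphere_bouquet_eq:
  assumes "0 < m" "m < n" and a: "a = pi * of_int m / of_int n"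
  shows "sphere_bouquet m n = {(w1, w2). (norm w1)^2 + (norm w2)^2 = 1 \<and>
     (\<exists>j::nat. int j < n \<and> Re (w1 * cnj (cis (2 * a * of_nat j + a))) = cos a)}" (is "_ = ?R")
proof -
  have a0: "0 < a" "a < pi" using assms by (auto simp: divide_less_eq)
  define \<alpha> where "\<alpha> = exp (2 * pi * \<i> * of_int m / of_int n)"
  have al: "\<alpha> = cis (2 * a)" unfolding \<alpha>_def cis_conv_exp a by (simp add: mult_ac)
  have pow: "\<alpha> ^ j = cis (2 * a * of_nat j)" for j
    unfolding al Complex.DeMoivre by (simp only: mult_ac)
  have ends: "\<alpha> ^ j = cis ((2 * a * of_nat j + a) - a)" "\<alpha> ^ (j + 1) = cis ((2 * a * of_nat j + a) + a)" for j
    unfolding pow by (simp_all add: algebra_simps)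
  have circ: "bouquet_circles m n = (\<Union>j\<in>{j::nat. int j < n}. plane_trace a (2 * a * of_nat j + a))"
  proof
    show "bouquet_circles m n \<subseteq> (\<Union>j\<in>{j::nat. int j < n}. plane_trace a (2 * a * of_nat j + a))"
      unfolding bouquet_circles_def Let_def \<alpha>_def[symmetric]
    proof (rule Union_least)
      fix D assume "D \<in> {D. perp_circle D \<and> (\<exists>j::nat. int j < n \<and> Some (\<alpha> ^ j) \<in> D \<and> Some (\<alpha> ^ (j + 1)) \<in> D)}"
      then obtain j :: nat where D: "perp_circle D" and j: "int j < n"
        and e: "Some (\<alpha> ^ j) \<in> D" "Some (\<alpha> ^ (j + 1)) \<in> D" by blast
      have "D \<subseteq> plane_trace a (2 * a * of_nat j + a)"
        by (rule perp_circle_subset_plane_trace[OF D a0 e[unfolded ends(1)[of j] ends(2)[of j]]])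
      then show "D \<subseteq> (\<Union>j\<in>{j::nat. int j < n}. plane_trace a (2 * a * of_nat j + a))" using j by blast
    qed
    show "(\<Union>j\<in>{j::nat. int j < n}. plane_trace a (2 * a * of_nat j + a)) \<subseteq> bouquet_circles m n"
      unfolding bouquet_circles_def Let_def \<alpha>_def[symmetric]
    proof (rule UN_least)
      fix j :: nat assume j: "j \<in> {j. int j < n}"
      let ?D = "plane_trace a (2 * a * of_nat j + a)"
      have "Some (\<alpha> ^ j) \<in> ?D" "Some (\<alpha> ^ (j + 1)) \<in> ?D"
        unfolding ends(1)[of j] ends(2)[of j] by (rule plane_trace_cis)+
      then show "?D \<subseteq> \<Union>{D. perp_circle D \<and> (\<exists>j::nat. int j < n \<and> Some (\<alpha> ^ j) \<in> D \<and> Some (\<alpha> ^ (j + 1)) \<in> D)}"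
        using perp_circle_plane_trace[OF a0] j by (intro Union_upper) blast
    qed
  qed
  have img: "inv_stereographic ` bouquet_circles m n = {(w, of_real s) |w s. (norm w)^2 + s^2 = 1 \<and>
      (\<exists>j::nat. int j < n \<and> Re (w * cnj (cis (2 * a * of_nat j + a))) = cos a)}"
    unfolding circ image_UN inv_stereographic_plane_trace by blast
  show ?thesis
  proof
    show "sphere_bouquet m n \<subseteq> ?R"
      unfolding sphere_bouquet_def img by (auto simp: norm_mult)
    show "?R \<subseteq> sphere_bouquet m n"
    proof
      fix X assume "X \<in> ?R"
      then obtain w1 w2 where X: "X = (w1, w2)" "(norm w1)^2 + (norm w2)^2 = 1"
         "\<exists>j::nat. int j < n \<and> Re (w1 * cnj (cis (2 * a * of_nat j + a))) = cos a" by auto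
      have "w2 = cis (Arg w2) * of_real (norm w2)"
        using cis_Arg[of w2] by (cases "w2 = 0") (simp_all add: sgn_div_norm scaleR_conv_of_real)
      moreover have "(w1, of_real (norm w2)) \<in> inv_stereographic ` bouquet_circles m n"
        unfolding img using X by blast
      ultimately show "X \<in> sphere_bouquet m n" unfolding sphere_bouquet_def X by blast
    qed
  qed
qed

lemma bouquet_angle:
  fixes m n :: int
  assumes "0 < m" "m < n" shows "0 < pi * of_int m / of_int n" "pi * of_int m / of_int n < pi"
proof -
  have "0 < real_of_int m" "real_of_int m < real_of_int n" "0 < real_of_int n" using assms by simp_all
  then show "0 < pi * of_int m / of_int n" "pi * of_int m / of_int n < pi"
    by (simp_all add: pos_divide_less_eq)
qed

lemma cis_periodic_int:
  assumes n: "0 < n" and a: "a = pi * of_int m / of_int n" and "i mod n = j mod (n::int)"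
  shows "cis (2 * a * of_int i) = cis (2 * a * of_int j)"
proof -
  have "n dvd i - j" using assms(3) by (simp add: mod_eq_dvd_iff)
  then obtain k where "i - j = n * k" ..
  then have k: "i = j + n * k" by simp
  have "2 * a * of_int i = 2 * a * of_int j + 2 * pi * of_int (m * k)"
    using n unfolding a k by (simp add: field_simps)
  then show ?thesis using cis_multiple_2pi[of "of_int (m * k)"] by (simp add: cis_mult[symmetric])
qed

text \<open>The parametrization imitates the limit of the surfaces: rotated copies of one chord in
  the first coordinate and the remaining radius in the second. All integers \<open>j\<close> are
  allowed because 2 a n is a multiple of 2 pi. The signs \<open>\<sigma>\<close> and
  \<open>\<epsilon>\<close>, which only reverse the order of the copies and the direction of the
  chord, leave room for the undetermined signs of the monodromy and of \<open>h\<close>.\<close>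

lemma sphere_bouquet_param:
  assumes mn: "0 < m" "m < n" and a: "a = pi * of_int m / of_int n" and sg: "\<sigma> \<in> {1, -1::real}" "\<epsilon> \<in> {1, -1::real}"
  shows "sphere_bouquet m n = {(cis (a + \<sigma> * (2 * a * of_int j)) * Complex (cos a) (\<epsilon> * (sin a * sin \<theta>)),
      of_real (sin a * cos \<theta>) * cis x) |j \<theta> x. \<bar>\<theta>\<bar> \<le> pi / 2}" (is "_ = ?P")
proof -
  have a0: "0 < a" "a < pi" using bouquet_angle[OF mn] unfolding a by auto
  have sa: "0 < sin a" using a0 by (rule sin_gt_zero)
  have ndiv: "0 < n" using mn by simp
  have sq: "\<sigma>^2 = 1" "\<epsilon>^2 = 1" using sg by auto
  have per: "cis (a + \<sigma> * (2 * a * of_int i)) = cis (2 * a * of_int j + a)"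
    if "\<sigma> = 1 \<and> i mod n = j mod n \<or> \<sigma> = -1 \<and> (- i) mod n = j mod n" for i j
  proof -
    have "cis (\<sigma> * (2 * a * of_int i)) = cis (2 * a * of_int j)"
      using that
    proof
      assume "\<sigma> = 1 \<and> i mod n = j mod n"
      then show ?thesis using cis_periodic_int[OF ndiv a, of i j] by simp
    next
      assume s: "\<sigma> = -1 \<and> (- i) mod n = j mod n"
      then have "\<sigma> * (2 * a * of_int i) = 2 * a * of_int (- i)" by simp
      then show ?thesis using cis_periodic_int[OF ndiv a, of "- i" j] s by (simp only:)
    qed
    then show ?thesis unfolding cis_mult[symmetric] by (simp only: mult.commute)
  qed
  show ?thesis
  proof
    show "?P \<subseteq> sphere_bouquet m n"
    proof
      fix X assume "X \<in> ?P"
      then obtain i \<theta> x where X: "X = (cis (a + \<sigma> * (2 * a * of_int i)) * Complex (cos a) (\<epsilon> * (sin a * sin \<theta>)), of_real (sin a * cos \<theta>) * cis x)"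
        by blast
      define j where "j = nat ((if \<sigma> = 1 then i else - i) mod n)"
      have j: "int j < n" "int j = (if \<sigma> = 1 then i else - i) mod n" using ndiv by (simp_all add: j_def)
      have e: "cis (a + \<sigma> * (2 * a * of_int i)) = cis (2 * a * of_int (int j) + a)"
        by (rule per) (use sg j(2) in auto)
      define u where "u = Complex (cos a) (\<epsilon> * (sin a * sin \<theta>))"
      have "(norm u)^2 + (norm (of_real (sin a * cos \<theta>) * cis x))^2 = (cos a)^2 + (sin a)^2 * ((sin \<theta>)^2 + (cos \<theta>)^2)"
        by (simp only: u_def cmod_power2 norm_mult norm_cis norm_of_real power_mult_distrib sq complex.sel power2_abs mult_1 one_power2 mult_1_right ring_distribs add.assoc)
      then have nrm: "(norm u)^2 + (norm (of_real (sin a * cos \<theta>) * cis x))^2 = 1"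
        by (simp only: sin_cos_squared_add sin_cos_squared_add2 mult_1_right)
      have "e * u * cnj e = u" if "norm e = 1" for e :: complex
        using complex_norm_square[of e] that by (simp add: mult_ac)
      then have ec: "cis (2 * a * of_int (int j) + a) * u * cnj (cis (2 * a * of_nat j + a)) = u" by simp
      have "Re (cis (2 * a * of_int (int j) + a) * u * cnj (cis (2 * a * of_nat j + a))) = cos a"
        unfolding ec by (simp add: u_def)
      then show "X \<in> sphere_bouquet m n"
        unfolding sphere_bouquet_eq[OF mn a] X e u_def[symmetric] using nrm j(1) by (auto simp: norm_mult)
    qed
    show "sphere_bouquet m n \<subseteq> ?P"
    proof
      fix X assume "X \<in> sphere_bouquet m n"
      then obtain w1 w2 j where X: "X = (w1, w2)" "(norm w1)^2 + (norm w2)^2 = 1"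
        and j: "int j < n" "Re (w1 * cnj (cis (2 * a * of_nat j + a))) = cos a"
        unfolding sphere_bouquet_eq[OF mn a] by auto
      define e where "e = cis (2 * a * of_nat j + a)"
      define \<tau> where "\<tau> = Im (w1 * cnj e)"
      have we: "w1 * cnj e = Complex (cos a) \<tau>" using j(2) by (simp add: e_def \<tau>_def complex_eq_iff)
      have w1: "w1 = e * Complex (cos a) \<tau>"
        unfolding we[symmetric] by (simp add: e_def cis_cnj mult.commute[of w1] mult.assoc[symmetric] cis_mult)
      have "norm w1 = norm (w1 * cnj e)" unfolding e_def norm_mult_cis ..
      then have "(norm w1)^2 = (cos a)^2 + \<tau>^2" unfolding we by (simp add: cmod_power2)
      then have w2: "(norm w2)^2 = (sin a)^2 - \<tau>^2" using X(2) sin_cos_squared_add[of a] by linarith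
      then have "\<tau>^2 \<le> (sin a)^2" by (metis diff_ge_0_iff_ge zero_le_power2)
      then have "\<bar>\<tau>\<bar> \<le> sin a" using sa by (simp add: abs_le_square_iff[symmetric])
      then have t1: "\<bar>\<tau> / sin a\<bar> \<le> 1" using sa by simp
      define \<theta> where "\<theta> = arcsin (\<epsilon> * (\<tau> / sin a))"
      have ct: "\<bar>\<epsilon> * (\<tau> / sin a)\<bar> \<le> 1" using t1 sg by (auto simp: abs_mult)
      then have th: "\<bar>\<theta>\<bar> \<le> pi / 2" "sin \<theta> = \<epsilon> * (\<tau> / sin a)"
      proof -
        have "-1 \<le> \<epsilon> * (\<tau> / sin a)" "\<epsilon> * (\<tau> / sin a) \<le> 1" using ct by linarith+
        from arcsin_bounded[OF this] sin_arcsin[OF this] show "\<bar>\<theta>\<bar> \<le> pi / 2" "sin \<theta> = \<epsilon> * (\<tau> / sin a)"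
          unfolding \<theta>_def by linarith+
      qed
      have im: "\<epsilon> * (sin a * sin \<theta>) = \<tau>" using sa sq(2) unfolding th(2) by (simp add: power2_eq_square mult.assoc[symmetric])
      have "(sin a * cos \<theta>)^2 = (sin a)^2 - (\<epsilon> * (sin a * sin \<theta>))^2"
        unfolding power_mult_distrib sq(2) cos_squared_eq by (simp add: algebra_simps)
      then have "(sin a * cos \<theta>)^2 = (norm w2)^2" unfolding im w2 .
      moreover have "0 \<le> sin a * cos \<theta>" using sa th(1) cos_ge_zero[of \<theta>] by (auto simp: abs_le_iff)
      ultimately have r: "sin a * cos \<theta> = norm w2" by (simp add: power2_eq_iff_nonneg)
      have w2': "w2 = of_real (sin a * cos \<theta>) * cis (Arg w2)"
        unfolding r using cis_Arg[of w2] by (cases "w2 = 0") (simp_all add: sgn_div_norm scaleR_conv_of_real)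
      define i :: int where "i = (if \<sigma> = 1 then int j else - int j)"
      have "cis (a + \<sigma> * (2 * a * of_int i)) = cis (2 * a * of_int (int j) + a)"
        by (rule per) (use sg in \<open>auto simp: i_def\<close>)
      then have ce: "cis (a + \<sigma> * (2 * a * of_int i)) = e" by (simp add: e_def)
      have "X = (cis (a + \<sigma> * (2 * a * of_int i)) * Complex (cos a) (\<epsilon> * (sin a * sin \<theta>)), of_real (sin a * cos \<theta>) * cis (Arg w2))"
        unfolding ce im X(1) by (simp only: w1 w2'[symmetric])
      then show "X \<in> ?P" using th(1) by blast
    qed
  qed
qed

section \<open>Convergence\<close>

lemma profile_shift_int:
  assumes "p \<noteq> 0" "\<bar>p\<bar> \<le> 1" "\<bar>h\<bar> < 1" "h \<noteq> p" and M: "monodromy p h = cis x"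
  shows "profile p h (\<theta> + of_int j * pi) = cis (x * of_int j) * profile p h \<theta>"
proof (cases "0 \<le> j")
  case True
  then obtain n where n: "j = int n" using zero_le_imp_eq_int by blast
  show ?thesis using profile_shift[OF assms(1-4), of \<theta> n]
    unfolding n M Complex.DeMoivre by (simp add: mult.commute)
next
  case False
  then obtain n where n: "j = - int n" by (metis int_cases2 nle_le of_nat_0_le_iff)
  have "profile p h (\<theta> + of_int j * pi + of_nat n * pi) = cis (of_nat n * x) * profile p h (\<theta> + of_int j * pi)"
    using profile_shift[OF assms(1-4), of "\<theta> + of_int j * pi" n] unfolding M Complex.DeMoivre .
  moreover have "\<theta> + of_int j * pi + of_nat n * pi = \<theta>" by (simp add: n)
  ultimately have "cis (- (of_nat n * x)) * profile p h \<theta> = cis (- (of_nat n * x)) * cis (of_nat n * x) * profile p h (\<theta> + of_int j * pi)"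
    by simp
  then show ?thesis by (simp add: cis_mult n mult.commute)
qed

lemma ampl_dn_shift_int: "ampl_dn p (\<theta> + of_int j * pi) = ampl_dn p \<theta>"
proof -
  have s: "sin (of_int j * pi) = 0" using sin_zero_iff_int2 by blast
  then have "(cos (of_int j * pi))^2 = 1" by (simp add: cos_squared_eq)
  then have "(sin (\<theta> + of_int j * pi))^2 = (sin \<theta>)^2"
    by (simp add: sin_add s power_mult_distrib)
  then show ?thesis by (simp add: ampl_dn_def)
qed

lemma reduce_angle: "\<exists>j \<theta>'. \<theta> = \<theta>' + of_int j * pi \<and> \<bar>\<theta>'\<bar> \<le> pi / 2"
proof (intro exI conjI)
  let ?j = "round (\<theta> / pi)"
  show "\<theta> = (\<theta> - of_int ?j * pi) + of_int ?j * pi" by simp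
  have "\<bar>of_int ?j - \<theta> / pi\<bar> * pi \<le> 1 / 2 * pi"
    by (intro mult_right_mono of_int_round_abs_le) auto
  then have "\<bar>(of_int ?j - \<theta> / pi) * pi\<bar> \<le> pi / 2" by (simp add: abs_mult)
  moreover have "(of_int ?j - \<theta> / pi) * pi = - (\<theta> - of_int ?j * pi)" by (simp add: algebra_simps)
  ultimately show "\<bar>\<theta> - of_int ?j * pi\<bar> \<le> pi / 2" by (simp only: abs_minus_cancel)
qed

text \<open>Every amplitude is \<open>\<theta> + j * pi\<close> with |\<theta>| <= pi/2. The shift
  keeps the radius and rotates the profile by the j-th power of the monodromy, so a single arc and
  its rotated copies sweep out the image.\<close>

lemma surface_image_param:
  assumes ph: "p \<noteq> 0" "\<bar>p\<bar> \<le> 1" "\<bar>h\<bar> < 1" "h \<noteq> p" and M: "monodromy p h = cis x0"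
    and nf: "\<And>x \<theta>. A (f (x, ampl_F p \<theta>)) = (profile p h \<theta>, of_real (r * ampl_dn p \<theta>) * cis (c * x))" and c: "c \<noteq> 0"
  shows "A ` range f = {(cis (x0 * of_int j) * profile p h \<theta>, of_real (r * ampl_dn p \<theta>) * cis x) |j \<theta> x. \<bar>\<theta>\<bar> \<le> pi / 2}"
    (is "_ = ?P")
proof
  show "A ` range f \<subseteq> ?P"
  proof
    fix X assume "X \<in> A ` range f"
    then obtain x y where X: "X = A (f (x, y))" by auto
    obtain \<theta>0 where y: "ampl_F p \<theta>0 = y" using ampl_F_surj[OF ph(1,2)] by blast
    obtain j \<theta> where j: "\<theta>0 = \<theta> + of_int j * pi" "\<bar>\<theta>\<bar> \<le> pi / 2" using reduce_angle by blast
    have "X = (cis (x0 * of_int j) * profile p h \<theta>, of_real (r * ampl_dn p \<theta>) * cis (c * x))"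
      unfolding X y[symmetric] nf j(1) profile_shift_int[OF ph M] ampl_dn_shift_int ..
    then show "X \<in> ?P" using j(2) by blast
  qed
  show "?P \<subseteq> A ` range f"
  proof
    fix X assume "X \<in> ?P"
    then obtain j \<theta> x where X: "X = (cis (x0 * of_int j) * profile p h \<theta>, of_real (r * ampl_dn p \<theta>) * cis x)" by blast
    have "c * (x / c) = x" using c by simp
    then have "A (f (x / c, ampl_F p (\<theta> + of_int j * pi))) = X"
      unfolding X nf profile_shift_int[OF ph M] ampl_dn_shift_int by simp
    then show "X \<in> A ` range f" by blast
  qed
qed

text \<open>The orbit speed contributes 4 |p|. Replacing dn by cos contributes |p|, since dn^2 -
  cos^2 = p^2 sin^2.\<close>

lemma radius_close:
  assumes "\<bar>p\<bar> \<le> 1/4" "\<bar>h\<bar> < 1" "\<bar>\<theta>\<bar> \<le> pi / 2"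
  shows "\<bar>sqrt (1 - h^2) / orbit_speed p h * ampl_dn p \<theta> - s * cos \<theta>\<bar> \<le> 5 * \<bar>p\<bar> + \<bar>sqrt (1 - h^2) - s\<bar>"
proof -
  define S c d where "S = sqrt (1 - h^2)" and "c = orbit_speed p h" and "d = ampl_dn p \<theta>"
  have p1: "\<bar>p\<bar> \<le> 1" using assms(1) by simp
  have "0 < 1 - h^2" using assms(2) by (simp add: abs_square_less_1)
  then have S: "0 \<le> S" "S \<le> 1" by (auto simp: S_def)
  have c: "\<bar>1 / c - 1\<bar> \<le> 4 * \<bar>p\<bar>" using orbit_speed_small[OF assms(1,2)] by (simp add: c_def)
  have d: "0 \<le> d" "d \<le> 1" using ampl_dn_nonneg ampl_dn_le_1[OF p1] by (auto simp: d_def)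
  have cos: "0 \<le> cos \<theta>" "cos \<theta> \<le> 1" using assms(3) by (auto intro!: cos_ge_zero simp: abs_le_iff)
  have dc: "\<bar>d - cos \<theta>\<bar> \<le> \<bar>p\<bar>"
  proof -
    have "cos \<theta> \<le> d" using ampl_dn_ge_cos[of \<theta> p] cos by (simp add: d_def)
    moreover have "d \<le> cos \<theta> + \<bar>p\<bar>"
    proof (rule power2_le_imp_le)
      have "p^2 * (sin \<theta>)^2 \<le> p^2 * 1" by (intro mult_left_mono) (auto simp: abs_square_le_1)
      moreover have "0 \<le> 2 * cos \<theta> * \<bar>p\<bar>" using cos by simp
      ultimately show "d^2 \<le> (cos \<theta> + \<bar>p\<bar>)^2" unfolding d_def ampl_dn_square power2_sum power2_abs by linarith
    qed (use cos in simp)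
    ultimately show ?thesis by linarith
  qed
  have "S / c * d - s * cos \<theta> = S * d * (1 / c - 1) + S * (d - cos \<theta>) + (S - s) * cos \<theta>"
    by (simp add: algebra_simps)
  also have "\<bar>\<dots>\<bar> \<le> \<bar>S * d * (1 / c - 1)\<bar> + \<bar>S * (d - cos \<theta>)\<bar> + \<bar>(S - s) * cos \<theta>\<bar>" by linarith
  also have "\<bar>S * d * (1 / c - 1)\<bar> \<le> 1 * 1 * (4 * \<bar>p\<bar>)"
    unfolding abs_mult using S d c by (intro mult_mono) auto
  also have "\<bar>S * (d - cos \<theta>)\<bar> \<le> 1 * \<bar>p\<bar>"
    unfolding abs_mult using S dc by (intro mult_mono) auto
  also have "\<bar>(S - s) * cos \<theta>\<bar> \<le> \<bar>S - s\<bar> * 1"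
    unfolding abs_mult using cos by (intro mult_mono) auto
  finally show ?thesis by (simp add: S_def c_def d_def)
qed

text \<open>The monodromy carries the end of the arc at -pi/2 to the end at pi/2. These ends are
  within 180 sqrt |p| of the conjugate of \<open>\<mu>\<close> and of \<open>\<mu>\<close>, and
  |\<mu>| = 1, so the multiplier is close to \<open>\<mu>\<close> divided by its conjugate, which is
  \<mu>^2.\<close>

lemma monodromy_close:
  assumes ph: "p \<noteq> 0" "\<bar>p\<bar> \<le> 1/4" "\<bar>h\<bar> < 1" "h \<noteq> p" and M: "norm (monodromy p h) = 1"
  shows "norm (monodromy p h - (Complex h (sqrt (1 - h^2)))^2) \<le> 360 * sqrt \<bar>p\<bar>"
proof -
  define \<mu> where "\<mu> = Complex h (sqrt (1 - h^2))"
  define P Q m where "P = profile p h (pi / 2)" and "Q = profile p h (- (pi / 2))" and "m = monodromy p h"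
  have h2: "0 \<le> 1 - h^2" using ph(3) by (simp add: abs_square_le_1)
  have "(norm \<mu>)^2 = 1" using h2 by (simp add: \<mu>_def cmod_power2)
  then have mu: "\<mu> * cnj \<mu> = 1" using complex_norm_square[of \<mu>] by simp
  have nmu: "norm \<mu> = 1" using \<open>(norm \<mu>)^2 = 1\<close> by (simp add: power2_eq_1_iff) (metis norm_ge_zero not_one_le_zero le_minus_one_simps(3) order_trans)
  have 1: "norm (P - \<mu>) \<le> 180 * sqrt \<bar>p\<bar>"
    using profile_close[OF ph, of "pi / 2"] by (simp add: P_def \<mu>_def)
  have "cnj \<mu> = Complex h (sqrt (1 - h^2) * sin (- (pi / 2)))" by (simp add: \<mu>_def complex_eq_iff)
  then have 2: "norm (Q - cnj \<mu>) \<le> 180 * sqrt \<bar>p\<bar>"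
    using profile_close[OF ph, of "- (pi / 2)"] by (simp add: Q_def)
  have "P = m * Q"
    using profile_periodic[OF ph(1) _ ph(3,4), of "- (pi / 2)"] ph(2) by (simp add: P_def Q_def m_def)
  then have "m * cnj \<mu> - \<mu> = m * (cnj \<mu> - Q) + (P - \<mu>)" by (simp add: algebra_simps)
  moreover have "m - \<mu>^2 = (m * cnj \<mu> - \<mu>) * \<mu>"
    using mu by (simp add: left_diff_distrib mult.assoc power2_eq_square mult.commute[of "cnj \<mu>"])
  ultimately have "norm (m - \<mu>^2) = norm (m * (cnj \<mu> - Q) + (P - \<mu>))"
    by (simp only: norm_mult nmu mult_1_right)
  also have "\<dots> \<le> norm (m * (cnj \<mu> - Q)) + norm (P - \<mu>)" by (rule norm_triangle_ineq)
  also have "norm (m * (cnj \<mu> - Q)) = norm (Q - cnj \<mu>)" using M by (simp add: norm_mult m_def norm_minus_commute)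
  finally show ?thesis using 1 2 by (simp add: m_def \<mu>_def)
qed

text \<open>Extraction of a square root: the norm of \<mu>^2 - \<nu>^2 is the product of the
  distances from \<open>\<mu>\<close> to \<open>\<nu>\<close> and to its negative, so the smaller
  distance is at most the root of that norm. The imaginary parts need no sign because sqrt (1 - h^2)
  and sin a are both nonnegative.\<close>

lemma half_angle_sign:
  fixes \<sigma> :: real
  assumes h: "\<bar>h\<bar> < 1" and a: "0 < sin a" and \<sigma>: "\<sigma> \<in> {1, -1}"
  shows "\<exists>\<tau>\<in>{1, -1::real}. \<bar>h - \<tau> * cos a\<bar> \<le> sqrt (norm (cis (\<sigma> * (2 * a)) - (Complex h (sqrt (1 - h^2)))^2)) \<and>
     \<bar>sqrt (1 - h^2) - sin a\<bar> \<le> sqrt (norm (cis (\<sigma> * (2 * a)) - (Complex h (sqrt (1 - h^2)))^2))"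
proof -
  define \<mu> where "\<mu> = Complex h (sqrt (1 - h^2))"
  define \<nu> where "\<nu> = cis (\<sigma> * a)"
  define B where "B = norm (cis (\<sigma> * (2 * a)) - \<mu>^2)"
  have "\<nu>^2 = cis (\<sigma> * (2 * a))" unfolding \<nu>_def Complex.DeMoivre by (simp add: mult_ac)
  then have B: "B = norm (\<mu> - \<nu>) * norm (\<mu> + \<nu>)"
    unfolding B_def norm_mult[symmetric] norm_minus_commute[of _ "\<mu>^2"]
    by (simp add: power2_eq_square algebra_simps)
  have S: "0 \<le> sqrt (1 - h^2)" using h by (simp add: abs_square_le_1)
  define \<tau> :: real where "\<tau> = (if norm (\<mu> - \<nu>) \<le> norm (\<mu> + \<nu>) then 1 else - 1)"
  have \<tau>: "\<tau> \<in> {1, -1}" by (simp add: \<tau>_def)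
  have "norm (\<mu> - of_real \<tau> * \<nu>) * norm (\<mu> - of_real \<tau> * \<nu>) \<le> B"
    unfolding B \<tau>_def by (auto intro: mult_left_mono mult_right_mono)
  then have n: "norm (\<mu> - of_real \<tau> * \<nu>) \<le> sqrt B"
    by (intro real_le_rsqrt) (simp add: power2_eq_square)
  have re: "Re (\<mu> - of_real \<tau> * \<nu>) = h - \<tau> * cos a"
    using \<sigma> by (auto simp: \<mu>_def \<nu>_def)
  have im: "Im (\<mu> - of_real \<tau> * \<nu>) = sqrt (1 - h^2) - \<tau> * \<sigma> * sin a"
    using \<sigma> by (auto simp: \<mu>_def \<nu>_def)
  have "\<bar>h - \<tau> * cos a\<bar> \<le> sqrt B" using abs_Re_le_cmod[of "\<mu> - of_real \<tau> * \<nu>"] n re by linarith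
  moreover have *: "\<bar>sqrt (1 - h^2) - \<tau> * \<sigma> * sin a\<bar> \<le> sqrt B" using abs_Im_le_cmod[of "\<mu> - of_real \<tau> * \<nu>"] n im by linarith
  then have "\<bar>sqrt (1 - h^2) - sin a\<bar> \<le> sqrt B"
  proof -
    have "\<tau> * \<sigma> = 1 \<or> \<tau> * \<sigma> = - 1" using \<tau> \<sigma> by auto
    moreover have "\<bar>x - s\<bar> \<le> y" if "\<bar>x - e * s\<bar> \<le> y" "e = 1 \<or> e = - 1" "0 < s" "0 \<le> x" for x e s y :: real
    proof -
      have "e * s = s \<or> e * s = - s" using that(2) by auto
      then show ?thesis using that by linarith
    qed
    ultimately show ?thesis using * a S by blast
  qed
  ultimately show ?thesis using \<tau> unfolding B_def \<mu>_def by blast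
qed

text \<open>The total error in \<open>surface_close\<close>: the terms of
  \<open>profile_close\<close> and \<open>radius_close\<close>, and three times the error of
  \<open>half_angle_sign\<close>, which enters through the real part, the imaginary part and the
  radius.\<close>

definition convergence_rate :: "real \<Rightarrow> real" where
  "convergence_rate x = 180 * sqrt x + 5 * x + 3 * sqrt (360 * sqrt x)"

lemma convergence_rate_small:
  assumes "0 < \<epsilon>" shows "\<exists>\<delta>>0. \<forall>x. 0 \<le> x \<longrightarrow> x < \<delta> \<longrightarrow> convergence_rate x < \<epsilon>"
proof -
  have "isCont convergence_rate 0" unfolding convergence_rate_def[abs_def] by (intro continuous_intros)
  then have "(convergence_rate \<longlongrightarrow> convergence_rate 0) (nhds 0)" by (simp add: continuous_at tendsto_at_iff_tendsto_nhds)
  moreover have "convergence_rate 0 < \<epsilon>" using assms by (simp add: convergence_rate_def)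
  ultimately have "eventually (\<lambda>x. convergence_rate x < \<epsilon>) (nhds 0)" by (rule order_tendstoD(2))
  then obtain \<delta> where "\<delta> > 0" "\<And>x. dist x 0 < \<delta> \<Longrightarrow> convergence_rate x < \<epsilon>"
    unfolding eventually_nhds_metric by blast
  then show ?thesis by (intro exI[of _ \<delta>]) auto
qed

lemma orthogonal_transformation_rotate_fst:
  assumes "norm k = 1" shows "orthogonal_transformation (\<lambda>(w1, w2). (k * w1, w2) :: R4)"
proof -
  have "(k * x) \<bullet> (k * y) = x \<bullet> y" for x y :: complex
  proof -
    have k: "Re k * Re k + Im k * Im k = 1" using assms cmod_power2[of k] by (simp add: power2_eq_square)
    have "(k * x) \<bullet> (k * y) = (Re k * Re k + Im k * Im k) * (x \<bullet> y)"
      by (simp add: inner_complex_def algebra_simps)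
    then show ?thesis by (simp add: k)
  qed
  moreover have "linear (\<lambda>(w1, w2). (k * w1, w2) :: R4)"
    by (rule linearI) (auto simp: algebra_simps)
  ultimately show ?thesis by (auto simp: orthogonal_transformation_def)
qed

lemma dist_Pair_le: "dist (a, b) (c, d) \<le> dist a c + dist b d"
  unfolding dist_Pair_Pair by (rule sqrt_sum_squares_le_sum) auto

section \<open>Comparison of the surfaces of a family with the bouquet\<close>

context rotational_family_data
begin

text \<open>Surface and bouquet are parametrized by the same triples
  \<open>(j, \<theta>, y)\<close>, so a uniform bound on the distance of corresponding points bounds
  the Hausdorff distance.\<close>

lemma surface_close:
  assumes l: "0 < l0" "l0 < l2" and t: "t \<in> T - {b}" and hp: "h t \<noteq> p t" and small: "\<bar>q t\<bar> \<le> 1/4"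
  shows "\<exists>A. orthogonal_transformation A \<and>
     (\<forall>\<epsilon>>convergence_rate \<bar>q t\<bar>. hausdorff_close \<epsilon> (A ` range (f t)) (sphere_bouquet l0 l2))"
proof -
  define a where "a = pi * of_int l0 / of_int l2"
  have tT: "t \<in> T" using t by simp
  have a: "0 < a" "a < pi" using bouquet_angle[OF l] by (auto simp: a_def)
  then have sa: "0 < sin a" by (rule sin_gt_zero)
  obtain \<sigma> where \<sigma>: "\<sigma> \<in> {1, -1::real}" and M: "monodromy (p t) (h t) = cis (\<sigma> * (2 * a))"
  proof -
    obtain \<sigma> where "\<sigma> \<in> {1, -1::real}" "monodromy (p t) (h t) = cis (\<sigma> * (2 * pi * of_int l0 / of_int l2))"
      using monodromy_value tT by blast
    moreover have "2 * pi * of_int l0 / of_int l2 = 2 * a" by (simp add: a_def)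
    ultimately show thesis using that by metis
  qed
  note ph = p_bounds[OF tT] h_bound[OF tT] hp
  have pq: "\<bar>p t\<bar> = \<bar>q t\<bar>" by (rule abs_p[OF tT])
  have p4: "\<bar>p t\<bar> \<le> 1/4" using small pq by simp
  define S c x where "S = sqrt (1 - (h t)^2)" and "c = orbit_speed (p t) (h t)" and "x = \<bar>q t\<bar>"
  define B where "B = sqrt (360 * sqrt x)"
  have "norm (cis (\<sigma> * (2 * a)) - (Complex (h t) S)^2) \<le> 360 * sqrt x"
    using monodromy_close[OF ph(1) p4 ph(3,4)] unfolding M S_def x_def pq by simp
  then have "sqrt (norm (cis (\<sigma> * (2 * a)) - (Complex (h t) S)^2)) \<le> B" unfolding B_def by simp
  then obtain \<tau> where \<tau>: "\<tau> \<in> {1, -1::real}" and hB: "\<bar>h t - \<tau> * cos a\<bar> \<le> B" and SB: "\<bar>S - sin a\<bar> \<le> B"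
    using half_angle_sign[OF ph(3) sa \<sigma>] unfolding S_def by fastforce
  obtain A where A: "orthogonal_transformation A"
     and nf: "\<And>x \<theta>. A (f t (x, ampl_F (p t) \<theta>)) = (profile (p t) (h t) \<theta>, of_real (S * ampl_dn (p t) \<theta> / c) * cis (c * x))"
    using cmc_surface_normal_form[OF family(12)[OF tT] family(11)[OF tT] _ _ hp] unfolding S_def c_def p_def k_def h_def by blast
  have c: "c \<noteq> 0" using orbit_speed_square(2)[OF ph(3), of "p t"] by (simp add: c_def)
  have nf': "A (f t (x, ampl_F (p t) \<theta>)) = (profile (p t) (h t) \<theta>, of_real (S / c * ampl_dn (p t) \<theta>) * cis (c * x))" for x \<theta>
    unfolding nf by simp
  \<comment> \<open>The arc lies near the chord with real part \<open>\<tau> * cos a\<close>. The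
    factor \<open>\<tau>\<close> makes this real part positive or negative like cos a, and
    \<open>cis a\<close> turns the chord to the one joining the first two points of the
    bouquet.\<close>
  define \<kappa> where "\<kappa> = of_real \<tau> * cis a"
  have nk: "norm \<kappa> = 1" using \<tau> by (auto simp: \<kappa>_def norm_mult)
  define R where "R = (\<lambda>(w1, w2). (\<kappa> * w1, w2) :: R4)"
  have RA: "orthogonal_transformation (R \<circ> A)"
    unfolding R_def by (rule orthogonal_transformation_compose[OF orthogonal_transformation_rotate_fst[OF nk] A])
  define F where "F j \<theta> y = (\<kappa> * (cis (\<sigma> * (2 * a) * of_int j) * profile (p t) (h t) \<theta>),
      complex_of_real (S / c * ampl_dn (p t) \<theta>) * cis y)" for j :: int and \<theta> y
  define G where "G j \<theta> y = (cis (a + \<sigma> * (2 * a * of_int j)) * Complex (cos a) (\<tau> * (sin a * sin \<theta>)),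
      complex_of_real (sin a * cos \<theta>) * cis y)" for j :: int and \<theta> y
  have imF: "(R \<circ> A) ` range (f t) = {F j \<theta> y |j \<theta> y. \<bar>\<theta>\<bar> \<le> pi / 2}"
  proof -
    have "(R \<circ> A) ` range (f t) = R ` (A ` range (f t))" by (simp add: image_comp)
    also have "\<dots> = {F j \<theta> y |j \<theta> y. \<bar>\<theta>\<bar> \<le> pi / 2}"
      unfolding surface_image_param[where A = A and f = "f t" and r = "S / c" and c = c, OF ph M nf' c] R_def F_def by force
    finally show ?thesis .
  qed
  have imG: "sphere_bouquet l0 l2 = {G j \<theta> y |j \<theta> y. \<bar>\<theta>\<bar> \<le> pi / 2}"
    unfolding G_def by (rule sphere_bouquet_param[OF l a_def \<sigma> \<tau>])
  have close: "dist (F j \<theta> y) (G j \<theta> y) \<le> convergence_rate x" if \<theta>: "\<bar>\<theta>\<bar> \<le> pi / 2" for j \<theta> y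
  proof -
    let ?P = "profile (p t) (h t) \<theta>" and ?C = "Complex (cos a) (\<tau> * (sin a * sin \<theta>))"
    let ?e = "cis (a + \<sigma> * (2 * a * of_int j))"
    have "\<kappa> * (cis (\<sigma> * (2 * a) * of_int j) * ?P) - ?e * ?C = ?e * (of_real \<tau> * ?P - ?C)"
      unfolding \<kappa>_def cis_mult[symmetric] by (simp add: algebra_simps)
    also have "\<dots> = ?e * (of_real \<tau> * (?P - of_real \<tau> * ?C))"
    proof -
      have "complex_of_real \<tau> * of_real \<tau> = 1" using \<tau> by auto
      then show ?thesis by (simp add: right_diff_distrib mult.assoc[symmetric])
    qed
    finally have "dist (\<kappa> * (cis (\<sigma> * (2 * a) * of_int j) * ?P)) (?e * ?C) = norm (?P - of_real \<tau> * ?C)"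
      using \<tau> by (auto simp: dist_norm norm_mult)
    also have "\<dots> \<le> norm (?P - Complex (h t) (S * sin \<theta>)) + norm (Complex (h t) (S * sin \<theta>) - of_real \<tau> * ?C)"
      unfolding dist_norm[symmetric] by (rule dist_triangle)
    finally have 0: "dist (\<kappa> * (cis (\<sigma> * (2 * a) * of_int j) * ?P)) (?e * ?C)
        \<le> norm (?P - Complex (h t) (S * sin \<theta>)) + norm (Complex (h t) (S * sin \<theta>) - of_real \<tau> * ?C)" .
    have 1: "norm (?P - Complex (h t) (S * sin \<theta>)) \<le> 180 * sqrt x"
      using profile_close[OF ph(1) p4 ph(3,4) \<theta>] unfolding S_def x_def pq .
    have 2: "norm (Complex (h t) (S * sin \<theta>) - of_real \<tau> * ?C) \<le> B + B"
    proof -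
      have "\<tau> * \<tau> = 1" using \<tau> by auto
      then have im: "Im (Complex (h t) (S * sin \<theta>) - of_real \<tau> * ?C) = (S - sin a) * sin \<theta>"
        by (simp add: mult.assoc[symmetric] left_diff_distrib)
      have "\<bar>(S - sin a) * sin \<theta>\<bar> \<le> B * 1"
        unfolding abs_mult using SB by (intro mult_mono) auto
      then show ?thesis
        using cmod_le[of "Complex (h t) (S * sin \<theta>) - of_real \<tau> * ?C"] hB unfolding im by simp
    qed
    have "dist (complex_of_real (S / c * ampl_dn (p t) \<theta>) * cis y) (complex_of_real (sin a * cos \<theta>) * cis y)
        = \<bar>S / c * ampl_dn (p t) \<theta> - sin a * cos \<theta>\<bar>"
      unfolding dist_norm left_diff_distrib[symmetric] norm_mult of_real_diff[symmetric] norm_of_real by simp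
    also have "\<dots> \<le> 5 * x + B"
      using radius_close[OF p4 ph(3) \<theta>, of "sin a"] SB unfolding S_def[symmetric] c_def[symmetric] x_def pq by linarith
    finally have 3: "dist (complex_of_real (S / c * ampl_dn (p t) \<theta>) * cis y) (complex_of_real (sin a * cos \<theta>) * cis y) \<le> 5 * x + B" .
    have "dist (F j \<theta> y) (G j \<theta> y) \<le> (180 * sqrt x + (B + B)) + (5 * x + B)"
      unfolding F_def G_def using order_trans[OF dist_Pair_le add_mono[OF order_trans[OF 0 add_mono[OF 1 2]] 3]] .
    then show ?thesis by (simp add: convergence_rate_def B_def)
  qed
  have "hausdorff_close \<epsilon> ((R \<circ> A) ` range (f t)) (sphere_bouquet l0 l2)" if \<epsilon>: "convergence_rate x < \<epsilon>" for \<epsilon>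
    unfolding hausdorff_close_def imF imG
  proof (intro conjI ballI)
    fix X assume "X \<in> {F j \<theta> y |j \<theta> y. \<bar>\<theta>\<bar> \<le> pi / 2}"
    then obtain j \<theta> y where "X = F j \<theta> y" "\<bar>\<theta>\<bar> \<le> pi / 2" by blast
    then show "\<exists>Y\<in>{G j \<theta> y |j \<theta> y. \<bar>\<theta>\<bar> \<le> pi / 2}. dist X Y < \<epsilon>"
      using close[of \<theta> j y] \<epsilon> by (intro bexI[of _ "G j \<theta> y"]) auto
  next
    fix Y assume "Y \<in> {G j \<theta> y |j \<theta> y. \<bar>\<theta>\<bar> \<le> pi / 2}"
    then obtain j \<theta> y where "Y = G j \<theta> y" "\<bar>\<theta>\<bar> \<le> pi / 2" by blast
    then show "\<exists>X\<in>{F j \<theta> y |j \<theta> y. \<bar>\<theta>\<bar> \<le> pi / 2}. dist X Y < \<epsilon>"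
      using close[of \<theta> j y] \<epsilon> by (intro bexI[of _ "F j \<theta> y"]) auto
  qed
  then show ?thesis using RA unfolding x_def by blast
qed

text \<open>At most one parameter other than \<open>b\<close> has \<open>h = p\<close>; it has |q| >
  0 and is left behind once |q| falls below that value.\<close>

lemma eventually_h_neq_p: "\<exists>\<delta>>0. \<forall>t\<in>T - {b}. \<bar>q t\<bar> < \<delta> \<longrightarrow> h t \<noteq> p t"
proof (cases "\<exists>t\<in>T - {b}. h t = p t")
  case True
  then obtain s where s: "s \<in> T - {b}" "h s = p s" by blast
  show ?thesis
  proof (intro exI[of _ "\<bar>q s\<bar>"] conjI ballI impI notI)
    show "0 < \<bar>q s\<bar>" using family(8)[OF s(1)] by simp
    fix t assume t: "t \<in> T - {b}" "\<bar>q t\<bar> < \<bar>q s\<bar>" "h t = p t"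
    then have "t = s" using zero_unique[OF t(1) s(1) t(3) s(2)] by simp
    then show False using t(2) by simp
  qed
next
  case False
  then show ?thesis by (intro exI[of _ 1]) auto
qed

end

theorem lemma4p4:
  fixes l0 l2 :: int
    and T :: "real set" and b :: real
    and q \<theta>1 \<theta>2 :: "real \<Rightarrow> real"
    and f :: "real \<Rightarrow> real \<times> real \<Rightarrow> R4"
  assumes "coprime l0 l2" and "0 < l0" and "l0 < l2"
    and "rotational_family l0 l2 T b q \<theta>1 \<theta>2 f"
  shows "\<exists>A :: real \<Rightarrow> R4 \<Rightarrow> R4.
           (\<forall>t\<in>T. orthogonal_transformation (A t)) \<and>
           (\<forall>\<epsilon>>0. \<exists>\<delta>>0. \<forall>t\<in>T. \<bar>q t\<bar> < \<delta> \<longrightarrow>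
              hausdorff_close \<epsilon> (A t ` range (f t)) (sphere_bouquet l0 l2))"
proof -
  interpret rotational_family_data l0 l2 T b q \<theta>1 \<theta>2 f
    using assms by unfold_locales auto
  \<comment> \<open>For parameters outside the range of \<open>surface_close\<close> any isometry
    will do, as the choice of \<delta> below excludes them.\<close>
  have "\<exists>A. orthogonal_transformation A \<and> (t \<noteq> b \<and> h t \<noteq> p t \<and> \<bar>q t\<bar> \<le> 1/4 \<longrightarrow>
     (\<forall>\<epsilon>>convergence_rate \<bar>q t\<bar>. hausdorff_close \<epsilon> (A ` range (f t)) (sphere_bouquet l0 l2)))" if "t \<in> T" for t
  proof (cases "t \<noteq> b \<and> h t \<noteq> p t \<and> \<bar>q t\<bar> \<le> 1/4")
    case True
    then show ?thesis using surface_close[OF assms(2,3), of t] that by blast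
  next
    case False
    have "orthogonal_transformation (\<lambda>x::R4. x)" by simp
    then show ?thesis using False by blast
  qed
  then obtain A where A: "\<And>t. t \<in> T \<Longrightarrow> orthogonal_transformation (A t)"
    "\<And>t \<epsilon>. t \<in> T \<Longrightarrow> t \<noteq> b \<Longrightarrow> h t \<noteq> p t \<Longrightarrow> \<bar>q t\<bar> \<le> 1/4 \<Longrightarrow> convergence_rate \<bar>q t\<bar> < \<epsilon> \<Longrightarrow>
       hausdorff_close \<epsilon> (A t ` range (f t)) (sphere_bouquet l0 l2)"
    by metis
  obtain \<delta>0 where \<delta>0: "0 < \<delta>0" "\<And>t. t \<in> T - {b} \<Longrightarrow> \<bar>q t\<bar> < \<delta>0 \<Longrightarrow> h t \<noteq> p t"
    using eventually_h_neq_p by blast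
  have qb: "\<bar>q b\<bar> = 1" using family(10) by (simp add: flat_torus_triple_def)
  show ?thesis
  proof (intro exI[of _ A] conjI ballI allI impI)
    show "orthogonal_transformation (A t)" if "t \<in> T" for t using A(1) that .
    fix \<epsilon> :: real assume "0 < \<epsilon>"
    then obtain \<delta>1 where \<delta>1: "0 < \<delta>1" "\<And>x. 0 \<le> x \<Longrightarrow> x < \<delta>1 \<Longrightarrow> convergence_rate x < \<epsilon>"
      using convergence_rate_small by blast
    show "\<exists>\<delta>>0. \<forall>t\<in>T. \<bar>q t\<bar> < \<delta> \<longrightarrow> hausdorff_close \<epsilon> (A t ` range (f t)) (sphere_bouquet l0 l2)"
    \<comment> \<open>The bound 1/4 is the range of the estimates and excludes \<open>b\<close>,
      where |q| = 1; \<open>\<delta>0\<close> excludes \<open>h = p\<close>, and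
      \<open>\<delta>1\<close> brings the rate below \<epsilon>.\<close>
    proof (intro exI[of _ "min (1/4) (min \<delta>0 \<delta>1)"] conjI ballI impI)
      show "0 < min (1/4) (min \<delta>0 \<delta>1)" using \<delta>0(1) \<delta>1(1) by simp
      fix t assume t: "t \<in> T" and q: "\<bar>q t\<bar> < min (1/4) (min \<delta>0 \<delta>1)"
      then have "t \<noteq> b" using qb by auto
      then show "hausdorff_close \<epsilon> (A t ` range (f t)) (sphere_bouquet l0 l2)"
        using t q \<delta>0(2)[of t] \<delta>1(2)[of "\<bar>q t\<bar>"] by (intro A(2)) auto
    qed
  qed
qed

end
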